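(* Let $\gamma$ be a primitive element of $\mathbb{F}_q$ and $\omega$ a primitive element of $\mathbb{F}_{q'}$, and let $\psi,\psi'$ be the canonical additive characters of $\mathbb{F}_q,\mathbb{F}_{q'}$. Let $J$ be the set of positive divisors of $k$ not divisible by $p_1^{e_1}$, let $J=J_1\sqcup J_2$ be a partition, and let $I\subseteq\{0,1,\dots,k-1\}$ satisfy: (i) $\sum_{i\in I}\zeta_k^{ij}=0$ for all $j\in J_1$; (ii) there is $\epsilon\in\{1,-1\}$, not depending on $j$, with $\vartheta_p(\chi_{P'}^{j},\chi_P^{j})=\epsilon$ for all $j\in J_2$; (iii) if $\ell\ge 2$ or $t\ge1$, then $G_{f'}(\chi_{P'}^{-p_1^{e_1+1}v})=\epsilon\, p^{\frac{\phi(k')-\phi(k)}{2e}}G_f(\chi_P^{-p_1^{e_1}v})$ for all $1\le v\le k/p_1^{e_1}-1$. Let \[ D=\bigcup_{i\in I}C_i^{(k,q)},\qquad D'=\bigcup_{i\in I}\bigcup_{j=0}^{p_1-1}C^{(kp_1,q')}_{ip_1+jk/p_1^{e_1}}, \] where $C_i^{(k,q)}=\gamma^i\langle\gamma^k\rangle$ and $C_i^{(kp_1,q')}=\omega^i\langle\omega^{kp_1}\rangle$ (indices modulo $k$, resp. $kp_1$). If the set $\{\psi(\gamma^aD):a=0,1,\dots,q-2\}$ has exactly two elements, then the set $\{\psi'(\omega^aD'):a=0,1,\dots,q'-2\}$ has exactly two elements. (Here $\psi(S)=\sum_{x\in S}\psi(x)$.)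
   Context: Let $h=2^tp_1p_2\cdots p_\ell$ with $t\ge0$ and $p_1,\dots,p_\ell$ distinct odd primes, and let $p$ be a prime, $p\nmid h$, such that for every divisor $d=2^sp_{i_1}\cdots p_{i_m}$ of $h$, if $\langle p\rangle$ has index $u$ in $(\mathbb{Z}/d\mathbb{Z})^\ast$ then it has index $u$ in $(\mathbb{Z}/d'\mathbb{Z})^\ast$ for every $d'=2^sp_{i_1}^{x_1}\cdots p_{i_m}^{x_m}$ with all $x_i\ge1$. Let $e=[(\mathbb{Z}/h\mathbb{Z})^\ast:\langle p\rangle]$. Let $k=2^tp_1^{e_1}\cdots p_\ell^{e_\ell}$ with all $e_i\ge1$, $k'=kp_1$, $f=\phi(k)/e$, $f'=\phi(k')/e$ ($\phi$ Euler's function; these are the orders of $p$ modulo $k$ and $k'$), $q=p^f$, $q'=p^{f'}$. Write $\zeta_n=e^{2\pi i/n}$. Let $P'$ be a prime ideal of $\mathbb{Z}[\zeta_{k'}]$ lying over $p$ and $P=P'\cap\mathbb{Z}[\zeta_k]$; identify $\mathbb{F}_q=\mathbb{Z}[\zeta_k]/P$ and $\mathbb{F}_{q'}=\mathbb{Z}[\zeta_{k'}]/P'$. The Teichmüller character $\chi_P$ is defined by letting $\chi_P(\alpha+P)$ be the unique power of $\zeta_k$ congruent to $\alpha^{(q-1)/k}$ modulo $P$ for $\alpha\notin P$ (and $0$ for $\alpha\in P$); $\chi_{P'}$ is defined analogously with $k',q',P'$. For a finite field $\mathbb{F}_{p^r}$ with canonical additive character $\psi(x)=\zeta_p^{\mathrm{Tr}_{\mathbb{F}_{p^r}/\mathbb{F}_p}(x)}$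 and a multiplicative character $\chi$, the Gauss sum is $G_r(\chi)=\sum_{x\in\mathbb{F}_{p^r}^\ast}\chi(x)\psi(x)$. For nontrivial multiplicative characters $\chi$ of $\mathbb{F}_{p^r}$ and $\chi'$ of $\mathbb{F}_{p^{r'}}$ with $r\mid r'$, the relative Gauss sum is $\vartheta_p(\chi',\chi)=G_{r'}(\chi')/(p^{(r'-r)/2}G_r(\chi))$.
   Formalization: The primitive elements γ and ω are additionally assumed compatible, χ_{P'}(ω)^{p_1} = χ_P(γ) (true e.g. if γ is the norm of ω); for independent γ, ω the claim fails, e.g. p=2, k=7, k'=49, I={1,2,4}. *)

theory Defs
  imports
    Complex_Main
    "HOL-Computational_Algebra.Polynomial"
    "HOL-Number_Theory.Residues"
    "HOL-Algebra.QuotRing"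
    "HOL-Algebra.Generated_Groups"
    "HOL-Algebra.Multiplicative_Group"
begin

text \<open>The index \<open>[(\<int>/n\<int>)\<^sup>* : \<langle>p\<rangle>]\<close>, for \<open>n \<ge> 2\<close> coprime to \<open>p\<close>.  (For \<open>n = 1\<close> the library's
  \<^const>\<open>residue_ring\<close> is not a ring, since its unit element is \<open>1\<close> rather than \<open>1 mod n\<close>; the
  value is then a junk value.)\<close>

definition unit_index :: "nat \<Rightarrow> nat \<Rightarrow> nat" where
  "unit_index n p =
    (let G = units_of (residue_ring (int n))
     in card (rcosets\<^bsub>G\<^esub> (generate G {int p mod int n})))"

text \<open>\<open>\<zeta>\<^sub>n = exp (2\<pi>\<i>/n)\<close> and the ring \<open>\<int>[\<zeta>\<^sub>n]\<close> as a subring of the complex numbers.\<close>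

definition zeta :: "nat \<Rightarrow> complex" where
  "zeta n = cis (2 * pi / real n)"

definition cyclotomic_ring :: "nat \<Rightarrow> complex ring" where
  "cyclotomic_ring n =
    \<lparr>carrier = range (\<lambda>g :: int poly. poly (map_poly of_int g) (zeta n)),
     monoid.mult = (*), one = 1, zero = 0, add = (+)\<rparr>"

definition prime_ideal_over :: "nat \<Rightarrow> nat \<Rightarrow> complex set \<Rightarrow> bool" where
  "prime_ideal_over n p P \<longleftrightarrow>
    primeideal P (cyclotomic_ring n) \<and> {a :: int. of_int a \<in> P} = {a. int p dvd a}"

text \<open>Elements of \<open>\<int>[\<zeta>\<^sub>n]/P\<close> are cosets \<open>X = \<alpha> + P\<close>; the zero element is \<open>P\<close> itself.  Here \<open>q\<close> is
  the number of elements of the residue field.\<close>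

abbreviation residue_field :: "nat \<Rightarrow> complex set \<Rightarrow> complex set ring" where
  "residue_field n P \<equiv> cyclotomic_ring n Quot P"

definition teichmueller :: "nat \<Rightarrow> complex set \<Rightarrow> nat \<Rightarrow> complex set \<Rightarrow> complex" where
  "teichmueller n P q X =
    (if X = P then 0
     else THE z. z \<in> range (\<lambda>i :: nat. zeta n ^ i) \<and> (\<forall>\<alpha>\<in>X. \<alpha> ^ ((q - 1) div n) - z \<in> P))"

text \<open>In the following, \<open>F\<close> is a field with \<open>p ^ r\<close> elements, \<open>p\<close> prime.  The absolute trace
  \<open>x + x\<^sup>p + \<dots>\<close> takes values in the prime field, i.e. among the multiples \<open>m \<cdot> 1\<close> with
  \<open>0 \<le> m < p\<close>.\<close>

definition abs_trace :: "('a, 'b) ring_scheme \<Rightarrow> nat \<Rightarrow> nat \<Rightarrow> 'a \<Rightarrow> 'a" where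
  "abs_trace F p r x = (\<Oplus>\<^bsub>F\<^esub>i\<in>{..<r}. x [^]\<^bsub>F\<^esub> (p ^ i))"

definition add_char :: "('a, 'b) ring_scheme \<Rightarrow> nat \<Rightarrow> nat \<Rightarrow> 'a \<Rightarrow> complex" where
  "add_char F p r x =
    zeta p ^ (THE m :: nat. m < p \<and> [m] \<cdot>\<^bsub>F\<^esub> \<one>\<^bsub>F\<^esub> = abs_trace F p r x)"

definition gauss_sum ::
    "('a, 'b) ring_scheme \<Rightarrow> nat \<Rightarrow> nat \<Rightarrow> ('a \<Rightarrow> complex) \<Rightarrow> complex" where
  "gauss_sum F p r \<chi> = (\<Sum>x\<in>carrier F - {\<zero>\<^bsub>F\<^esub>}. \<chi> x * add_char F p r x)"

definition relative_gauss_sum ::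
    "nat \<Rightarrow> ('a, 'b) ring_scheme \<Rightarrow> nat \<Rightarrow> ('a \<Rightarrow> complex)
         \<Rightarrow> ('c, 'd) ring_scheme \<Rightarrow> nat \<Rightarrow> ('c \<Rightarrow> complex) \<Rightarrow> complex" where
  "relative_gauss_sum p F' r' \<chi>' F r \<chi> =
    gauss_sum F' p r' \<chi>' /
      (complex_of_real (real p powr ((real r' - real r) / 2)) * gauss_sum F p r \<chi>)"

text \<open>The power \<open>\<chi>\<^sup>j\<close>, \<open>j \<in> \<int>\<close>, of a multiplicative character.  Its value at zero is irrelevant, as
  Gauss sums run over nonzero elements only.\<close>

definition char_power :: "('a \<Rightarrow> complex) \<Rightarrow> int \<Rightarrow> 'a \<Rightarrow> complex" where
  "char_power \<chi> j x = \<chi> x powi j"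

definition primitive_element :: "('a, 'b) ring_scheme \<Rightarrow> 'a \<Rightarrow> bool" where
  "primitive_element F g \<longleftrightarrow>
    g \<in> carrier (mult_of F) \<and> generate (mult_of F) {g} = carrier (mult_of F)"

definition cyclotomic_class :: "('a, 'b) ring_scheme \<Rightarrow> 'a \<Rightarrow> nat \<Rightarrow> nat \<Rightarrow> 'a set" where
  "cyclotomic_class F g k i =
    (g [^]\<^bsub>F\<^esub> i) <#\<^bsub>mult_of F\<^esub> generate (mult_of F) {g [^]\<^bsub>F\<^esub> k}"

text \<open>The set \<open>{\<psi>(g\<^sup>a S) : a = 0, 1, \<dots>, q - 2}\<close> where \<open>\<psi>\<close> is the canonical additive character and
  \<open>\<psi>(T) = \<Sum>x\<in>T. \<psi>(x)\<close>.\<close>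

definition char_values ::
    "('a, 'b) ring_scheme \<Rightarrow> nat \<Rightarrow> nat \<Rightarrow> 'a \<Rightarrow> 'a set \<Rightarrow> complex set" where
  "char_values F p r g S =
    (\<lambda>a :: nat. \<Sum>x\<in>(g [^]\<^bsub>F\<^esub> a) <#\<^bsub>mult_of F\<^esub> S. add_char F p r x) ` {0..p ^ r - 2}"

text \<open>The choice of primitive elements \<open>\<gamma>\<close> of \<open>\<int>[\<zeta>\<^sub>k]/P\<close> and \<open>\<omega>\<close> of \<open>\<int>[\<zeta>\<^sub>k\<^sub>'] / P'\<close> used to
  number the cyclotomic classes has to be coherent, \<open>k' = k p\<^sub>1\<close>: the class of index \<open>p\<^sub>1\<close> of \<open>\<omega>\<close>
  must correspond to the class of index \<open>1\<close> of \<open>\<gamma>\<close>.  The relation below holds if \<open>\<gamma>\<close> is the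
  norm of \<open>\<omega>\<close>, and also if \<open>\<chi>\<^sub>P(\<gamma>) = \<zeta>\<^sub>k\<close> and \<open>\<chi>\<^sub>P\<^sub>'(\<omega>) = \<zeta>\<^sub>k\<^sub>'\<close>.

  It cannot be dropped from the theorem.  For \<open>p = 2\<close>, \<open>k = 7\<close>, \<open>k' = 49\<close> (so \<open>e = 2\<close>, \<open>q = 2\<^sup>3\<close>,
  \<open>q' = 2\<^sup>2\<^sup>1\<close>, \<open>J = J\<^sub>2 = {1}\<close>, \<open>\<epsilon> = 1\<close>) and \<open>I = {1,2,4}\<close>, if \<open>\<gamma>\<close> is a root of \<open>x\<^sup>3 + x + 1\<close> then
  \<open>D\<close> has the two values \<open>3\<close>, \<open>-1\<close>; if \<open>\<omega>\<close> is a root of \<open>x\<^sup>2\<^sup>1 + x\<^sup>2 + 1\<close> then \<open>D'\<close> has the three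
  values \<open>-1317\<close>, \<open>-293\<close>, \<open>731\<close>, whereas with \<open>\<omega>\<close> replaced by its inverse it has the two values
  \<open>-293\<close>, \<open>1755\<close>.\<close>

definition coherent_primitive_elements ::
    "('a \<Rightarrow> complex) \<Rightarrow> 'a \<Rightarrow> ('b \<Rightarrow> complex) \<Rightarrow> 'b \<Rightarrow> nat \<Rightarrow> bool" where
  "coherent_primitive_elements \<chi> \<gamma> \<chi>' \<omega> p1 \<longleftrightarrow> \<chi>' \<omega> ^ p1 = \<chi> \<gamma>"

end

theory Submission
  imports Defs "HOL-Computational_Algebra.Polynomial_Factorial" "HOL-Algebra.Polynomial_Divisibility"
    "HOL-Number_Theory.Number_Theory" "HOL-Algebra.Sylow"
begin

text \<open>
  Write \<open>n = p\<^sub>1\<close>, \<open>a = e\<^sub>1\<close>, \<open>w = k / n\<^sup>a\<close>, \<open>c = q powr ((n - 1) / 2)\<close>, and let \<open>G\<^sub>K j\<close> and \<open>G\<^sub>L j\<close> be the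
  Gauss sums of \<open>\<chi>\<^sub>P\<^sup>j\<close> and \<open>\<chi>\<^sub>P\<^sub>'\<^sup>j\<close>.  By Fourier inversion \<open>k \<psi>(\<gamma>\<^sup>b D)\<close> is the sum over \<open>j\<close> modulo \<open>k\<close> of
  \<open>G\<^sub>K(-j) \<xi>\<^sup>j\<^sup>b (\<Sum>i\<in>I. \<xi>\<^sup>i\<^sup>j)\<close> with \<open>\<xi> = \<chi>\<^sub>P(\<gamma>)\<close>, and similarly for \<open>D'\<close>.  The index hypothesis puts the
  kernel of \<open>(\<int>/k')\<^sup>* \<rightarrow> (\<int>/k)\<^sup>*\<close> into \<open>\<langle>p\<rangle>\<close>, so that \<open>G\<^sub>L\<close> has period \<open>k\<close> off the multiples of \<open>n\<^sup>a\<close>; then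
  only the sums \<open>G\<^sub>L j\<close> with \<open>\<not> n\<^sup>a dvd j\<close> or \<open>n\<^sup>a\<^sup>+\<^sup>1 dvd j\<close> survive in the expansion for \<open>D'\<close>.  Those are
  expressed by (ii) and (iii) through \<open>G\<^sub>K\<close>, where a Galois automorphism fixing \<open>\<zeta>\<^sub>p\<close> extends (i) and (ii)
  from divisors of \<open>k\<close> to all \<open>j\<close>.

  It remains to see that the unwanted signs and the change from \<open>j\<close> to \<open>n j\<close> amount to a translation of
  \<open>b\<close>.  Collecting the orbits of the \<open>q\<close>-Frobenius gives \<open>G\<^sub>L j \<equiv> \<chi>\<^sub>P\<^sub>'(n)\<^sup>-\<^sup>j G\<^sub>K j\<close> modulo \<open>1 - \<zeta>\<^sub>n\<close>, and by (ii),
  (iii) the two sides of the resulting congruences, as well as \<open>G\<^sub>L(n j) = (G\<^sub>K j)\<^sup>n\<close> by Davenport--Hasse,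
  yield numbers that satisfy one and the same equation \<open>u\<^sup>M\<^sup>+\<^sup>1 = C u\<close> with \<open>n\<close> dividing neither \<open>M\<close> nor \<open>C\<close>.
  Solutions of such an equation that are congruent modulo \<open>1 - \<zeta>\<^sub>n\<close> are equal.  Thus \<open>\<epsilon>\<close> and the quotients
  \<open>G\<^sub>K j / G\<^sub>K(n j)\<close> are powers of \<open>\<xi>\<close> linear in the exponent \<open>j\<close>, whence
  \<open>\<psi>'(\<omega>\<^sup>A D') = c \<psi>(\<gamma>\<^sup>b\<^sup>+\<^sup>s D) + const\<close> for a fixed \<open>s\<close>, whenever \<open>A + m w = n b\<close> with \<open>0 \<le> m < n\<close>.
\<close>

hide_const (open) UnivPoly.monom Polynomials.lead_coeff Polynomials.degree Divisibility.prime
  Divisibility.irreducible Ring_Divisibility.mult_of Order.top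

section \<open>Rings generated by a root of unity\<close>

text \<open>Restriction and norm pull apart here. The restriction of \<open>\<chi>'\<close> to the
  small field is \<open>\<chi>\<close>, whereas \<open>\<chi>\<close> composed with the norm is the
  n-th power of \<open>\<chi>'\<close>. Davenport--Hasse therefore reaches only the sums with
  exponent n j; the sums at exponent j itself, which (ii) speaks of, are tied to their counterparts
  over the small field only by a congruence. The factor \<open>\<chi>'\<close> (n) enters that
  congruence because the trace of an element x of the small field is n x. What makes the congruence
  strong enough is arithmetic modulo n: q is 1 modulo n, so c is 1 modulo 1 - zeta_n; n is odd, so c
  is an integer and Davenport--Hasse carries no sign; and as n divides neither M nor C, the
  polynomial X^(M+1) - C X remains separable modulo the primes above n. The form u^(M+1) = C u,
  rather than u^M = C, leaves room for Gauss sums that are not known to be nonzero. Both fields are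
  treated inside the large one, the small one being the fixed points of the q-Frobenius. A single
  character \<open>\<chi>\<close> and a single ring of algebraic integers then serve both
  sides.\<close>

definition int_adjoin :: "complex \<Rightarrow> complex set" where
  "int_adjoin x = range (\<lambda>g :: int poly. poly (map_poly of_int g) x)"

abbreviation ipoly :: "int poly \<Rightarrow> complex \<Rightarrow> complex" where
  "ipoly g x \<equiv> poly (map_poly of_int g) x"

lemma ipoly_pCons: "ipoly (pCons a g) x = of_int a + x * ipoly g x"
  by (simp add: map_poly_pCons)

lemma ipoly_add: "ipoly (f + g) x = ipoly f x + ipoly g x"
proof (induction f arbitrary: g)
  case (pCons a f)
  obtain b g' where g: "g = pCons b g'" by (cases g)
  show ?case unfolding g by (simp add: pCons.IH ipoly_pCons algebra_simps)
qed simp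

lemma ipoly_smult: "ipoly (Polynomial.smult a f) x = of_int a * ipoly f x"
  by (induction f) (simp_all add: ipoly_pCons algebra_simps)

lemma ipoly_minus: "ipoly (- f) x = - ipoly f x"
  using ipoly_smult[of "-1" f x] by simp

lemma ipoly_diff: "ipoly (f - g) x = ipoly f x - ipoly g x"
  using ipoly_add[of f "-g" x] by (simp add: ipoly_minus)

lemma ipoly_mult: "ipoly (f * g) x = ipoly f x * ipoly g x"
  by (induction f) (simp_all add: ipoly_pCons ipoly_add ipoly_smult algebra_simps)

lemma ipoly_monom: "ipoly (Polynomial.monom a n) x = of_int a * x ^ n"
  by (simp add: map_poly_monom poly_monom)

lemma ipoly_pcompose_monom: "ipoly (pcompose g (Polynomial.monom 1 r)) x = ipoly g (x ^ r)"
  by (induction g) (simp_all add: ipoly_pCons pcompose_pCons ipoly_add ipoly_mult ipoly_monom)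

lemma ipoly_in [intro, simp]: "ipoly g x \<in> int_adjoin x"
  by (auto simp: int_adjoin_def)

lemma int_adjoinE:
  assumes "a \<in> int_adjoin x" obtains g where "a = ipoly g x"
  using assms by (auto simp: int_adjoin_def)

lemma adj_add [intro]: "a \<in> int_adjoin x \<Longrightarrow> b \<in> int_adjoin x \<Longrightarrow> a + b \<in> int_adjoin x"
  by (metis int_adjoinE ipoly_add ipoly_in)

lemma adj_mult [intro]: "a \<in> int_adjoin x \<Longrightarrow> b \<in> int_adjoin x \<Longrightarrow> a * b \<in> int_adjoin x"
  by (metis int_adjoinE ipoly_mult ipoly_in)

lemma adj_uminus [intro]: "a \<in> int_adjoin x \<Longrightarrow> - a \<in> int_adjoin x"
  by (metis int_adjoinE ipoly_minus ipoly_in)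

lemma adj_diff [intro]: "a \<in> int_adjoin x \<Longrightarrow> b \<in> int_adjoin x \<Longrightarrow> a - b \<in> int_adjoin x"
  by (metis int_adjoinE ipoly_diff ipoly_in)

lemma adj_of_int [intro, simp]: "of_int a \<in> int_adjoin x"
  using ipoly_in[of "[:a:]" x] by (simp add: ipoly_pCons)

lemma adj_of_nat [intro, simp]: "of_nat a \<in> int_adjoin x"
  using adj_of_int[of "int a"] by simp

lemma adj_0 [intro, simp]: "0 \<in> int_adjoin x" and adj_1 [intro, simp]: "1 \<in> int_adjoin x"
  using adj_of_int[of 0] adj_of_int[of 1] by simp_all

lemma adj_power [intro]: "a \<in> int_adjoin x \<Longrightarrow> a ^ n \<in> int_adjoin x"
  by (induction n) auto

lemma adj_self [intro, simp]: "x \<in> int_adjoin x"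
  using ipoly_in[of "Polynomial.monom 1 1" x] by (simp only: ipoly_monom) simp

lemma adj_sum [intro]: "(\<And>i. i \<in> A \<Longrightarrow> f i \<in> int_adjoin x) \<Longrightarrow> sum f A \<in> int_adjoin x"
  by (induction A rule: infinite_finite_induct) auto

text \<open>Congruence modulo the multiples of d in Z[x], used with d a prime number and with d = 1
  - zeta_n.\<close>

definition adj_cong :: "complex \<Rightarrow> complex \<Rightarrow> complex \<Rightarrow> complex \<Rightarrow> bool" where
  "adj_cong x d a b \<longleftrightarrow> (\<exists>y\<in>int_adjoin x. a - b = d * y)"

lemma adj_cong_refl [intro, simp]: "adj_cong x d a a"
  by (auto simp: adj_cong_def intro: bexI[of _ 0])

lemma adj_cong_sym: "adj_cong x d a b \<Longrightarrow> adj_cong x d b a"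
  unfolding adj_cong_def by (metis adj_uminus minus_diff_eq mult_minus_right)

lemma adj_cong_trans [trans]: "adj_cong x d a b \<Longrightarrow> adj_cong x d b c \<Longrightarrow> adj_cong x d a c"
  unfolding adj_cong_def by (metis adj_add diff_add_cancel add_diff_eq distrib_left)

lemma adj_cong_add: "adj_cong x d a b \<Longrightarrow> adj_cong x d a' b' \<Longrightarrow> adj_cong x d (a + a') (b + b')"
  unfolding adj_cong_def by (metis adj_add add_diff_add distrib_left)

lemma adj_cong_mult_left: "adj_cong x d a b \<Longrightarrow> c \<in> int_adjoin x \<Longrightarrow> adj_cong x d (c * a) (c * b)"
  unfolding adj_cong_def by (metis adj_mult mult.left_commute right_diff_distrib)

lemma adj_cong_mult:
  assumes "adj_cong x d a b" "adj_cong x d a' b'" "a \<in> int_adjoin x" "b' \<in> int_adjoin x"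
  shows "adj_cong x d (a * a') (b * b')"
  using adj_cong_trans[OF adj_cong_mult_left[OF assms(2,3)]] adj_cong_mult_left[OF assms(1,4)]
  by (simp add: mult.commute)

lemma adj_cong_power:
  assumes "adj_cong x d a b" "a \<in> int_adjoin x" "b \<in> int_adjoin x"
  shows "adj_cong x d (a ^ n) (b ^ n)"
  by (induction n) (auto intro!: adj_cong_mult assms)

lemma adj_cong_sum:
  "(\<And>i. i \<in> A \<Longrightarrow> adj_cong x d (f i) (g i)) \<Longrightarrow> adj_cong x d (sum f A) (sum g A)"
  by (induction A rule: infinite_finite_induct) (auto intro: adj_cong_add)

lemma adj_cong_multI: "y \<in> int_adjoin x \<Longrightarrow> adj_cong x d (d * y) 0"
  by (auto simp: adj_cong_def)

text \<open>All binomial coefficients except the two outer ones are divisible by r.\<close>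

lemma adj_cong_power_add_prime:
  assumes r: "prime (r :: nat)" and a: "a \<in> int_adjoin x" "b \<in> int_adjoin x"
  shows "adj_cong x (of_nat r) ((a + b) ^ r) (a ^ r + b ^ r)"
proof -
  have r1: "r > 0" "r \<noteq> 0" using r prime_gt_0_nat by auto
  have "(a + b) ^ r = (\<Sum>k\<le>r. of_nat (r choose k) * a ^ k * b ^ (r - k))"
    by (rule binomial_ring)
  also have "adj_cong x (of_nat r) \<dots>
      (\<Sum>k\<le>r. if k = 0 then b ^ r else if k = r then a ^ r else 0)"
  proof (rule adj_cong_sum)
    fix k assume "k \<in> {..r}"
    show "adj_cong x (of_nat r) (of_nat (r choose k) * a ^ k * b ^ (r - k))
           (if k = 0 then b ^ r else if k = r then a ^ r else 0)"
    proof (cases "k = 0 \<or> k = r")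
      case False
      then have "r dvd (r choose k)" using r \<open>k \<in> {..r}\<close> by (intro dvd_choose_prime) auto
      then obtain m where "r choose k = r * m" by (elim dvdE)
      then have e: "of_nat (r choose k) * a ^ k * b ^ (r - k)
          = of_nat r * (of_nat m * a ^ k * b ^ (r - k))"
        by (simp add: mult.assoc)
      have "adj_cong x (of_nat r) (of_nat r * (of_nat m * a ^ k * b ^ (r - k))) 0"
        using a by (intro adj_cong_multI) auto
      then show ?thesis unfolding e using False by (simp only: de_Morgan_disj if_False)
    qed (use r1 in auto)
  qed
  also have "(\<Sum>k\<le>r. if k = 0 then b ^ r else if k = r then a ^ r else 0)
      = (\<Sum>k\<in>{0, r}. if k = 0 then b ^ r else if k = r then a ^ r else 0)"
    by (rule sum.mono_neutral_right) auto
  also have "\<dots> = a ^ r + b ^ r" using r1 by simp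
  finally show ?thesis .
qed

text \<open>Frobenius modulo r raises only the argument to the r-th power, since Fermat's little
  theorem fixes the integer coefficients.\<close>

lemma ipoly_power_prime_cong:
  assumes r: "prime (r :: nat)"
  shows "adj_cong x (of_nat r) (ipoly h x ^ r) (ipoly h (x ^ r))"
proof (induction h)
  case 0 then show ?case using prime_gt_0_nat[OF r] by (simp add: power_0_left)
next
  case (pCons a h)
  have "adj_cong x (of_nat r) (ipoly (pCons a h) x ^ r) (of_int a ^ r + (x * ipoly h x) ^ r)"
    unfolding ipoly_pCons by (intro adj_cong_power_add_prime[OF r]) auto
  moreover have "adj_cong x (of_nat r) (of_int a ^ r + (x * ipoly h x) ^ r)
      (of_int a + x ^ r * ipoly h (x ^ r))"
  proof (rule adj_cong_add)
    have "[a ^ r = a] (mod int r)"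
    proof (cases "int r dvd a")
      case True
      then have "int r dvd a ^ r" using r by (simp add: dvd_power prime_gt_0_nat dvd_trans[OF True])
      then show ?thesis using True by (meson cong_0_iff cong_sym cong_trans)
    next
      case False
      have "[a ^ (r - 1) = 1] (mod int r)"
      proof -
        \<comment> \<open>Fermat's theorem is at hand for natural numbers, while the coefficient a
          may be negative; hence the passage to its residue.\<close>
        define b where "b = nat (a mod int r)"
        have rp: "r > 0" using r prime_gt_0_nat by blast
        have b: "int b = a mod int r" unfolding b_def using rp by simp
        have "\<not> r dvd b" using False b by (metis dvd_mod_iff dvd_refl int_dvd_int_iff)
        from fermat_theorem[OF r this] have "[int b ^ (r - 1) = 1] (mod int r)"
          by (metis cong_int_iff of_nat_1 of_nat_power)
        moreover have "[int b = a] (mod int r)" by (simp add: b cong_def)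
        ultimately show ?thesis by (meson cong_pow cong_sym cong_trans)
      qed
      then have "[a * a ^ (r - 1) = a * 1] (mod int r)" by (rule cong_scalar_left)
      then show ?thesis using r by (simp add: prime_gt_0_nat power_eq_if split: if_splits)
    qed
    then obtain m where "a ^ r - a = int r * m" by (metis cong_iff_dvd_diff dvdE)
    then have "(of_int a :: complex) ^ r - of_int a = of_nat r * of_int m"
      by (metis of_int_diff of_int_mult of_int_of_nat_eq of_int_power)
    then show "adj_cong x (of_nat r) (of_int a ^ r) (of_int a)"
      unfolding adj_cong_def by auto
    show "adj_cong x (of_nat r) ((x * ipoly h x) ^ r) (x ^ r * ipoly h (x ^ r))"
      unfolding power_mult_distrib by (intro adj_cong_mult_left pCons.IH) auto
  qed
  ultimately show ?case unfolding ipoly_pCons by (rule adj_cong_trans)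
qed

section \<open>Irreducibility of the cyclotomic polynomials\<close>

text \<open>The minimal polynomial over Z, obtained as the primitive part of a polynomial of least
  degree among those vanishing at x. It divides X^N - 1, so its leading coefficient is a
  unit.\<close>

lemma min_ipoly:
  assumes N: "N > 0" and x: "x ^ N = 1"
  obtains m :: "int poly" and h :: "int poly"
  where "ipoly m x = 0" "\<And>g. ipoly g x = 0 \<Longrightarrow> m dvd g" "m * h = Polynomial.monom 1 N - 1"
    "\<bar>Polynomial.lead_coeff m\<bar> = 1" "Polynomial.degree m > 0"
proof -
  let ?X = "Polynomial.monom 1 N - 1 :: int poly"
  have X0: "ipoly ?X x = 0" using x by (simp add: ipoly_diff ipoly_monom)
  have Xl: "Polynomial.lead_coeff ?X = 1" "?X \<noteq> 0"
  proof -
    have "Polynomial.degree (1 :: int poly) < Polynomial.degree (Polynomial.monom (1::int) N)"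
      using N by (simp add: degree_monom_eq)
    then have d: "Polynomial.degree ?X = N"
      using degree_add_eq_left[of "- 1" "Polynomial.monom (1::int) N"] by (simp add: degree_monom_eq)
    have c: "Polynomial.coeff ?X N = 1" using N by (simp add: coeff_1)
    then show "Polynomial.lead_coeff ?X = 1" using c by (simp only: d)
    show "?X \<noteq> 0" using c by (metis coeff_0 zero_neq_one)
  qed
  define S where "S = {g :: int poly. g \<noteq> 0 \<and> ipoly g x = 0}"
  have "?X \<in> S" using X0 Xl by (simp add: S_def)
  then obtain m0 where m0: "m0 \<in> S" "\<And>g. g \<in> S \<Longrightarrow> Polynomial.degree m0 \<le> Polynomial.degree g"
    using ex_has_least_nat[of "\<lambda>g. g \<in> S" ?X Polynomial.degree] by blast
  define m where "m = primitive_part m0"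
  have m00: "m0 \<noteq> 0" using m0 by (simp add: S_def)
  have cm: "content m = 1" unfolding m_def using m00 by simp
  have "ipoly m0 x = of_int (content m0) * ipoly m x"
    unfolding m_def by (metis content_times_primitive_part ipoly_smult)
  then have mx: "ipoly m x = 0" using m0 m00 by (simp add: S_def)
  have mS: "m \<in> S" using mx cm by (auto simp: S_def)
  have mmin: "Polynomial.degree m \<le> Polynomial.degree g" if "g \<in> S" for g
    using m0(2)[OF that] by (simp add: m_def)
  have dvd: "m dvd g" if g: "ipoly g x = 0" for g
  proof -
    have mn: "m \<noteq> 0" using mS by (simp add: S_def)
    \<comment> \<open>Division in Z[X] costs a factor a. Because m is primitive, a divides the
      content of u and can be cancelled again.\<close>
    obtain a u where au: "a \<noteq> 0" "Polynomial.smult a g = m * u + pseudo_mod g m"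
      using pseudo_mod(1)[OF mn, of g] by blast
    have "ipoly (pseudo_mod g m) x = 0"
      using arg_cong[OF au(2), of "\<lambda>f. ipoly f x"] g mx by (simp add: ipoly_smult ipoly_add ipoly_mult)
    then have "pseudo_mod g m = 0"
      using pseudo_mod(2)[OF mn, of g] mmin by (fastforce simp: S_def)
    then have eq: "Polynomial.smult a g = m * u" using au by simp
    have "content (Polynomial.smult a g) = content u" unfolding eq content_mult cm by simp
    then have "a dvd content u" by (metis content_smult dvd_triv_left normalize_dvd_iff)
    then have "[:a:] dvd u" using const_poly_dvd_iff_dvd_content by blast
    then obtain u' where "u = [:a:] * u'" by (elim dvdE)
    then have "Polynomial.smult a g = Polynomial.smult a (m * u')" using eq by simp
    then have "g = m * u'" using au(1) by (intro poly_eqI) (auto simp: poly_eq_iff)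
    then show ?thesis by simp
  qed
  obtain h where h: "?X = m * h" using dvd[OF X0] by (elim dvdE)
  have "Polynomial.lead_coeff m * Polynomial.lead_coeff h = 1" using Xl h by (simp add: lead_coeff_mult)
  then have lm: "\<bar>Polynomial.lead_coeff m\<bar> = 1" by (simp add: zmult_eq_1_iff abs_if) linarith
  have dm: "Polynomial.degree m > 0"
  proof (rule ccontr)
    assume "\<not> Polynomial.degree m > 0"
    then obtain b where "m = [:b:]" by (metis degree_eq_zeroE neq0_conv)
    then show False using mx lm by (simp add: ipoly_pCons)
  qed
  show ?thesis by (rule that[OF mx dvd h[symmetric] lm dm])
qed

text \<open>The integers in r Z[x] are the multiples of r. A relation a = r u(x) gives r u - a = m
  v; the highest coefficient of v not divisible by r would reappear, up to sign, in m v at a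
  positive degree, where all coefficients of r u - a are multiples of r.\<close>

lemma int_dvd_adjoin:
  assumes N: "N > 0" and x: "x ^ N = 1" and r: "prime (r :: nat)"
    and a: "adj_cong x (of_nat r) (of_int a) 0"
  shows "int r dvd a"
proof (rule ccontr)
  assume na: "\<not> int r dvd a"
  obtain m h where m: "ipoly m x = 0" "\<And>g. ipoly g x = 0 \<Longrightarrow> m dvd g"
    "\<bar>Polynomial.lead_coeff m\<bar> = 1" "Polynomial.degree m > 0"
    using min_ipoly[OF N x] by metis
  obtain u where u: "of_int a = of_nat r * ipoly u x"
    using a unfolding adj_cong_def by (auto elim!: int_adjoinE)
  have "ipoly (Polynomial.smult (int r) u - [:a:]) x = 0"
    by (simp add: ipoly_diff ipoly_smult ipoly_pCons u)
  then obtain v where v: "Polynomial.smult (int r) u - [:a:] = m * v" using m(2) by (auto elim: dvdE)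
  define B where "B = {i. \<not> int r dvd Polynomial.coeff v i}"
  have finB: "finite B"
    by (rule finite_subset[of _ "{..Polynomial.degree v}"])
       (auto simp: B_def intro: le_degree)
  have "B \<noteq> {}"
  proof
    assume "B = {}"
    then have "int r dvd Polynomial.coeff (m * v) 0" by (auto simp: B_def coeff_mult)
    then have "int r dvd Polynomial.coeff (Polynomial.smult (int r) u - [:a:]) 0" by (simp add: v)
    then show False using na by (simp add: dvd_diff_right_iff)
  qed
  define i where "i = Max B"
  have iB: "i \<in> B" unfolding i_def using finB \<open>B \<noteq> {}\<close> by simp
  have imax: "int r dvd Polynomial.coeff v j" if "j > i" for j
    using that finB by (metis B_def Max_ge i_def linorder_not_less mem_Collect_eq)
  let ?n = "Polynomial.degree m"
  have "Polynomial.coeff (m * v) (?n + i)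
      = (\<Sum>j\<le>?n + i. Polynomial.coeff m j * Polynomial.coeff v (?n + i - j))"
    by (simp add: coeff_mult)
  also have "\<dots> = Polynomial.lead_coeff m * Polynomial.coeff v i
      + (\<Sum>j\<in>{..?n + i} - {?n}. Polynomial.coeff m j * Polynomial.coeff v (?n + i - j))"
    by (subst sum.remove[of _ ?n]) auto
  finally have e: "Polynomial.coeff (m * v) (?n + i) = Polynomial.lead_coeff m * Polynomial.coeff v i
      + (\<Sum>j\<in>{..?n + i} - {?n}. Polynomial.coeff m j * Polynomial.coeff v (?n + i - j))" .
  have d1: "int r dvd (\<Sum>j\<in>{..?n + i} - {?n}. Polynomial.coeff m j * Polynomial.coeff v (?n + i - j))"
  proof (rule dvd_sum)
    fix j assume j: "j \<in> {..?n + i} - {?n}"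
    show "int r dvd Polynomial.coeff m j * Polynomial.coeff v (?n + i - j)"
    proof (cases "j > ?n")
      case True then show ?thesis by (simp add: coeff_eq_0)
    next
      case False
      then have "?n + i - j > i" using j by auto
      then show ?thesis using imax by auto
    qed
  qed
  have "int r dvd Polynomial.coeff (m * v) (?n + i)"
    using m(4) unfolding v[symmetric] by (simp add: coeff_pCons split: nat.split)
  then have "int r dvd Polynomial.lead_coeff m * Polynomial.coeff v i"
    using d1 e by (simp add: dvd_add_left_iff)
  moreover have "Polynomial.lead_coeff m = 1 \<or> Polynomial.lead_coeff m = -1" using m(3) by linarith
  ultimately have "int r dvd Polynomial.coeff v i" by auto
  then show False using iB by (simp add: B_def)
qed

text \<open>Dedekind's argument. With m h = X^N - 1, a nonzero m(x^r) forces h(x^r) = 0, so h(x)^r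
  is 0 modulo r. Differentiating m h at x gives x m'(x) h(x) = N, and r would divide a power of
  N.\<close>

lemma ipoly_root_power_prime:
  assumes N: "N > 0" and x: "x ^ N = 1" and r: "prime (r :: nat)" "\<not> r dvd N"
    and g: "ipoly g x = 0"
  shows "ipoly g (x ^ r) = 0"
proof -
  obtain m h where m: "ipoly m x = 0" "\<And>g. ipoly g x = 0 \<Longrightarrow> m dvd g"
    "m * h = Polynomial.monom 1 N - 1"
    using min_ipoly[OF N x] by metis
  have "ipoly m (x ^ r) = 0"
  proof (rule ccontr)
    assume nz: "ipoly m (x ^ r) \<noteq> 0"
    have "ipoly m (x ^ r) * ipoly h (x ^ r) = 0"
      unfolding ipoly_mult[symmetric] m(3) using x
      by (simp add: ipoly_diff ipoly_monom flip: power_mult) (simp add: mult.commute power_mult)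
    then have h0: "ipoly h (x ^ r) = 0" using nz by simp
    have "adj_cong x (of_nat r) (ipoly h x ^ r) 0"
      using ipoly_power_prime_cong[OF r(1), of x h] h0 by simp
    then have c1: "adj_cong x (of_nat r) ((x * ipoly (pderiv m) x) ^ r * ipoly h x ^ r) 0"
      using adj_cong_mult_left[of x "of_nat r" "ipoly h x ^ r" 0 "(x * ipoly (pderiv m) x) ^ r"] by auto
    have "pderiv (m * h) = Polynomial.monom (int N) (N - 1)"
      unfolding m(3) by (simp add: pderiv_diff pderiv_monom)
    then have "ipoly (pderiv m) x * ipoly h x = of_nat N * x ^ (N - 1)"
      using arg_cong[of "pderiv (m * h)" _ "\<lambda>g. ipoly g x"] m(1)
      unfolding pderiv_mult ipoly_add ipoly_mult by (simp add: mult.commute ipoly_monom)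
    then have "x * ipoly (pderiv m) x * ipoly h x = of_nat N * x ^ N"
      using N by (cases N) (auto simp: algebra_simps)
    then have "(x * ipoly (pderiv m) x) ^ r * ipoly h x ^ r = of_int (int N ^ r)"
      by (metis power_mult_distrib x mult.right_neutral of_int_of_nat_eq of_int_power)
    then have "int r dvd int N ^ r" using c1 int_dvd_adjoin[OF N x r(1)] by metis
    then show False using r prime_dvd_power_nat by (metis int_dvd_int_iff of_nat_power)
  qed
  moreover obtain u where "g = m * u" using m(2)[OF g] by (elim dvdE)
  ultimately show ?thesis by (simp add: ipoly_mult)
qed

text \<open>Irreducibility of the cyclotomic polynomials in the form used later: prime factors of c
  are taken one at a time, each replacing x by another N-th root of unity.\<close>

lemma ipoly_root_power_coprime:
  assumes N: "N > 0" and x: "x ^ N = 1" and c: "coprime c N" "c > 0" and g: "ipoly g x = 0"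
  shows "ipoly g (x ^ c) = 0"
  using c x g
proof (induction c arbitrary: x rule: less_induct)
  case (less c)
  show ?case
  proof (cases "c = 1")
    case True then show ?thesis using less by simp
  next
    case False
    then obtain r where r: "prime r" "r dvd c" using prime_factor_nat by blast
    then obtain d where d: "c = r * d" by (elim dvdE)
    have rN: "\<not> r dvd N" using less.prems(1) r
      by (meson coprime_common_divisor not_prime_unit)
    have "ipoly g (x ^ r) = 0"
      using ipoly_root_power_prime[OF N _ r(1) rN] less.prems by blast
    moreover have "d < c" "d > 0" using d less.prems(2) prime_gt_1_nat[OF r(1)] by auto
    moreover have "coprime d N" using less.prems(1) d by simp
    moreover have "(x ^ r) ^ N = 1" using less.prems(3)
      by (metis mult.commute power_mult power_one)
    ultimately have "ipoly g ((x ^ r) ^ d) = 0" using less.IH by blast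
    then show ?thesis by (simp add: d power_mult)
  qed
qed

text \<open>An element is sent to g(x^c) for any integer polynomial g that represents it at x; two
  choices of g differ by a polynomial vanishing at x, hence also at x^c.\<close>

lemma galois_automorphism:
  assumes N: "N > 0" and x: "x ^ N = 1" and c: "coprime c N" "c > 0"
  obtains \<sigma> where "\<And>a b. a \<in> int_adjoin x \<Longrightarrow> b \<in> int_adjoin x \<Longrightarrow> \<sigma> (a + b) = \<sigma> a + \<sigma> b"
    "\<And>a b. a \<in> int_adjoin x \<Longrightarrow> b \<in> int_adjoin x \<Longrightarrow> \<sigma> (a * b) = \<sigma> a * \<sigma> b"
    "\<And>n. \<sigma> (of_int n) = of_int n" "\<sigma> x = x ^ c"
proof -
  define \<sigma> where "\<sigma> a = ipoly (SOME g. a = ipoly g x) (x ^ c)" for a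
  have \<sigma>: "\<sigma> (ipoly g x) = ipoly g (x ^ c)" for g
  proof -
    define f where "f = (SOME f. ipoly g x = ipoly f x)"
    have "ipoly g x = ipoly f x" unfolding f_def by (rule someI[of _ g]) simp
    then have "ipoly (g - f) x = 0" by (simp add: ipoly_diff)
    then have "ipoly (g - f) (x ^ c) = 0" by (rule ipoly_root_power_coprime[OF N x c])
    then show ?thesis unfolding \<sigma>_def f_def[symmetric] by (simp add: ipoly_diff)
  qed
  show ?thesis
  proof
    show "\<sigma> (a + b) = \<sigma> a + \<sigma> b" if "a \<in> int_adjoin x" "b \<in> int_adjoin x" for a b
      using that by (metis int_adjoinE \<sigma> ipoly_add)
    show "\<sigma> (a * b) = \<sigma> a * \<sigma> b" if "a \<in> int_adjoin x" "b \<in> int_adjoin x" for a b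
      using that by (metis int_adjoinE \<sigma> ipoly_mult)
    show "\<sigma> (of_int n) = of_int n" for n using \<sigma>[of "[:n:]"] by (simp add: ipoly_pCons)
    show "\<sigma> x = x ^ c" using \<sigma>[of "Polynomial.monom 1 1"] by (simp only: ipoly_monom) simp
  qed
qed

text \<open>(1 - z)^r is congruent to 1 + (-z)^r modulo r, and this is 0, or 2 if r = 2. Hence the
  r-th power of an integer multiple of 1 - z is a multiple of r.\<close>

lemma int_dvd_one_minus_root:
  assumes N: "N > 0" and x: "x ^ N = 1" and r: "prime (r :: nat)"
    and z: "z \<in> int_adjoin x" "z ^ r = 1" and a: "adj_cong x (1 - z) (of_int a) 0"
  shows "int r dvd a"
proof -
  obtain y where y: "y \<in> int_adjoin x" "of_int a = (1 - z) * y"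
    using a unfolding adj_cong_def by auto
  have r0: "r > 0" using r prime_gt_0_nat by blast
  have "adj_cong x (of_nat r) ((1 - z) ^ r) 0"
  proof -
    have "adj_cong x (of_nat r) ((1 + - z) ^ r) (1 ^ r + (- z) ^ r)"
      by (rule adj_cong_power_add_prime[OF r]) (auto intro: z)
    also have "adj_cong x (of_nat r) \<dots> 0"
    proof (cases "odd r")
      case False
      then have "r = 2" using r by (metis primes_dvd_imp_eq two_is_prime_nat)
      then show ?thesis using z r0 by (auto simp: adj_cong_def intro: bexI[of _ 1])
    qed (use z r0 in simp)
    finally show ?thesis by simp
  qed
  then have "adj_cong x (of_nat r) (y ^ r * (1 - z) ^ r) 0"
    using adj_cong_mult_left[of x "of_nat r" "(1 - z) ^ r" 0 "y ^ r"] y by auto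
  then have "adj_cong x (of_nat r) (of_int (a ^ r)) 0"
    using y(2) by (simp add: power_mult_distrib mult.commute)
  then have "int r dvd a ^ r" by (rule int_dvd_adjoin[OF N x r])
  then show ?thesis using r by (meson prime_dvd_power prime_nat_int_transfer)
qed

text \<open>X^(M+1) - C X has simple roots modulo 1 - z. For distinct nonzero roots the quotient
  (u^M - v^M) / (u - v) is 0, yet congruent to M u^(M-1); multiplied by u, it makes M C a multiple
  of 1 - z. If exactly one root is 0, C itself is such a multiple.\<close>

lemma adj_cong_imp_eq:
  fixes u v C :: complex and M :: nat and C' :: int
  assumes N: "N > 0" and x: "x ^ N = 1" and r: "prime (r :: nat)"
    and z: "z \<in> int_adjoin x" "z ^ r = 1"
    and uv: "adj_cong x (1 - z) u v" "u \<in> int_adjoin x" "v \<in> int_adjoin x"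
    and M: "\<not> r dvd M" "\<not> int r dvd C'" "C = of_int C'"
    and u: "u ^ Suc M = C * u" and v: "v ^ Suc M = C * v"
  shows "u = v"
proof -
  have M0: "M > 0" using M by (metis dvd_0_right neq0_conv)
  have C: "t = 0 \<or> t ^ M = C" if "t ^ Suc M = C * t" for t :: complex
    using that by (auto simp: mult.commute)
  have unit: False if "adj_cong x (1 - z) t 0" "t ^ M = C" "t \<in> int_adjoin x" for t
  proof -
    have "adj_cong x (1 - z) (t ^ M) (0 ^ M)" using that by (intro adj_cong_power) auto
    then show False using int_dvd_one_minus_root[OF N x r z, of C'] that M M0 by (simp add: power_0_left)
  qed
  consider "u = 0" "v = 0" | "u = 0" "v ^ M = C" | "v = 0" "u ^ M = C" | "u ^ M = C" "v ^ M = C"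
    using C[OF u] C[OF v] by blast
  then show ?thesis
  proof cases
    case 2 then show ?thesis using unit[of v] uv adj_cong_sym by blast
  next
    case 3 then show ?thesis using unit[of u] uv by blast
  next
    case 4
    show ?thesis
    proof (rule ccontr)
      assume ne: "u \<noteq> v"
      have "u ^ M - v ^ M = (u - v) * (\<Sum>i<M. v ^ (M - Suc i) * u ^ i)"
        by (rule power_diff_sumr2)
      then have s0: "(\<Sum>i<M. v ^ (M - Suc i) * u ^ i) = 0" using 4 ne by simp
      have "adj_cong x (1 - z) (\<Sum>i<M. v ^ (M - Suc i) * u ^ i) (\<Sum>i<M. u ^ (M - Suc i) * u ^ i)"
        by (intro adj_cong_sum adj_cong_mult adj_cong_power adj_cong_sym[OF uv(1)] adj_cong_refl)
           (use uv in auto)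
      also have "(\<Sum>i<M. u ^ (M - Suc i) * u ^ i) = of_nat M * u ^ (M - 1)"
        by (simp flip: power_add)
      finally have "adj_cong x (1 - z) (of_nat M * u ^ (M - 1)) 0"
        using s0 by (auto intro: adj_cong_sym)
      from adj_cong_mult_left[OF this uv(2)]
      have "adj_cong x (1 - z) (of_int (int M * C')) 0"
      proof -
        have "u * (of_nat M * u ^ (M - 1)) = of_nat M * u ^ M"
          using M0 by (simp add: power_eq_if)
        also have "\<dots> = of_int (int M * C')" using 4 M(3) by simp
        finally show ?thesis
          using \<open>adj_cong x (1 - z) (u * (of_nat M * u ^ (M - 1))) (u * 0)\<close> by (simp only: mult_zero_right)
      qed
      then have "int r dvd int M * C'" by (rule int_dvd_one_minus_root[OF N x r z])
      then show False using M r prime_dvd_mult_iff[of "int r"] by simp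
    qed
  qed simp
qed

section \<open>Monic polynomials over a finite field\<close>

context domain
begin

declare poly_add.simps [simp del] poly_mult.simps [simp del]

definition monics :: "'a set \<Rightarrow> nat \<Rightarrow> 'a list set" where
  "monics K m = {f. polynomial K f \<and> f \<noteq> [] \<and> hd f = \<one> \<and> length f - 1 = m}"

lemma monics_carrier: "f \<in> monics K m \<Longrightarrow> f \<in> carrier (K[X])"
  by (simp add: monics_def univ_poly_carrier[symmetric])

lemma monics_degree: "f \<in> monics K m \<Longrightarrow> length f - 1 = m"
  by (simp add: monics_def)

lemma monics_not_nil: "f \<in> monics K m \<Longrightarrow> f \<noteq> []"
  by (simp add: monics_def)

lemma monics_set: "f \<in> monics K m \<Longrightarrow> set f \<subseteq> K"
  by (auto simp: monics_def polynomial_def)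

lemma monics_mono: "f \<in> monics K m \<Longrightarrow> K \<subseteq> K' \<Longrightarrow> f \<in> monics K' m"
  by (auto simp: monics_def polynomial_def)

lemma monics_eq_image:
  assumes "\<one> \<in> K"
  shows "monics K m = Cons \<one> ` {xs. set xs \<subseteq> K \<and> length xs = m}"
proof (intro equalityI subsetI)
  fix f assume f: "f \<in> monics K m"
  then obtain xs where "f = \<one> # xs" by (cases f) (auto simp: monics_def)
  then show "f \<in> Cons \<one> ` {xs. set xs \<subseteq> K \<and> length xs = m}"
    using f monics_set[OF f] by (auto simp: monics_def)
qed (use assms in \<open>auto simp: monics_def polynomial_def\<close>)

lemma finite_monics: "finite K \<Longrightarrow> \<one> \<in> K \<Longrightarrow> finite (monics K m)"
  by (simp add: monics_eq_image finite_lists_length_eq)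

lemma monics_0: "\<one> \<in> K \<Longrightarrow> monics K 0 = {[\<one>]}"
  by (auto simp: monics_eq_image)

lemma monics_mult:
  assumes K: "subring K R" and f: "f \<in> monics K a" and g: "g \<in> monics K b"
  shows "poly_mult f g \<in> monics K (a + b)"
proof -
  have p: "polynomial K f" "polynomial K g" "f \<noteq> []" "g \<noteq> []" "hd f = \<one>" "hd g = \<one>"
    using f g by (auto simp: monics_def)
  have "poly_mult f g \<noteq> []" using poly_mult_integral[OF K p(1,2)] p by auto
  then show ?thesis
    using poly_mult_closed[OF K p(1,2)] poly_mult_degree_eq[OF K p(1,2)]
      poly_mult_lead_coeff[OF K p(1-4)] p monics_degree[OF f] monics_degree[OF g]
    by (simp add: monics_def)
qed

lemma monics_quotient:
  assumes K: "subring K R" and f: "f \<in> monics K a" and g: "g \<in> carrier (K[X])"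
    and fg: "poly_mult f g \<in> monics K c"
  shows "a \<le> c \<and> g \<in> monics K (c - a)"
proof -
  have p: "polynomial K f" "polynomial K g" "f \<noteq> []" "hd f = \<one>"
    using f g by (auto simp: monics_def univ_poly_carrier)
  have f': "set f \<subseteq> carrier R" using polynomial_in_carrier[OF K p(1)] .
  have gn: "g \<noteq> []" using fg poly_mult_zero(2)[OF f'] by (auto simp: monics_def)
  have "hd g \<in> carrier R" using polynomial_in_carrier[OF K p(2)] gn by auto
  then have "hd g = \<one>"
    using poly_mult_lead_coeff[OF K p(1,2,3) gn] p(4) fg by (simp add: monics_def)
  then show ?thesis
    using poly_mult_degree_eq[OF K p(1,2)] p gn monics_degree[OF f] monics_degree[OF fg]
    by (simp add: monics_def)
qed

lemma monics_pow:
  assumes K: "subring K R" and f: "f \<in> monics K a"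
  shows "f [^]\<^bsub>K[X]\<^esub> (j :: nat) \<in> monics K (j * a)"
proof (induction j)
  case 0
  have "\<one> \<in> K" using K by (rule subringE(3))
  then show ?case by (simp add: univ_poly_one monics_0)
next
  case (Suc j)
  then show ?case using monics_mult[OF K Suc f] by (simp add: univ_poly_mult add.commute)
qed

text \<open>The bound M keeps the set finite, so that sums over irreducible polynomials are finite
  sums; for factors of polynomials of degree at most M nothing is lost.\<close>

definition monic_irreducibles :: "'a set \<Rightarrow> nat \<Rightarrow> 'a list set" where
  "monic_irreducibles K M = {P. pirreducible K P \<and> (\<exists>d\<in>{1..M}. P \<in> monics K d)}"

definition mdvd :: "'a set \<Rightarrow> 'a list \<Rightarrow> 'a list \<Rightarrow> bool" where
  "mdvd K f g \<longleftrightarrow> (\<exists>h\<in>carrier (K[X]). g = poly_mult f h)"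

lemma mdvd_iff_pdivides:
  "subfield K R \<Longrightarrow> f \<in> carrier (K[X]) \<Longrightarrow> g \<in> carrier (K[X]) \<Longrightarrow> mdvd K f g \<longleftrightarrow> f pdivides g"
  by (simp add: mdvd_def pdivides_iff_shell factor_def univ_poly_mult)

lemma finite_monic_irreducibles: "finite K \<Longrightarrow> \<one> \<in> K \<Longrightarrow> finite (monic_irreducibles K M)"
  by (rule finite_subset[of _ "\<Union>d\<in>{1..M}. monics K d"])
     (auto simp: monic_irreducibles_def finite_monics)

text \<open>A monic divisor of least positive degree is irreducible: a proper factor of it, divided
  by its leading coefficient, would be a smaller one.\<close>

lemma exists_monic_irreducible_factor:
  assumes K: "subfield K R" and f: "f \<in> monics K m" and m: "m > 0"
  obtains P d h where "pirreducible K P" "P \<in> monics K d" "1 \<le> d" "d \<le> m" "h \<in> monics K (m - d)"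
    "f = poly_mult P h"
proof -
  note K1 = subfieldE(1)[OF K]
  interpret UP: domain "K[X]" using univ_poly_is_domain[OF K1] .
  have oneK: "\<one> \<in> K" using K1 by (rule subringE(3))
  define D where "D d \<longleftrightarrow> d \<ge> 1 \<and> (\<exists>P\<in>monics K d. mdvd K P f)" for d
  have "mdvd K f f" unfolding mdvd_def using UP.r_one[OF monics_carrier[OF f]] UP.one_closed
    by (metis univ_poly_mult)
  then have "D m" using f m by (auto simp: D_def)
  define d where "d = (LEAST d. D d)"
  have "D d" unfolding d_def using \<open>D m\<close> by (rule LeastI)
  then obtain P h where P: "P \<in> monics K d" "h \<in> carrier (K[X])" "f = poly_mult P h" "d \<ge> 1"
    by (auto simp: D_def mdvd_def)
  have h: "d \<le> m" "h \<in> monics K (m - d)" using monics_quotient[OF K1 P(1,2)] f P(3) by auto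
  have "pirreducible K P"
  proof (rule pirreducibleI[OF K1 monics_carrier[OF P(1)] monics_not_nil[OF P(1)]])
    show "P \<notin> Units (K[X])"
      using univ_poly_units'[OF K, of P] monics_degree[OF P(1)] P(4) by linarith
    fix a b assume ab: "a \<in> carrier (K[X])" "b \<in> carrier (K[X])" "P = a \<otimes>\<^bsub>K[X]\<^esub> b"
    have pol: "polynomial K a" "polynomial K b" using ab by (auto simp: univ_poly_carrier)
    have inc: "set a \<subseteq> carrier R" "set b \<subseteq> carrier R" using polynomial_in_carrier[OF K1] pol by auto
    have Pab: "P = poly_mult a b" using ab by (simp add: univ_poly_mult)
    have ne: "a \<noteq> []" "b \<noteq> []"
      using monics_not_nil[OF P(1)] Pab poly_mult_zero[OF inc(1)] poly_mult_zero[OF inc(2)] by auto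
    have deg: "length a - 1 + (length b - 1) = d"
      using poly_mult_degree_eq[OF K1 pol] ne Pab monics_degree[OF P(1)] by simp
    show "a \<in> Units (K[X]) \<or> b \<in> Units (K[X])"
    proof (rule ccontr)
      assume "\<not> ?thesis"
      then have d1: "length a - 1 > 0" "length b - 1 > 0" using ab(1,2) ne univ_poly_units'[OF K, of a] univ_poly_units'[OF K, of b] by (metis neq0_conv)+
      define c where "c = hd a"
      have c: "c \<in> K - {\<zero>}" using pol(1) ne(1) unfolding c_def polynomial_def by auto
      have cu: "[c] \<in> Units (K[X])" using univ_poly_units[OF K] c by auto
      define v where "v = inv\<^bsub>K[X]\<^esub> [c]"
      have v: "v \<in> Units (K[X])" "v \<otimes>\<^bsub>K[X]\<^esub> [c] = \<one>\<^bsub>K[X]\<^esub>"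
        using cu unfolding v_def by auto
      obtain c' where c': "v = [c']" "c' \<in> K - {\<zero>}" using v(1) univ_poly_units[OF K] by auto
      have cc: "[c] \<in> carrier (K[X])" "v \<in> carrier (K[X])" using cu v(1) by auto
      have "poly_mult v [c] = [\<one>]" using v(2) by (simp add: univ_poly_mult univ_poly_one)
      then have c'c: "c' \<otimes> c = \<one>"
        using poly_mult_lead_coeff[OF K1, of v "[c]"] c c' cc
        by (simp add: univ_poly_carrier)
      define a' where "a' = poly_mult v a"
      have polv: "polynomial K v" "v \<noteq> []" using cc(2) c' by (auto simp: univ_poly_carrier)
      have a'c: "a' \<in> carrier (K[X])" unfolding a'_def univ_poly_carrier[symmetric]
        by (rule poly_mult_closed[OF K1 polv(1) pol(1)])
      have "hd a' = \<one>" unfolding a'_def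
        using poly_mult_lead_coeff[OF K1 polv(1) pol(1) polv(2) ne(1)] c'c c'(1) by (simp add: c_def)
      moreover have "length a' - 1 = length a - 1" unfolding a'_def
        using poly_mult_degree_eq[OF K1 polv(1) pol(1)] polv(2) ne c'(1) by simp
      ultimately have "a' \<in> monics K (length a - 1)"
        using a'c d1 by (auto simp: monics_def univ_poly_carrier)
      moreover have "f = poly_mult a' (poly_mult [c] (poly_mult b h))"
      proof -
        have "f = a \<otimes>\<^bsub>K[X]\<^esub> b \<otimes>\<^bsub>K[X]\<^esub> h" using P(3) ab(3) by (simp add: univ_poly_mult)
        also have "\<dots> = (v \<otimes>\<^bsub>K[X]\<^esub> [c]) \<otimes>\<^bsub>K[X]\<^esub> (a \<otimes>\<^bsub>K[X]\<^esub> b \<otimes>\<^bsub>K[X]\<^esub> h)"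
          unfolding v(2) by (rule UP.l_one[symmetric]) (intro UP.m_closed ab P)
        also have "\<dots> = (v \<otimes>\<^bsub>K[X]\<^esub> a) \<otimes>\<^bsub>K[X]\<^esub> ([c] \<otimes>\<^bsub>K[X]\<^esub> (b \<otimes>\<^bsub>K[X]\<^esub> h))"
          using ab(1,2) cc P(2) by (simp add: UP.m_ac)
        finally show ?thesis by (simp only: a'_def univ_poly_mult)
      qed
      moreover have "poly_mult [c] (poly_mult b h) \<in> carrier (K[X])"
        using UP.m_closed[OF cc(1) UP.m_closed[OF ab(2) P(2)]] by (simp add: univ_poly_mult)
      ultimately have "D (length a - 1)" using d1 by (auto simp: D_def mdvd_def)
      moreover have "length a - 1 < d" using deg d1 by simp
      ultimately show False unfolding d_def using not_less_Least by blast
    qed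
  qed
  then show ?thesis using that P h by blast
qed

text \<open>Unique factorisation as one additive identity: the multiplicity of P is counted by the
  exponents j with P^j dividing f. Splitting off an irreducible P0 raises the count of P0 by one and
  leaves all others alone.\<close>

lemma degree_eq_sum_factors:
  assumes K: "subfield K R" "finite K"
  shows "f \<in> monics K m \<Longrightarrow> m \<le> M \<Longrightarrow>
    m = (\<Sum>P\<in>monic_irreducibles K M. (length P - 1) * card {j\<in>{1..M}. mdvd K (P [^]\<^bsub>K[X]\<^esub> j) f})"
proof (induction m arbitrary: f rule: less_induct)
  case (less m)
  note K1 = subfieldE(1)[OF K(1)]
  interpret UP: domain "K[X]" using univ_poly_is_domain[OF K1] .
  have oneK: "\<one> \<in> K" using K1 by (rule subringE(3))
  let ?c = "\<lambda>P f. {j\<in>{1..M}. mdvd K (P [^]\<^bsub>K[X]\<^esub> j) f}"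
  have le: "j * d \<le> m'" if "mdvd K (P [^]\<^bsub>K[X]\<^esub> j) g" "P \<in> monics K d" "g \<in> monics K m'" for P j d g m'
    using that monics_quotient[OF K1 monics_pow[OF K1 that(2)]] by (auto simp: mdvd_def)
  show ?case
  proof (cases "m = 0")
    case True
    have "?c P f = {}" if P: "P \<in> monic_irreducibles K M" for P
    proof -
      obtain d where d: "d \<ge> 1" "P \<in> monics K d" using P by (auto simp: monic_irreducibles_def)
      show ?thesis using le[OF _ d(2) less.prems(1)] d(1) True by fastforce
    qed
    then have "(\<Sum>P\<in>monic_irreducibles K M. (length P - 1) * card (?c P f)) = 0"
      by (intro sum.neutral) (metis card.empty mult_0_right)
    then show ?thesis using True by simp
  next
    case False
    then obtain P0 d h where P0: "pirreducible K P0" "P0 \<in> monics K d" "1 \<le> d" "d \<le> m"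
      and h: "h \<in> monics K (m - d)" "f = poly_mult P0 h"
      using exists_monic_irreducible_factor[OF K(1) less.prems(1)] by blast
    have P0i: "P0 \<in> monic_irreducibles K M" using P0 less.prems(2) by (auto simp: monic_irreducibles_def)
    note carr = monics_carrier[OF P0(2)] monics_carrier[OF h(1)]
    have fh: "f = P0 \<otimes>\<^bsub>K[X]\<^esub> h" using h(2) by (simp add: univ_poly_mult)
    have other: "?c P f = ?c P h" if P: "P \<in> monic_irreducibles K M" "P \<noteq> P0" for P
    proof -
      obtain d' where d': "pirreducible K P" "d' \<ge> 1" "P \<in> monics K d'"
        using P by (auto simp: monic_irreducibles_def)
      have Pc: "P \<in> carrier (K[X])" using monics_carrier[OF d'(3)] .
      have "\<not> P pdivides P0"
      proof
        assume "P pdivides P0"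
        then obtain g where g: "g \<in> carrier (K[X])" "P0 = P \<otimes>\<^bsub>K[X]\<^esub> g"
          using pdivides_iff_shell[OF K(1) Pc carr(1)] by (auto simp: factor_def)
        have "g \<in> Units (K[X])"
          using pirreducibleE(2)[OF K1 Pc d'(1)] pirreducibleE(3)[OF K1 carr(1) P0(1) Pc g(1)] g(2) by auto
        then have "length g - 1 = 0" using univ_poly_units'[OF K(1), of g] by blast
        moreover have "g \<in> monics K (d - d')" "d' \<le> d"
          using monics_quotient[OF K1 d'(3) g(1), of d] P0(2) g(2) by (auto simp: univ_poly_mult)
        ultimately have "g \<in> monics K 0" using monics_degree by metis
        then have "g = \<one>\<^bsub>K[X]\<^esub>" using monics_0[OF oneK] by (simp add: univ_poly_one)
        then show False using g Pc P(2) by simp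
      qed
      have "mdvd K (P [^]\<^bsub>K[X]\<^esub> j) f \<longleftrightarrow> mdvd K (P [^]\<^bsub>K[X]\<^esub> j) h" for j :: nat
      proof -
        have pc: "P [^]\<^bsub>K[X]\<^esub> j \<in> carrier (K[X])" using Pc by (rule UP.nat_pow_closed)
        show ?thesis
          unfolding mdvd_iff_pdivides[OF K(1) pc monics_carrier[OF less.prems(1)]]
            mdvd_iff_pdivides[OF K(1) pc carr(2)]
          unfolding fh by (rule pirreducible_pow_pdivides_iff[OF K(1) Pc carr d'(1) \<open>\<not> P pdivides P0\<close>])
      qed
      then show ?thesis by simp
    qed
    have M1: "M \<ge> 1" using False less.prems(2) by simp
    have step: "mdvd K (P0 [^]\<^bsub>K[X]\<^esub> Suc j) f \<longleftrightarrow> mdvd K (P0 [^]\<^bsub>K[X]\<^esub> j) h" for j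
    proof -
      have P0n: "P0 \<noteq> \<zero>\<^bsub>K[X]\<^esub>" using monics_not_nil[OF P0(2)] by (simp add: univ_poly_zero)
      have "P0 \<otimes>\<^bsub>K[X]\<^esub> h = P0 [^]\<^bsub>K[X]\<^esub> Suc j \<otimes>\<^bsub>K[X]\<^esub> g \<longleftrightarrow> h = P0 [^]\<^bsub>K[X]\<^esub> j \<otimes>\<^bsub>K[X]\<^esub> g"
        if "g \<in> carrier (K[X])" for g
      proof -
        have "P0 [^]\<^bsub>K[X]\<^esub> Suc j \<otimes>\<^bsub>K[X]\<^esub> g = P0 \<otimes>\<^bsub>K[X]\<^esub> (P0 [^]\<^bsub>K[X]\<^esub> j \<otimes>\<^bsub>K[X]\<^esub> g)"
          using that carr by (simp add: UP.m_ac)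
        then show ?thesis using UP.m_lcancel[OF P0n carr(1) carr(2)] that carr by auto
      qed
      then show ?thesis unfolding mdvd_def fh univ_poly_mult[symmetric, of R K] by blast
    qed
    \<comment> \<open>Exponent 1 is new and the old ones move up by one. That they stay below M
      follows from the degree of f.\<close>
    have c0: "?c P0 f = insert 1 (Suc ` ?c P0 h)"
    proof (intro equalityI subsetI)
      fix j assume j: "j \<in> ?c P0 f"
      then obtain i where i: "j = Suc i" by (cases j) auto
      then show "j \<in> insert 1 (Suc ` ?c P0 h)" using j step[of i] by (cases "i = 0") auto
    next
      fix j assume j: "j \<in> insert 1 (Suc ` ?c P0 h)"
      show "j \<in> ?c P0 f"
      proof (cases "j = 1")
        case True
        have "mdvd K (P0 [^]\<^bsub>K[X]\<^esub> Suc 0) f" unfolding mdvd_def using carr h(2) by auto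
        then show ?thesis using True M1 by simp
      next
        case False
        then obtain i where i: "j = Suc i" "i \<in> ?c P0 h" using j by auto
        then have "i * d \<le> m - d" using le[OF _ P0(2) h(1)] by simp
        then have "Suc i * d \<le> m" using P0(4) by simp
        moreover have "Suc i \<le> Suc i * d" using mult_le_mono2[OF P0(3), of "Suc i"] by (simp only: mult_1_right)
        ultimately have "Suc i \<le> M" using less.prems(2) by linarith
        then show ?thesis using i step by simp
      qed
    qed
    have "card (?c P0 f) = 1 + card (?c P0 h)"
      unfolding c0 by (subst card_insert_disjoint) (auto simp: card_image)
    then have P0c: "(length P0 - 1) * card (?c P0 f) = d + (length P0 - 1) * card (?c P0 h)"
      using monics_degree[OF P0(2)] by simp
    have fin: "finite (monic_irreducibles K M)" by (rule finite_monic_irreducibles[OF K(2) oneK])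
    have "m - d = (\<Sum>P\<in>monic_irreducibles K M. (length P - 1) * card (?c P h))"
      using less.IH[of "m - d" h] h(1) P0 less.prems(2) by simp
    then have "m = d + (\<Sum>P\<in>monic_irreducibles K M. (length P - 1) * card (?c P h))"
      using P0(4) by simp
    also have "\<dots> = (\<Sum>P\<in>monic_irreducibles K M. (length P - 1) * card (?c P f))"
      unfolding sum.remove[OF fin P0i] P0c using other by simp
    finally show ?thesis .
  qed
qed

text \<open>The von Mangoldt function for polynomials: P^j has weight deg P. For completely
  multiplicative L and 1 <= i <= M this is the coefficient of T^i in T d/dT log of the series with
  terms L(f) T^(deg f).\<close>

definition mangoldt_sum :: "'a set \<Rightarrow> nat \<Rightarrow> ('a list \<Rightarrow> complex) \<Rightarrow> nat \<Rightarrow> complex" where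
  "mangoldt_sum K M L i = (\<Sum>P\<in>monic_irreducibles K M. \<Sum>j\<in>{1..M}.
     if j * (length P - 1) = i then of_nat (length P - 1) * L P ^ j else 0)"

text \<open>The logarithmic derivative of the Euler product of the multiplicative function \<open>L\<close>.\<close>

lemma sum_monics_recursion:
  assumes K: "subfield K R" "finite K"
    and L: "\<And>f g a b. f \<in> monics K a \<Longrightarrow> g \<in> monics K b \<Longrightarrow> L (poly_mult f g) = L f * L g"
    and L1: "L [\<one>] = 1" and m: "m \<le> M"
  shows "of_nat m * (\<Sum>f\<in>monics K m. L f) = (\<Sum>i\<in>{1..m}. mangoldt_sum K M L i * (\<Sum>f\<in>monics K (m - i). L f))"
proof -
  note K1 = subfieldE(1)[OF K(1)]
  interpret UP: domain "K[X]" using univ_poly_is_domain[OF K1] .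
  have oneK: "\<one> \<in> K" using K1 by (rule subringE(3))
  let ?I = "monic_irreducibles K M"
  have Lpow: "L (P [^]\<^bsub>K[X]\<^esub> (j :: nat)) = L P ^ j" if "P \<in> monics K d" for P d j
  proof (induction j)
    case 0 then show ?case by (simp add: univ_poly_one L1)
  next
    case (Suc j)
    then show ?case using L[OF monics_pow[OF K1 that] that, of j] by (simp add: univ_poly_mult mult.commute)
  qed
  \<comment> \<open>The multiples of P^j in degree m are the P^j h with h monic of degree m - j d,
    and L splits along this product; there are none if j d exceeds m.\<close>
  have inner: "(\<Sum>f\<in>monics K m. if mdvd K (P [^]\<^bsub>K[X]\<^esub> j) f then of_nat (length P - 1) * L f else 0)
      = (\<Sum>i\<in>{1..m}. (if j * (length P - 1) = i then of_nat (length P - 1) * L P ^ j else 0) * (\<Sum>f\<in>monics K (m - i). L f))"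
    if P: "P \<in> ?I" and j: "j \<in> {1..M}" for P j
  proof -
    obtain d where d: "1 \<le> d" "P \<in> monics K d" using P by (auto simp: monic_irreducibles_def)
    have lP: "length P - 1 = d" using monics_degree[OF d(2)] .
    let ?Q = "P [^]\<^bsub>K[X]\<^esub> j"
    have Q: "?Q \<in> monics K (j * d)" by (rule monics_pow[OF K1 d(2)])
    have fin: "finite (monics K m)" by (rule finite_monics[OF K(2) oneK])
    have l: "(\<Sum>f\<in>monics K m. if mdvd K ?Q f then of_nat (length P - 1) * L f else 0)
        = (\<Sum>f\<in>{f \<in> monics K m. mdvd K ?Q f}. of_nat d * L f)"
      unfolding lP by (rule sum.inter_filter[OF fin, symmetric])
    show ?thesis
    proof (cases "j * d \<le> m")
      case True
      have "bij_betw (poly_mult ?Q) (monics K (m - j * d)) {f \<in> monics K m. mdvd K ?Q f}"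
      proof (rule bij_betwI')
        fix g h assume gh: "g \<in> monics K (m - j * d)" "h \<in> monics K (m - j * d)"
        have "?Q \<noteq> \<zero>\<^bsub>K[X]\<^esub>" using monics_not_nil[OF Q] by (simp add: univ_poly_zero)
        then show "poly_mult ?Q g = poly_mult ?Q h \<longleftrightarrow> g = h"
          using UP.m_lcancel[OF _ monics_carrier[OF Q] monics_carrier[OF gh(1)] monics_carrier[OF gh(2)]]
          by (simp add: univ_poly_mult)
      next
        fix g assume g: "g \<in> monics K (m - j * d)"
        show "poly_mult ?Q g \<in> {f \<in> monics K m. mdvd K ?Q f}"
          using monics_mult[OF K1 Q g] True monics_carrier[OF g] by (auto simp: mdvd_def)
      next
        fix f assume "f \<in> {f \<in> monics K m. mdvd K ?Q f}"
        then obtain h where "f \<in> monics K m" "h \<in> carrier (K[X])" "f = poly_mult ?Q h" by (auto simp: mdvd_def)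
        then show "\<exists>h\<in>monics K (m - j * d). f = poly_mult ?Q h"
          using monics_quotient[OF K1 Q] by blast
      qed
      then have "(\<Sum>f\<in>{f \<in> monics K m. mdvd K ?Q f}. of_nat d * L f)
          = (\<Sum>h\<in>monics K (m - j * d). of_nat d * L (poly_mult ?Q h))"
        by (rule sum.reindex_bij_betw[symmetric])
      also have "\<dots> = (\<Sum>h\<in>monics K (m - j * d). of_nat d * (L P ^ j * L h))"
        by (rule sum.cong) (simp_all add: L[OF Q] Lpow[OF d(2)])
      also have "\<dots> = of_nat d * L P ^ j * (\<Sum>h\<in>monics K (m - j * d). L h)"
        by (simp add: sum_distrib_left mult.assoc)
      also have "\<dots> = (\<Sum>i\<in>{1..m}. if i = j * d then of_nat d * L P ^ j * (\<Sum>f\<in>monics K (m - i). L f) else 0)"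
        using True d(1) j by (subst sum.delta) auto
      also have "\<dots> = (\<Sum>i\<in>{1..m}. (if j * d = i then of_nat d * L P ^ j else 0) * (\<Sum>f\<in>monics K (m - i). L f))"
        by (rule sum.cong) auto
      finally show ?thesis unfolding l unfolding lP .
    next
      case False
      then have e: "{f \<in> monics K m. mdvd K ?Q f} = {}"
        using monics_quotient[OF K1 Q] by (auto simp: mdvd_def)
      moreover have "(\<Sum>i\<in>{1..m}. (if j * d = i then of_nat d * L P ^ j else 0) * (\<Sum>f\<in>monics K (m - i). L f)) = 0"
        using False by (intro sum.neutral) auto
      ultimately show ?thesis unfolding l e unfolding lP by (simp only: sum.empty)
    qed
  qed
  have "of_nat m * (\<Sum>f\<in>monics K m. L f) = (\<Sum>f\<in>monics K m. of_nat m * L f)"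
    by (rule sum_distrib_left)
  also have "\<dots> = (\<Sum>f\<in>monics K m. \<Sum>P\<in>?I. \<Sum>j\<in>{1..M}.
      if mdvd K (P [^]\<^bsub>K[X]\<^esub> j) f then of_nat (length P - 1) * L f else 0)"
  proof (rule sum.cong[OF refl])
    fix f assume f: "f \<in> monics K m"
    have "of_nat m * L f = (\<Sum>P\<in>?I. of_nat (length P - 1) * of_nat (card {j\<in>{1..M}. mdvd K (P [^]\<^bsub>K[X]\<^esub> j) f})) * L f"
      using arg_cong[OF degree_eq_sum_factors[OF K f m], of "of_nat :: nat \<Rightarrow> complex"] by simp
    also have "\<dots> = (\<Sum>P\<in>?I. \<Sum>j\<in>{1..M}. if mdvd K (P [^]\<^bsub>K[X]\<^esub> j) f then of_nat (length P - 1) * L f else 0)"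
      unfolding sum_distrib_right
    proof (rule sum.cong[OF refl])
      fix P
      show "of_nat (length P - 1) * of_nat (card {j\<in>{1..M}. mdvd K (P [^]\<^bsub>K[X]\<^esub> j) f}) * L f
          = (\<Sum>j\<in>{1..M}. if mdvd K (P [^]\<^bsub>K[X]\<^esub> j) f then of_nat (length P - 1) * L f else 0)"
        by (simp add: sum.inter_filter[symmetric] mult_ac)
    qed
    finally show "of_nat m * L f = \<dots>" .
  qed
  also have "\<dots> = (\<Sum>P\<in>?I. \<Sum>j\<in>{1..M}. \<Sum>f\<in>monics K m.
      if mdvd K (P [^]\<^bsub>K[X]\<^esub> j) f then of_nat (length P - 1) * L f else 0)"
    by (subst sum.swap) (intro sum.cong refl sum.swap)
  also have "\<dots> = (\<Sum>P\<in>?I. \<Sum>j\<in>{1..M}. \<Sum>i\<in>{1..m}.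
      (if j * (length P - 1) = i then of_nat (length P - 1) * L P ^ j else 0) * (\<Sum>f\<in>monics K (m - i). L f))"
    by (intro sum.cong refl inner)
  also have "\<dots> = (\<Sum>P\<in>?I. \<Sum>i\<in>{1..m}. \<Sum>j\<in>{1..M}.
      (if j * (length P - 1) = i then of_nat (length P - 1) * L P ^ j else 0) * (\<Sum>f\<in>monics K (m - i). L f))"
    by (intro sum.cong refl sum.swap)
  also have "\<dots> = (\<Sum>i\<in>{1..m}. \<Sum>P\<in>?I. \<Sum>j\<in>{1..M}.
      (if j * (length P - 1) = i then of_nat (length P - 1) * L P ^ j else 0) * (\<Sum>f\<in>monics K (m - i). L f))"
    by (rule sum.swap)
  also have "\<dots> = (\<Sum>i\<in>{1..m}. mangoldt_sum K M L i * (\<Sum>f\<in>monics K (m - i). L f))"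
    by (simp add: mangoldt_sum_def sum_distrib_right)
  finally show ?thesis .
qed

end

section \<open>The Davenport--Hasse lifting theorem\<close>

text \<open>The small field lives inside R as the fixed points of x -> x^q. That n is prime makes
  every other element have n distinct conjugates; that n is odd makes the sign in Davenport--Hasse
  disappear.\<close>

locale finite_field_ext = field R for R (structure) + fixes q n :: nat
  assumes fin: "finite (carrier R)" and card_R: "card (carrier R) = q ^ n" and q1: "q > 1"
    and frob_add: "\<And>x y. x \<in> carrier R \<Longrightarrow> y \<in> carrier R \<Longrightarrow> (x \<oplus> y) [^] q = x [^] q \<oplus> y [^] q"
    and card_fixed: "card {x \<in> carrier R. x [^] q = x} = q"
    and prime_n: "prime n" and odd_n: "odd n"
begin

declare poly_add.simps [simp del] poly_mult.simps [simp del]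

definition base_field :: "'a set" where
  "base_field = {x \<in> carrier R. x [^] q = x}"

abbreviation conj :: "'a \<Rightarrow> nat \<Rightarrow> 'a" where
  "conj x i \<equiv> x [^] (q ^ i)"

lemma base_fieldD: "x \<in> base_field \<Longrightarrow> x \<in> carrier R" "x \<in> base_field \<Longrightarrow> x [^] q = x"
  by (simp_all add: base_field_def)

lemma finite_base_field: "finite base_field"
  using fin by (simp add: base_field_def)

lemma card_base_field: "card base_field = q"
  using card_fixed by (simp add: base_field_def)

lemma pow_card:
  assumes x: "x \<in> carrier R" shows "conj x n = x"
proof (cases "x = \<zero>")
  case True
  have "q ^ n \<noteq> 0" using q1 by simp
  then show ?thesis using True by (simp add: nat_pow_zero)
next
  case False
  interpret G: group "mult_of R" by (rule field_mult_group)
  have "order (mult_of R) = q ^ n - 1" using order_mult_of[OF fin] card_R by (simp add: order_def)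
  then have "x [^] (q ^ n - 1) = \<one>"
    using G.pow_order_eq_1[of x] x False by (simp add: Multiplicative_Group.nat_pow_mult_of)
  then have "x [^] Suc (q ^ n - 1) = x" using x by simp
  then show ?thesis using q1 by simp
qed

lemma frob_hom: "ring_hom_ring R R (\<lambda>x. x [^] q)"
  by (rule ring_hom_ringI2) (auto intro!: ring_hom_memI simp: ring_axioms frob_add nat_pow_distrib)

lemma conj_closed [simp, intro]: "x \<in> carrier R \<Longrightarrow> conj x i \<in> carrier R"
  by simp

lemma conj_conj: "x \<in> carrier R \<Longrightarrow> conj (conj x i) j = conj x (i + j)"
  by (simp add: nat_pow_pow power_add)

lemma conj_Suc: "x \<in> carrier R \<Longrightarrow> conj x (Suc i) = conj x i [^] q"
  by (simp add: nat_pow_pow mult.commute)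

lemma conj_base: "x \<in> base_field \<Longrightarrow> conj x i = x"
proof (induction i)
  case (Suc i)
  then have "conj x (Suc i) = conj x i [^] q" using base_fieldD by (intro conj_Suc) auto
  then show ?case using Suc base_fieldD(2) by simp
qed (simp add: base_fieldD)

lemma subfield_base: "subfield base_field R"
proof (rule subfieldI'[OF subringI])
  show "base_field \<subseteq> carrier R" by (auto simp: base_field_def)
  show "\<one> \<in> base_field" by (simp add: base_field_def)
  interpret h: ring_hom_ring R R "\<lambda>x. x [^] q" by (rule frob_hom)
  show "\<ominus> h \<in> base_field" if "h \<in> base_field" for h
    using that h.hom_a_inv[of h] by (simp add: base_field_def)
  show "h1 \<otimes> h2 \<in> base_field" if "h1 \<in> base_field" "h2 \<in> base_field" for h1 h2
    using that by (simp add: base_field_def nat_pow_distrib)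
  show "h1 \<oplus> h2 \<in> base_field" if "h1 \<in> base_field" "h2 \<in> base_field" for h1 h2
    using that by (simp add: base_field_def frob_add)
  show "inv k \<in> base_field" if k: "k \<in> base_field - {\<zero>}" for k
  proof -
    have kU: "k \<in> Units R" using k by (simp add: base_field_def field_Units)
    have kc: "k \<in> carrier R" "inv k \<in> carrier R" "k [^] q = k" using kU k by (auto simp: base_field_def)
    have "(inv k \<otimes> k) [^] q = \<one>" using Units_l_inv[OF kU] by simp
    then have "inv k [^] q \<otimes> k [^] q = \<one>"
      using nat_pow_distrib[OF kc(2,1), of q] by simp
    then have "inv k [^] q = inv k" using k kU
      by (simp add: base_field_def) (metis Units_inv_closed inv_unique' inv_char nat_pow_closed m_comm)
    then show ?thesis using kU by (simp add: base_field_def)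
  qed
qed

lemma one_base: "\<one> \<in> base_field" and zero_base: "\<zero> \<in> base_field"
  using subringE[OF subfieldE(1)[OF subfield_base]] by auto

lemma n_gt_0: "n > 0"
  using prime_n prime_gt_0_nat by blast

text \<open>A coincidence of two conjugates means that x is fixed by the d-th power of Frobenius for
  some 0 < d < n, as well as by the n-th; d and n are coprime, so Frobenius itself fixes x.\<close>

lemma conj_inj:
  assumes x: "x \<in> carrier R" "x \<notin> base_field"
  shows "inj_on (conj x) {..<n}"
proof -
  have False if ij: "i < j" "j < n" "conj x i = conj x j" for i j
  proof -
    define d where "d = j - i"
    have d: "0 < d" "d < n" "j = i + d" using ij by (auto simp: d_def)
    have "conj (conj x i) (n - i) = conj (conj x j) (n - i)" using ij by simp
    moreover have "conj (conj x i) (n - i) = conj x n"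
    proof -
      have "i + (n - i) = n" using ij by simp
      then show ?thesis using x by (simp only: conj_conj)
    qed
    moreover have "conj (conj x j) (n - i) = conj (conj x n) d"
    proof -
      have "j + (n - i) = n + d" using d ij by simp
      then show ?thesis using x by (simp only: conj_conj)
    qed
    ultimately have "conj x n = conj (conj x n) d" by simp
    then have xd: "conj x d = x" using pow_card[OF x(1)] by simp
    have "coprime d n" using d prime_n
      by (metis coprime_commute dvd_imp_le linorder_not_less prime_imp_coprime)
    then obtain a where "[d * a = Suc 0] (mod n)" using cong_solve_coprime_nat by blast
    then have "(d * a) mod n = 1" using prime_gt_1_nat[OF prime_n] by (simp add: cong_def)
    then obtain b where b: "d * a = b * n + 1" by (metis div_mult_mod_eq)
    have r: "conj x (m * c) = x" if "conj x m = x" for m c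
      by (induction c) (use x that in \<open>simp_all add: conj_conj[symmetric]\<close>)
    have "x = conj x (n * b + 1)" using r[OF xd, of a] b by (simp add: mult.commute)
    also have "\<dots> = conj (conj x (n * b)) 1" using x by (simp only: conj_conj)
    also have "\<dots> = x [^] q" using r[OF pow_card[OF x(1)]] by simp
    finally show False using x by (simp add: base_field_def)
  qed
  then show ?thesis by (intro inj_onI) (metis lessThan_iff linorder_neqE_nat)
qed

section \<open>Norm and trace as coefficients of the polynomial of conjugates\<close>

primrec lin_prod :: "(nat \<Rightarrow> 'a) \<Rightarrow> nat \<Rightarrow> 'a list" where
  "lin_prod c 0 = [\<one>]"
| "lin_prod c (Suc m) = poly_mult [\<one>, c m] (lin_prod c m)"

lemma lin_monic: "x \<in> K \<Longrightarrow> \<one> \<in> K \<Longrightarrow> [\<one>, x] \<in> monics K 1"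
  by (auto simp: monics_def polynomial_def)

lemma lin_prod_monic:
  assumes "subring K R" "\<And>i. c i \<in> K"
  shows "lin_prod c m \<in> monics K m"
proof (induction m)
  case 0 then show ?case using subringE(3)[OF assms(1)] by (simp add: monics_0)
next
  case (Suc m)
  then show ?case using monics_mult[OF assms(1) lin_monic Suc] assms subringE(3)[OF assms(1)] by simp
qed

text \<open>The value 0 for the constant polynomial 1 makes the passage from products to sums hold
  in all degrees.\<close>

definition next_coeff :: "'a list \<Rightarrow> 'a" where
  "next_coeff f = (if length f \<le> 1 then \<zero> else coeff f (length f - 2))"

lemma coeff_0_mult:
  "set f \<subseteq> carrier R \<Longrightarrow> set g \<subseteq> carrier R \<Longrightarrow> coeff (poly_mult f g) 0 = coeff f 0 \<otimes> coeff g 0"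
  by (simp add: poly_mult_coeff)

text \<open>Just below the top degree only two products contribute, and each contains a leading
  coefficient 1. A factor of degree 0 is the polynomial 1 and is treated apart.\<close>

lemma next_coeff_mult:
  assumes f: "f \<in> monics (carrier R) a" and g: "g \<in> monics (carrier R) b"
  shows "next_coeff (poly_mult f g) = next_coeff f \<oplus> next_coeff g"
proof -
  note c = monics_set[OF f] monics_set[OF g]
  have nf: "next_coeff f \<in> carrier R" "next_coeff g \<in> carrier R" using c by (auto simp: next_coeff_def)
  consider "a = 0" | "b = 0" | "a > 0" "b > 0" by auto
  then show ?thesis
  proof cases
    case 1
    then have "f = [\<one>]" using f monics_0 by simp
    moreover have "poly_mult [\<one>] g = g"
      using poly_mult_one[OF carrier_is_subring, of g] g by (simp add: monics_def)
    ultimately show ?thesis using nf by (simp add: next_coeff_def)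
  next
    case 2
    then have "g = [\<one>]" using g monics_0 by simp
    moreover have "poly_mult f [\<one>] = f"
      using poly_mult_one[OF carrier_is_subring, of f] f by (simp add: monics_def)
    ultimately show ?thesis using nf by (simp add: next_coeff_def)
  next
    case 3
    have len: "length f = Suc a" "length g = Suc b" "length (poly_mult f g) = Suc (a + b)"
      using f g monics_mult[OF carrier_is_subring f g] by (auto simp: monics_def)
        (metis Suc_pred length_greater_0_conv)+
    have cf: "coeff f a = \<one>" "coeff g b = \<one>"
      using lead_coeff_simp[of f] lead_coeff_simp[of g] f g len by (auto simp: monics_def)
    obtain N where N: "N = a + b - 1" by simp
    have "next_coeff (poly_mult f g) = coeff (poly_mult f g) N"
      using len 3 by (simp add: next_coeff_def N)
    also have "\<dots> = (\<Oplus>k\<in>{..N}. coeff f k \<otimes> coeff g (N - k))"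
      by (simp add: poly_mult_coeff[OF c])
    also have "\<dots> = (\<Oplus>k\<in>{a - 1, a}. coeff f k \<otimes> coeff g (N - k))"
    proof (rule add.finprod_mono_neutral_cong_right)
      show "{a - 1, a} \<subseteq> {..N}" using 3 N by auto
      fix k assume k: "k \<in> {..N} - {a - 1, a}"
      show "coeff f k \<otimes> coeff g (N - k) = \<zero>"
      proof (cases "k > a")
        case True then show ?thesis using coeff_length[of f k] len c by simp
      next
        case False
        then have "N - k \<ge> length g" using k N len by auto
        then show ?thesis using coeff_length[of g "N - k"] c by simp
      qed
    qed (use c in auto)
    also have "\<dots> = coeff f (a - 1) \<otimes> coeff g (N - (a - 1)) \<oplus> coeff f a \<otimes> coeff g (N - a)"
      using 3(1) c by (subst finsum_insert) auto
    also have "\<dots> = coeff f (a - 1) \<oplus> coeff g (b - 1)"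
    proof -
      have "N - (a - 1) = b" "N - a = b - 1" using 3 N by auto
      then show ?thesis using cf c by simp
    qed
    also have "\<dots> = next_coeff f \<oplus> next_coeff g" using len 3 by (simp add: next_coeff_def)
    finally show ?thesis .
  qed
qed

lemma coeff_0_lin_prod:
  assumes "\<And>i. c i \<in> carrier R" shows "coeff (lin_prod c m) 0 = (\<Otimes>i\<in>{..<m}. c i)"
proof (induction m)
  case (Suc m)
  have "set (lin_prod c m) \<subseteq> carrier R"
    using monics_set[OF lin_prod_monic[OF carrier_is_subring]] assms by blast
  then show ?case using assms Suc by (simp add: coeff_0_mult lessThan_Suc)
qed simp

lemma next_coeff_lin_prod:
  assumes "\<And>i. c i \<in> carrier R" shows "next_coeff (lin_prod c m) = (\<Oplus>i\<in>{..<m}. c i)"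
proof (induction m)
  case (Suc m)
  have "lin_prod c m \<in> monics (carrier R) m" "[\<one>, c m] \<in> monics (carrier R) 1"
    using lin_prod_monic[OF carrier_is_subring] lin_monic assms by auto
  then show ?case using assms Suc by (simp add: next_coeff_mult lessThan_Suc) (simp add: next_coeff_def)
qed (simp add: next_coeff_def)

lemma eval_lin_prod:
  assumes c: "\<And>i. c i \<in> carrier R" and y: "y \<in> carrier R"
  shows "eval (lin_prod c m) y = \<zero> \<longleftrightarrow> (\<exists>i<m. y = \<ominus> c i)"
proof (induction m)
  case 0 then show ?case using y by simp
next
  case (Suc m)
  have s: "set (lin_prod c m) \<subseteq> carrier R"
    using monics_set[OF lin_prod_monic[OF carrier_is_subring]] assms by blast
  have "eval (lin_prod c (Suc m)) y = (y \<oplus> c m) \<otimes> eval (lin_prod c m) y"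
    using c y s by (simp add: eval_poly_mult)
  moreover have "y \<oplus> c m = \<zero> \<longleftrightarrow> y = \<ominus> c m"
    using c[of m] y by (metis minus_equality l_neg)
  ultimately have "eval (lin_prod c (Suc m)) y = \<zero> \<longleftrightarrow> y = \<ominus> c m \<or> (\<exists>i<m. y = \<ominus> c i)"
    using Suc c y s eval_in_carrier integral_iff[of "y \<oplus> c m" "eval (lin_prod c m) y"] by auto
  then show ?case using less_Suc_eq by auto
qed

lemma map_frob_mult:
  assumes f: "f \<in> monics (carrier R) a" and g: "g \<in> monics (carrier R) b"
  shows "map (\<lambda>x. x [^] q) (poly_mult f g) = poly_mult (map (\<lambda>x. x [^] q) f) (map (\<lambda>x. x [^] q) g)"
proof -
  interpret h: ring_hom_ring R R "\<lambda>x. x [^] q" by (rule frob_hom)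
  have m: "poly_mult f g \<in> monics (carrier R) (a + b)" by (rule monics_mult[OF carrier_is_subring f g])
  have "polynomial (carrier R) (map (\<lambda>x. x [^] q) (poly_mult f g))"
    using m by (cases "poly_mult f g") (auto simp: monics_def polynomial_def)
  then have "normalize (map (\<lambda>x. x [^] q) (poly_mult f g)) = map (\<lambda>x. x [^] q) (poly_mult f g)"
    by (rule normalize_polynomial)
  then show ?thesis using h.poly_mult_hom'[OF monics_set[OF f] monics_set[OF g]] by simp
qed

lemma map_frob_lin_prod:
  assumes c: "\<And>i. c i \<in> carrier R"
  shows "map (\<lambda>x. x [^] q) (lin_prod c m) = lin_prod (\<lambda>i. c i [^] q) m"
proof (induction m)
  case (Suc m)
  have "lin_prod c m \<in> monics (carrier R) m" "[\<one>, c m] \<in> monics (carrier R) 1"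
    using lin_prod_monic[OF carrier_is_subring] lin_monic assms by auto
  then show ?case using Suc by (simp add: map_frob_mult)
qed simp

text \<open>Linear factors X + x^(q^i), with a plus sign, make norm and trace of x appear as
  coefficients without signs. The price is that the roots are the negatives of the
  conjugates.\<close>

abbreviation conj_poly :: "'a \<Rightarrow> 'a list" where
  "conj_poly x \<equiv> lin_prod (conj x) n"

lemma lin_prod_shift:
  assumes c: "\<And>i. c i \<in> carrier R"
  shows "poly_mult (lin_prod (\<lambda>i. c (Suc i)) m) [\<one>, c 0] = lin_prod c (Suc m)"
proof (induction m)
  case 0
  have "polynomial (carrier R) [\<one>, c 0]" using c by (auto simp: polynomial_def)
  then show ?case using poly_mult_one[OF carrier_is_subring] by simp
next
  case (Suc m)
  interpret UP: domain "(carrier R)[X]" using univ_poly_is_domain[OF carrier_is_subring] .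
  have car: "lin_prod (\<lambda>i. c (Suc i)) m \<in> carrier ((carrier R)[X])" "[\<one>, c i] \<in> carrier ((carrier R)[X])" for i
    using monics_carrier[OF lin_prod_monic[OF carrier_is_subring]] monics_carrier[OF lin_monic] c by auto
  have "poly_mult (lin_prod (\<lambda>i. c (Suc i)) (Suc m)) [\<one>, c 0]
      = poly_mult [\<one>, c (Suc m)] (poly_mult (lin_prod (\<lambda>i. c (Suc i)) m) [\<one>, c 0])"
    using UP.m_assoc[OF car(2) car(1) car(2)] by (simp add: univ_poly_mult)
  then show ?case using Suc by simp
qed

text \<open>Frobenius permutes the linear factors cyclically. After multiplication by X + x both
  sides are the product of n + 1 consecutive factors, and X + x cancels.\<close>

lemma conj_poly_frob:
  assumes x: "x \<in> carrier R"
  shows "conj_poly (x [^] q) = conj_poly x"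
proof -
  interpret UP: domain "(carrier R)[X]" using univ_poly_is_domain[OF carrier_is_subring] .
  have s: "conj (x [^] q) = (\<lambda>i. conj x (Suc i))" using x by (auto simp: nat_pow_pow)
  have car: "lin_prod c n \<in> carrier ((carrier R)[X])" "[\<one>, c 0] \<in> carrier ((carrier R)[X])"
    if "\<And>i. c i \<in> carrier R" for c
    using monics_carrier[OF lin_prod_monic[OF carrier_is_subring that]] monics_carrier[OF lin_monic[OF that]] by auto
  have "poly_mult (conj_poly (x [^] q)) [\<one>, conj x 0] = poly_mult [\<one>, conj x n] (conj_poly x)"
    unfolding s using lin_prod_shift[of "conj x" n] x by simp
  also have "\<dots> = poly_mult (conj_poly x) [\<one>, conj x 0]"
    using UP.m_comm[OF car(2) car(1), of "conj x" "conj x"] x pow_card[OF x] by (simp add: univ_poly_mult)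
  finally show ?thesis
    using UP.m_rcancel[of "[\<one>, conj x 0]" "conj_poly (x [^] q)" "conj_poly x"] car[of "conj x"] car[of "conj (x [^] q)"] x
    by (simp add: univ_poly_mult univ_poly_zero)
qed

lemma conj_poly_monic:
  assumes x: "x \<in> carrier R"
  shows "conj_poly x \<in> monics base_field n"
proof -
  have m: "conj_poly x \<in> monics (carrier R) n" using lin_prod_monic[OF carrier_is_subring] x by simp
  have "map (\<lambda>x. x [^] q) (conj_poly x) = conj_poly (x [^] q)"
  proof -
    have "(\<lambda>i. conj x i [^] q) = conj (x [^] q)" using x by (auto simp: nat_pow_pow mult.commute)
    then show ?thesis using map_frob_lin_prod[of "conj x"] x by simp
  qed
  then have "map (\<lambda>x. x [^] q) (conj_poly x) = map (\<lambda>x. x) (conj_poly x)" using conj_poly_frob[OF x] by simp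
  then have "\<forall>y\<in>set (conj_poly x). y [^] q = y" by (simp only: map_eq_conv)
  then have "set (conj_poly x) \<subseteq> base_field" using monics_set[OF m] by (auto simp: base_field_def)
  then show ?thesis using m by (auto simp: monics_def polynomial_def)
qed

lemma card_roots_le:
  assumes g: "g \<in> carrier ((carrier R)[X])" "g \<noteq> []" and A: "A \<subseteq> {y \<in> carrier R. eval g y = \<zero>}"
  shows "card A \<le> length g - 1"
proof -
  have "A \<subseteq> set_mset (roots g)" using A g roots_mem_iff_is_root[OF g(1)] by (auto simp: is_root_def)
  then have "card A \<le> card (set_mset (roots g))" by (intro card_mono) auto
  also have "\<dots> \<le> size (roots g)"
    unfolding size_multiset_overloaded_eq by (subst card_eq_sum) (intro sum_mono, simp)
  also have "\<dots> \<le> length g - 1" by (rule size_roots_le_degree[OF g(1)])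
  finally show ?thesis .
qed

text \<open>Frobenius fixes the coefficients of g and carries its root -x through the n distinct
  negatives of the conjugates.\<close>

lemma degree_of_root:
  assumes x: "x \<in> carrier R" "x \<notin> base_field"
    and g: "g \<in> carrier (base_field[X])" "g \<noteq> []" and e: "eval g (\<ominus> x) = \<zero>"
  shows "n \<le> length g - 1"
proof -
  interpret h: ring_hom_ring R R "\<lambda>x. x [^] q" by (rule frob_hom)
  have gK: "set g \<subseteq> base_field" using g by (auto simp: univ_poly_carrier[symmetric] polynomial_def)
  then have gm: "map (\<lambda>x. x [^] q) g = g" using base_fieldD(2) by (intro map_idI) auto
  have gc: "set g \<subseteq> carrier R" using gK base_fieldD(1) by auto
  have ev: "eval g (\<ominus> conj x i) = \<zero>" for i
  proof (induction i)
    case 0 then show ?case using e x by simp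
  next
    case (Suc i)
    have "(\<ominus> conj x i) [^] q = \<ominus> conj x (Suc i)"
      using h.hom_a_inv[of "conj x i"] x by (simp add: nat_pow_pow mult.commute)
    then show ?case using h.eval_hom'[of "\<ominus> conj x i" g] gc gm x Suc q1 by (simp add: nat_pow_zero)
  qed
  have "card ((\<lambda>i. \<ominus> conj x i) ` {..<n}) = n"
  proof (subst card_image)
    show "inj_on (\<lambda>i. \<ominus> conj x i) {..<n}"
    proof (rule inj_onI)
      fix i j assume ij: "i \<in> {..<n}" "j \<in> {..<n}" "\<ominus> conj x i = \<ominus> conj x j"
      from arg_cong[OF ij(3), of "a_inv R"] have "conj x i = conj x j" using x by (simp only: minus_minus conj_closed)
      then show "i = j" using inj_onD[OF conj_inj[OF x] _ ij(1,2)] by blast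
    qed
  qed simp
  moreover have "g \<in> carrier ((carrier R)[X])"
    using g gc by (auto simp: univ_poly_carrier[symmetric] polynomial_def)
  ultimately show ?thesis using card_roots_le[of g "(\<lambda>i. \<ominus> conj x i) ` {..<n}"] g(2) ev x by auto
qed

text \<open>One of two factors vanishes at -x, so it already has the full degree n and the other is
  constant.\<close>

lemma conj_poly_irreducible:
  assumes x: "x \<in> carrier R" "x \<notin> base_field"
  shows "pirreducible base_field (conj_poly x)"
proof -
  note K = subfield_base and K1 = subfieldE(1)[OF subfield_base]
  note m = conj_poly_monic[OF x(1)]
  show ?thesis
  proof (rule pirreducibleI[OF K1 monics_carrier[OF m] monics_not_nil[OF m]])
    show "conj_poly x \<notin> Units (base_field[X])"
      using univ_poly_units'[OF K, of "conj_poly x"] monics_degree[OF m] n_gt_0 by linarith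
    fix a b assume ab: "a \<in> carrier (base_field[X])" "b \<in> carrier (base_field[X])"
      "conj_poly x = a \<otimes>\<^bsub>base_field[X]\<^esub> b"
    have pol: "polynomial base_field a" "polynomial base_field b" using ab by (auto simp: univ_poly_carrier)
    have inc: "set a \<subseteq> carrier R" "set b \<subseteq> carrier R" using polynomial_in_carrier[OF K1] pol by auto
    have Pab: "conj_poly x = poly_mult a b" using ab by (simp add: univ_poly_mult)
    have ne: "a \<noteq> []" "b \<noteq> []"
      using monics_not_nil[OF m] Pab poly_mult_zero[OF inc(1)] poly_mult_zero[OF inc(2)] by auto
    have deg: "length a - 1 + (length b - 1) = n"
      using poly_mult_degree_eq[OF K1 pol] ne Pab monics_degree[OF m] by simp
    have "eval (conj_poly x) (\<ominus> conj x 0) = \<zero>"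
      using eval_lin_prod[of "conj x" "\<ominus> conj x 0" n] x n_gt_0 by auto
    then have "eval a (\<ominus> x) \<otimes> eval b (\<ominus> x) = \<zero>"
      using Pab eval_poly_mult[OF inc, of "\<ominus> x"] x by simp
    then have "eval a (\<ominus> x) = \<zero> \<or> eval b (\<ominus> x) = \<zero>"
      using eval_in_carrier inc x by (simp add: integral_iff)
    then have "n \<le> length a - 1 \<or> n \<le> length b - 1"
      using degree_of_root[OF x ab(1) ne(1)] degree_of_root[OF x ab(2) ne(2)] by blast
    then have "length a - 1 = 0 \<or> length b - 1 = 0" using deg by linarith
    then show "a \<in> Units (base_field[X]) \<or> b \<in> Units (base_field[X])"
      using univ_poly_units'[OF K, of a] univ_poly_units'[OF K, of b] ab ne by blast
  qed
qed

lemma conj_poly_fiber: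
  assumes x: "x \<in> carrier R"
  shows "{y \<in> carrier R. conj_poly y = conj_poly x} = conj x ` {..<n}"
proof (intro equalityI subsetI)
  fix y assume "y \<in> {y \<in> carrier R. conj_poly y = conj_poly x}"
  then have y: "y \<in> carrier R" "conj_poly y = conj_poly x" by auto
  have "eval (conj_poly y) (\<ominus> conj y 0) = \<zero>"
    using eval_lin_prod[of "conj y" "\<ominus> conj y 0" n] y n_gt_0 by auto
  then obtain i where i: "i < n" "\<ominus> conj y 0 = \<ominus> conj x i"
    using eval_lin_prod[of "conj x" "\<ominus> conj y 0" n] x y by auto
  have "y = conj x i" using x y arg_cong[OF i(2), of "a_inv R"] by (simp add: minus_minus)
  then show "y \<in> conj x ` {..<n}" using i by auto
next
  fix y assume "y \<in> conj x ` {..<n}"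
  then obtain i where i: "y = conj x i" by auto
  have "conj_poly (conj x i) = conj_poly x"
  proof (induction i)
    case (Suc i)
    have "conj x (Suc i) = conj x i [^] q" by (rule conj_Suc[OF x])
    then show ?case using conj_poly_frob[of "conj x i"] x Suc by simp
  qed (use x in simp)
  then show "y \<in> {y \<in> carrier R. conj_poly y = conj_poly x}" using i x by simp
qed

lemma sum_conj_poly:
  fixes g :: "'a list \<Rightarrow> complex"
  shows "(\<Sum>x\<in>carrier R - base_field. g (conj_poly x))
    = of_nat n * (\<Sum>P\<in>conj_poly ` (carrier R - base_field). g P)"
proof -
  let ?A = "carrier R - base_field"
  have "(\<Sum>x\<in>?A. g (conj_poly x)) = (\<Sum>P\<in>conj_poly ` ?A. \<Sum>x\<in>{x\<in>?A. conj_poly x = P}. g (conj_poly x))"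
    by (rule sum.image_gen) (use fin in simp)
  also have "\<dots> = (\<Sum>P\<in>conj_poly ` ?A. of_nat n * g P)"
  proof (rule sum.cong[OF refl])
    fix P assume "P \<in> conj_poly ` ?A"
    then obtain x where x: "x \<in> ?A" "P = conj_poly x" by auto
    have "{y\<in>?A. conj_poly y = P} = conj x ` {..<n}"
    proof -
      have "conj x i \<notin> base_field" if "i < n" for i
      proof
        assume c: "conj x i \<in> base_field"
        have "i + (n - i) = n" using that by simp
        then have "conj (conj x i) (n - i) = conj x n" using x by (simp only: conj_conj Diff_iff)
        then have "conj x i = x" using conj_base[OF c] pow_card[of x] x by simp
        then show False using c x by simp
      qed
      then show ?thesis using conj_poly_fiber[of x] x by auto
    qed
    moreover have "card (conj x ` {..<n}) = n" using card_image[OF conj_inj] x by simp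
    ultimately have "card {y\<in>?A. conj_poly y = P} = n" by simp
    moreover have "(\<Sum>y\<in>{y\<in>?A. conj_poly y = P}. g (conj_poly y)) = (\<Sum>y\<in>{y\<in>?A. conj_poly y = P}. g P)"
      by (rule sum.cong) auto
    ultimately show "(\<Sum>y\<in>{y\<in>?A. conj_poly y = P}. g (conj_poly y)) = of_nat n * g P" by simp
  qed
  finally show ?thesis by (simp add: sum_distrib_left)
qed

abbreviation irr_n :: "'a list set" where
  "irr_n \<equiv> {P \<in> monics base_field n. pirreducible base_field P}"

text \<open>As n is prime, a prime power P^j of degree n has either deg P = n and j = 1, or deg P =
  1 and j = n.\<close>

lemma mangoldt_sum_n:
  "mangoldt_sum base_field n L n = of_nat n * (\<Sum>P\<in>irr_n. L P) + (\<Sum>c\<in>base_field. L [\<one>, c] ^ n)"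
proof -
  let ?I = "monic_irreducibles base_field n"
  let ?L1 = "monics base_field 1"
  have finI: "finite ?I" by (rule finite_monic_irreducibles[OF finite_base_field one_base])
  have n1: "n > 1" using prime_n prime_gt_1_nat by blast
  have irr1: "P \<in> ?I" if "P \<in> ?L1" for P
    using degree_one_imp_pirreducible[OF subfield_base monics_carrier[OF that]] monics_degree[OF that] that n1
    unfolding monic_irreducibles_def by (auto intro!: bexI[of _ 1])
  have irrn: "P \<in> ?I" if "P \<in> irr_n" for P
    using that n1 unfolding monic_irreducibles_def by (auto intro!: bexI[of _ n])
  have inner: "(\<Sum>j\<in>{1..n}. if j * (length P - 1) = n then of_nat (length P - 1) * L P ^ j else 0)
      = (if P \<in> irr_n then of_nat n * L P else 0) + (if P \<in> ?L1 then L P ^ n else 0)" (is "?l = ?r")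
    if P: "P \<in> ?I" for P
  proof -
    obtain d where d: "d \<in> {1..n}" "P \<in> monics base_field d" and irr: "pirreducible base_field P"
      using P unfolding monic_irreducibles_def by blast
    have ld: "length P - 1 = d" by (rule monics_degree[OF d(2)])
    have uniq: "P \<in> monics base_field d' \<longleftrightarrow> d' = d" for d' using d(2) monics_degree by metis
    consider "d = 1" | "d = n" "d \<noteq> 1" | "d \<noteq> 1" "d \<noteq> n" by blast
    then show ?thesis
    proof cases
      case 1
      have "?l = (\<Sum>j\<in>{1..n}. if j = n then L P ^ j else 0)"
        unfolding ld using 1 by (intro sum.cong) auto
      then show ?thesis using 1 n1 uniq by simp
    next
      case 2
      have "?l = (\<Sum>j\<in>{1..n}. if j = 1 then of_nat n * L P ^ j else 0)"
        unfolding ld using 2 n1 by (intro sum.cong) auto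
      then show ?thesis using 2 n1 uniq irr by simp
    next
      case 3
      have "\<not> d dvd n" using 3 prime_n by (auto simp: prime_nat_iff)
      then have "?l = 0" unfolding ld by (intro sum.neutral) (metis dvd_triv_right)
      then show ?thesis using 3 uniq by simp
    qed
  qed
  have "mangoldt_sum base_field n L n
      = (\<Sum>P\<in>?I. (if P \<in> irr_n then of_nat n * L P else 0)) + (\<Sum>P\<in>?I. (if P \<in> ?L1 then L P ^ n else 0))"
    unfolding mangoldt_sum_def sum.distrib[symmetric] by (rule sum.cong[OF refl inner])
  also have "(\<Sum>P\<in>?I. (if P \<in> irr_n then of_nat n * L P else 0)) = (\<Sum>P\<in>irr_n. of_nat n * L P)"
    using irrn by (subst sum.inter_restrict[OF finI, symmetric]) (intro sum.cong, auto)
  also have "(\<Sum>P\<in>?I. (if P \<in> ?L1 then L P ^ n else 0)) = (\<Sum>P\<in>?L1. L P ^ n)"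
    using irr1 by (subst sum.inter_restrict[OF finI, symmetric]) (intro sum.cong, auto)
  also have "?L1 = (\<lambda>c. [\<one>, c]) ` base_field"
    unfolding monics_eq_image[OF one_base] by (auto simp: length_Suc_conv image_iff)
  also have "(\<Sum>P\<in>(\<lambda>c. [\<one>, c]) ` base_field. L P ^ n) = (\<Sum>c\<in>base_field. L [\<one>, c] ^ n)"
    by (subst sum.reindex) (auto simp: inj_on_def)
  finally show ?thesis by (simp add: sum_distrib_left)
qed

lemma card_monics: "card (monics base_field m) = q ^ m"
  unfolding monics_eq_image[OF one_base]
  by (subst card_image) (auto simp: card_lists_length_eq finite_base_field card_base_field)

text \<open>There are q^m monic polynomials of degree m, and for L = 1 the recursion is solved by
  q^i. This yields the number of irreducible polynomials of degree n.\<close>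

lemma mangoldt_sum_one:
  assumes "1 \<le> i" "i \<le> n"
  shows "mangoldt_sum base_field n (\<lambda>_. 1) i = of_nat (q ^ i)"
  using assms
proof (induction i rule: less_induct)
  case (less i)
  let ?S = "mangoldt_sum base_field n (\<lambda>_. 1)"
  have "of_nat i * of_nat (q ^ i) = (\<Sum>j\<in>{1..i}. ?S j * of_nat (q ^ (i - j)))"
    using sum_monics_recursion[OF subfield_base finite_base_field, of "\<lambda>_. 1" i n] less.prems
    by (simp add: card_monics)
  also have "\<dots> = ?S i + (\<Sum>j\<in>{1..i} - {i}. ?S j * of_nat (q ^ (i - j)))"
    using less.prems by (subst sum.remove[of _ i]) auto
  also have "(\<Sum>j\<in>{1..i} - {i}. ?S j * of_nat (q ^ (i - j))) = (\<Sum>j\<in>{1..i} - {i}. of_nat (q ^ i))"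
    using less by (intro sum.cong refl) (auto simp flip: of_nat_mult power_add)
  also have "\<dots> = of_nat (i - 1) * of_nat (q ^ i)" using less.prems by simp
  finally show ?case using less.prems by (simp add: of_nat_diff algebra_simps)
qed

text \<open>Inclusion and equal size: n times either cardinality is q^n - q, on one side by the
  Mangoldt sum for L = 1, on the other by the fibres of size n.\<close>

lemma irr_n_eq: "irr_n = conj_poly ` (carrier R - base_field)"
proof (rule sym, rule card_subset_eq)
  show "finite irr_n" using finite_monics[OF finite_base_field one_base] by simp
  show sub: "conj_poly ` (carrier R - base_field) \<subseteq> irr_n"
    using conj_poly_monic conj_poly_irreducible by auto
  have "of_nat (n * card irr_n + q) = (of_nat (q ^ n) :: complex)"
    using mangoldt_sum_n[of "\<lambda>_. 1"] mangoldt_sum_one[of n] n_gt_0 card_base_field by simp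
  then have 1: "n * card irr_n + q = q ^ n" by (simp only: of_nat_eq_iff)
  have "of_nat (card (carrier R - base_field))
      = (of_nat (n * card (conj_poly ` (carrier R - base_field))) :: complex)"
    using sum_conj_poly[of "\<lambda>_. 1"] by simp
  then have "card (carrier R - base_field) = n * card (conj_poly ` (carrier R - base_field))"
    by (simp only: of_nat_eq_iff)
  moreover have "card (carrier R - base_field) = q ^ n - q"
    using card_Diff_subset[OF finite_base_field, of "carrier R"] card_R card_base_field base_fieldD by auto
  ultimately have "n * card (conj_poly ` (carrier R - base_field)) = n * card irr_n" using 1 by linarith
  then show "card (conj_poly ` (carrier R - base_field)) = card irr_n" using n_gt_0 by simp
qed

text \<open>The function L f = \<open>\<chi>\<close> (constant term) * \<open>\<psi>\<close> (next
  coefficient) is completely multiplicative, and its sums over the monic polynomials of degree 0, 1,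
  2, 3, ... are 1, G, 0, 0, ... Hence the n-th coefficient of the logarithmic derivative of 1 + G T,
  which is (-1)^(n-1) G^n, equals the Mangoldt sum; the latter, written over irreducible polynomials
  of degree n and linear ones, is the lifted Gauss sum.\<close>

theorem davenport_hasse:
  fixes \<chi> \<psi> :: "'a \<Rightarrow> complex"
  assumes chi_mult: "\<And>x y. x \<in> base_field \<Longrightarrow> y \<in> base_field \<Longrightarrow> \<chi> (x \<otimes> y) = \<chi> x * \<chi> y"
    and chi_one: "\<chi> \<one> = 1" and chi_zero: "\<chi> \<zero> = 0" and chi_sum: "(\<Sum>c\<in>base_field. \<chi> c) = 0"
    and psi_add: "\<And>x y. x \<in> base_field \<Longrightarrow> y \<in> base_field \<Longrightarrow> \<psi> (x \<oplus> y) = \<psi> x * \<psi> y"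
    and psi_zero: "\<psi> \<zero> = 1"
  shows "(\<Sum>x\<in>carrier R. \<chi> (\<Otimes>i\<in>{..<n}. conj x i) * \<psi> (\<Oplus>i\<in>{..<n}. conj x i))
    = (\<Sum>c\<in>base_field. \<chi> c * \<psi> c) ^ n"
proof -
  note K1 = subfieldE(1)[OF subfield_base]
  have sub: "base_field \<subseteq> carrier R" using base_fieldD by auto
  define L where "L f = \<chi> (coeff f 0) * \<psi> (next_coeff f)" for f
  define G where "G = (\<Sum>c\<in>base_field. \<chi> c * \<psi> c)"
  have coeffK: "coeff f i \<in> base_field" if "f \<in> monics base_field a" for f a i
  proof (cases "i < length f")
    case True
    then have "coeff f i \<in> set f" unfolding coeff_img_restrict[of f, symmetric] by (rule imageI[OF lessThan_iff[THEN iffD2]])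
    then show ?thesis using monics_set[OF that] by blast
  next
    case False then show ?thesis using coeff_length[of f i] zero_base by simp
  qed
  have nextK: "next_coeff f \<in> base_field" if "f \<in> monics base_field a" for f a
    using coeffK[OF that] zero_base by (simp add: next_coeff_def)
  have Lmult: "L (poly_mult f g) = L f * L g" if f: "f \<in> monics base_field a" and g: "g \<in> monics base_field b" for f g a b
    unfolding L_def coeff_0_mult[OF order_trans[OF monics_set[OF f] sub] order_trans[OF monics_set[OF g] sub]]
      next_coeff_mult[OF monics_mono[OF f sub] monics_mono[OF g sub]]
    by (simp add: chi_mult coeffK[OF f] coeffK[OF g] psi_add nextK[OF f] nextK[OF g])
  have Lone: "L [\<one>] = 1" by (simp add: L_def next_coeff_def chi_one psi_zero)
  have Llin: "L [\<one>, c] = \<chi> c * \<psi> c" for c by (simp add: L_def next_coeff_def)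
  have S0: "(\<Sum>f\<in>monics base_field 0. L f) = 1" by (simp add: monics_0[OF one_base] Lone)
  have S1: "(\<Sum>f\<in>monics base_field 1. L f) = G"
  proof -
    have "monics base_field 1 = (\<lambda>c. [\<one>, c]) ` base_field"
      unfolding monics_eq_image[OF one_base] by (auto simp: length_Suc_conv image_iff)
    then show ?thesis by (simp add: sum.reindex inj_on_def Llin G_def)
  qed
  \<comment> \<open>From degree 2 on the constant term and the coefficient after the leading one are
    different entries, so the sum over the constant term separates and is 0.\<close>
  have S2: "(\<Sum>f\<in>monics base_field m. L f) = 0" if m: "m \<ge> 2" for m
  proof -
    let ?X = "{ys. set ys \<subseteq> base_field \<and> length ys = m - 2}"
    have "monics base_field m = (\<lambda>(b, ys, z). \<one> # b # ys @ [z]) ` (base_field \<times> ?X \<times> base_field)" (is "?l = ?r")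
    proof (intro equalityI subsetI)
      fix f assume f: "f \<in> ?l"
      then obtain xs where xs: "f = \<one> # xs" "set xs \<subseteq> base_field" "length xs = m"
        unfolding monics_eq_image[OF one_base] by auto
      then obtain b ws where bw: "xs = b # ws" "length ws = m - 1" using m by (cases xs) auto
      then obtain ys z where yz: "ws = ys @ [z]" using m by (cases ws rule: rev_cases) auto
      have "(b, ys, z) \<in> base_field \<times> ?X \<times> base_field" using xs bw yz m by auto
      then show "f \<in> ?r" by (rule image_eqI[rotated]) (simp add: xs(1) bw(1) yz)
    next
      fix f assume "f \<in> ?r"
      then show "f \<in> ?l" using m unfolding monics_eq_image[OF one_base] by auto
    qed
    moreover have "inj_on (\<lambda>(b, ys, z). \<one> # b # ys @ [z]) (base_field \<times> ?X \<times> base_field)"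
      by (auto simp: inj_on_def)
    ultimately have "(\<Sum>f\<in>monics base_field m. L f)
        = (\<Sum>(b, ys, z)\<in>base_field \<times> ?X \<times> base_field. L (\<one> # b # ys @ [z]))"
      by (simp add: sum.reindex case_prod_unfold)
    also have "\<dots> = (\<Sum>(b, ys, z)\<in>base_field \<times> ?X \<times> base_field. \<psi> b * \<chi> z)"
    proof (rule sum.cong[OF refl], clarsimp)
      fix b ys z
      have "coeff (\<one> # b # ys @ [z]) 0 = z"
        using coeff_nth[of 0 "\<one> # b # ys @ [z]"] by (simp add: nth_append)
      moreover have "next_coeff (\<one> # b # ys @ [z]) = b"
        using coeff_nth[of "length (\<one> # b # ys @ [z]) - 2" "\<one> # b # ys @ [z]"] by (simp add: next_coeff_def)
      ultimately show "L (\<one> # b # ys @ [z]) = \<psi> b * \<chi> z" by (simp add: L_def)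
    qed
    also have "\<dots> = (\<Sum>b\<in>base_field. \<Sum>ys\<in>?X. \<psi> b * (\<Sum>z\<in>base_field. \<chi> z))"
      by (simp add: sum.cartesian_product[symmetric] sum_distrib_left)
    also have "\<dots> = 0" by (simp add: chi_sum)
    finally show ?thesis .
  qed
  let ?S = "mangoldt_sum base_field n L"
  have rec: "of_nat m * (\<Sum>f\<in>monics base_field m. L f)
      = (\<Sum>i\<in>{1..m}. ?S i * (\<Sum>f\<in>monics base_field (m - i). L f))" if "m \<le> n" for m
    by (rule sum_monics_recursion[OF subfield_base finite_base_field Lmult Lone that])
  \<comment> \<open>As the monic sums vanish from degree 2 on, the recursion shrinks to two terms:
    each Mangoldt sum is -G times the one before.\<close>
  have "?S (Suc m) = (- 1) ^ m * G ^ Suc m" if "Suc m \<le> n" for m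
    using that
  proof (induction m)
    case 0
    then show ?case using rec[of 1] S0 S1 by simp
  next
    case (Suc m)
    have "0 = (\<Sum>i\<in>{1..Suc (Suc m)}. ?S i * (\<Sum>f\<in>monics base_field (Suc (Suc m) - i). L f))"
      using rec[OF Suc.prems] S2[of "Suc (Suc m)"] by simp
    also have "\<dots> = (\<Sum>i\<in>{Suc m, Suc (Suc m)}. ?S i * (\<Sum>f\<in>monics base_field (Suc (Suc m) - i). L f))"
      by (rule sum.mono_neutral_right) (auto intro!: S2)
    also have "\<dots> = ?S (Suc m) * G + ?S (Suc (Suc m))" using S0 S1 by simp
    finally have "?S (Suc (Suc m)) = - (?S (Suc m) * G)" by (simp add: eq_neg_iff_add_eq_0 add.commute)
    then show ?case using Suc by simp
  qed
  from this[of "n - 1"] have Sn: "?S n = G ^ n"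
    using n_gt_0 odd_n by simp
  have LP: "L (conj_poly x) = \<chi> (\<Otimes>i\<in>{..<n}. conj x i) * \<psi> (\<Oplus>i\<in>{..<n}. conj x i)" if "x \<in> carrier R" for x
    unfolding L_def using coeff_0_lin_prod[of "conj x" n] next_coeff_lin_prod[of "conj x" n] that by simp
  have Lbase: "L (conj_poly x) = L [\<one>, x] ^ n" if x: "x \<in> base_field" for x
  proof -
    have "L (lin_prod (conj x) m) = L [\<one>, x] ^ m" for m
    proof (induction m)
      case (Suc m)
      then show ?case
        using Lmult[OF lin_monic[OF x one_base] lin_prod_monic[OF K1, of "conj x" m]] conj_base[OF x] x
        by simp
    qed (simp add: Lone)
    then show ?thesis .
  qed
  have "(\<Sum>x\<in>carrier R. \<chi> (\<Otimes>i\<in>{..<n}. conj x i) * \<psi> (\<Oplus>i\<in>{..<n}. conj x i)) = (\<Sum>x\<in>carrier R. L (conj_poly x))"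
    by (rule sum.cong) (simp_all add: LP)
  also have "\<dots> = (\<Sum>x\<in>carrier R - base_field. L (conj_poly x)) + (\<Sum>x\<in>base_field. L (conj_poly x))"
    by (rule sum.subset_diff[OF sub fin])
  also have "\<dots> = of_nat n * (\<Sum>P\<in>irr_n. L P) + (\<Sum>c\<in>base_field. L [\<one>, c] ^ n)"
    unfolding sum_conj_poly irr_n_eq[symmetric] by (simp add: Lbase)
  also have "\<dots> = G ^ n" using mangoldt_sum_n Sn by simp
  finally show ?thesis by (simp add: G_def)
qed

end

section \<open>The order of \<open>p\<close> modulo \<open>k\<close>\<close>

text \<open>Lagrange's theorem for the subgroup generated by p; its group-theoretic order is
  identified with the arithmetic one because both have the same multiples.\<close>

lemma unit_index_mult_ord:
  assumes m: "m > 1" and p: "coprime p m"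
  shows "unit_index m p * Pocklington.ord m p = totient m"
proof -
  define R where "R = residue_ring (int m)"
  interpret residues "int m" R using m by unfold_locales (simp_all add: R_def)
  define G where "G = units_of R"
  interpret G: group G unfolding G_def by (rule units_group)
  define x where "x = int p mod int m"
  have x: "x \<in> carrier G"
    using p m by (simp add: x_def G_def units_of_def coprime_commute)
  have ordG: "order G = totient m"
    using totient_eq by (simp add: order_def G_def units_of_def)
  have one: "\<one>\<^bsub>G\<^esub> = 1" by (simp add: G_def units_of_def res_one_eq)
  have pow: "x [^]\<^bsub>G\<^esub> n = int (p ^ n) mod int m" for n :: nat
  proof -
    have "x [^]\<^bsub>G\<^esub> n = x [^]\<^bsub>R\<^esub> n"
      unfolding G_def by (rule units_of_pow[OF x[unfolded G_def units_of_def, simplified]])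
    also have "\<dots> = (int p) ^ n mod int m" unfolding x_def by (rule pow_cong)
    finally show ?thesis by simp
  qed
  have "G.ord x dvd n \<longleftrightarrow> Pocklington.ord m p dvd n" for n
  proof -
    have "G.ord x dvd n \<longleftrightarrow> x [^]\<^bsub>G\<^esub> n = \<one>\<^bsub>G\<^esub>" using G.pow_eq_id[OF x] by simp
    also have "\<dots> \<longleftrightarrow> int (p ^ n) mod int m = 1 mod int m" using m by (simp add: pow one)
    also have "\<dots> \<longleftrightarrow> [p ^ n = 1] (mod m)"
      by (metis cong_def of_nat_1 of_nat_eq_iff zmod_int)
    also have "\<dots> \<longleftrightarrow> Pocklington.ord m p dvd n" by (rule ord_divides)
    finally show ?thesis .
  qed
  then have ord: "G.ord x = Pocklington.ord m p" by (meson dvd_antisym dvd_refl)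
  have "card (rcosets\<^bsub>G\<^esub> (generate G {x})) * card (generate G {x}) = order G"
    by (rule G.lagrange) (use x G.generate_is_subgroup in auto)
  then show ?thesis
    using ordG ord G.generate_pow_card[OF x]
    by (simp add: unit_index_def Let_def G_def R_def x_def)
qed

text \<open>With a constant index the order must grow exactly like the totient, that is, by a factor
  P at each level.\<close>

lemma ord_tower:
  fixes w P p e a :: nat
  assumes P: "prime P" "\<not> P dvd w" and w: "w > 0" and cop: "coprime p (w * P)" and a: "a \<ge> 1"
    and idx: "\<And>x. x \<ge> 1 \<Longrightarrow> unit_index (w * P ^ x) p = e"
  shows "Pocklington.ord (w * P ^ a) p = P ^ (a - 1) * Pocklington.ord (w * P) p"
    and "totient (w * P ^ a) = e * Pocklington.ord (w * P ^ a) p" and "e > 0"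
proof -
  have eq: "e * Pocklington.ord (w * P ^ x) p = totient w * (P ^ (x - 1) * (P - 1))" if x: "x \<ge> 1" for x
  proof -
    have "w * P ^ x \<ge> P ^ x" using w by simp
    moreover have "P ^ x > 1" using P x prime_gt_1_nat[OF P(1)] by (intro one_less_power) auto
    ultimately have "w * P ^ x > 1" by linarith
    moreover have "coprime p (w * P ^ x)" using cop by simp
    ultimately have "e * Pocklington.ord (w * P ^ x) p = totient (w * P ^ x)"
      using unit_index_mult_ord idx[OF x] by metis
    also have "\<dots> = totient w * totient (P ^ x)"
      by (rule totient_mult_coprime) (use P x in \<open>simp add: prime_imp_coprime coprime_commute\<close>)
    also have "totient (P ^ x) = P ^ (x - 1) * (P - 1)" using P x by (simp add: totient_prime_power)
    finally show ?thesis .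
  qed
  show e: "e > 0"
  proof (rule ccontr)
    assume "\<not> e > 0"
    then have "totient w * (P - 1) = 0" using eq[of 1] by simp
    then show False using w prime_gt_1_nat[OF P(1)] by simp
  qed
  have "e * Pocklington.ord (w * P ^ a) p = P ^ (a - 1) * (totient w * (P - 1))"
    unfolding eq[OF a] by simp
  also have "totient w * (P - 1) = e * Pocklington.ord (w * P) p" using eq[of 1] by simp
  finally show "Pocklington.ord (w * P ^ a) p = P ^ (a - 1) * Pocklington.ord (w * P) p"
    using e by simp
  have "w * P ^ a > 1"
  proof -
    have "P ^ a > 1" using a prime_gt_1_nat[OF P(1)] by (intro one_less_power) auto
    then show ?thesis using w by (metis less_1_mult mult.commute mult.right_neutral nat_neq_iff less_one)
  qed
  then show "totient (w * P ^ a) = e * Pocklington.ord (w * P ^ a) p"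
    using unit_index_mult_ord[of "w * P ^ a" p] cop idx[OF a] by simp
qed

text \<open>The powers of \<open>p\<close> contain the kernel of \<open>(\<int>/k P)\<^sup>* \<rightarrow> (\<int>/k)\<^sup>*\<close>, and likewise for the
  divisors of \<open>k\<close> obtained by lowering the exponent of \<open>P\<close>.\<close>

lemma power_orbit:
  fixes w P p e a :: nat and j u :: int
  assumes P: "prime P" "\<not> P dvd w" and w: "w > 0" and cop: "coprime p (w * P)" and a: "a \<ge> 1"
    and idx: "\<And>x. x \<ge> 1 \<Longrightarrow> unit_index (w * P ^ x) p = e"
    and j: "\<not> int P ^ a dvd j"
  shows "\<exists>m. [j * int p ^ m = j + int (w * P ^ a) * u] (mod int (w * P ^ Suc a))"
proof -
  define k where "k = int (w * P ^ a)"
  have P1: "P > 1" using P(1) prime_gt_1_nat by blast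
  have j0: "j \<noteq> 0" using j by auto
  define b where "b = multiplicity (int P) j"
  have Pp: "prime (int P)" using P(1) by simp
  have ba: "b < a" unfolding b_def using j j0 P1
    by (metis Pp multiplicity_dvd' linorder_not_less)
  obtain j' where j': "j = int P ^ b * j'" "\<not> int P dvd j'"
    unfolding b_def by (rule multiplicity_decompose'[OF j0, of "int P"]) (use P1 in auto)
  \<comment> \<open>The part P^b of j is absorbed: multipliers that agree modulo w P^(x+1) have the
    same effect on j modulo w P^(a+1). The argument runs at level x, which is at least 1 because P^a
    does not divide j.\<close>
  define x where "x = a - b"
  have x: "x \<ge> 1" "b + x = a" using ba by (auto simp: x_def)
  define n where "n = Pocklington.ord (w * P ^ x) p"
  have "n > 0" unfolding n_def using cop by (simp add: coprime_commute)
  have n1: "Pocklington.ord (w * P ^ Suc x) p = P * n"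
    using ord_tower(1)[OF P w cop _ idx, of "Suc x"] ord_tower(1)[OF P w cop x(1) idx] x(1)
    by (cases x) (simp_all add: n_def)
  have c1: "[p ^ n = 1] (mod w * P ^ x)" unfolding n_def by (rule Pocklington.ord)
  have c2: "\<not> [p ^ n = 1] (mod w * P ^ Suc x)"
    unfolding ord_divides n1 using \<open>n > 0\<close> P1 by (metis dvd_imp_le nat_mult_less_cancel_disj
      mult.commute mult.right_neutral not_le)
  \<comment> \<open>P cannot divide y: the order of p at level x + 1 would then still divide n, but
    it is P n.\<close>
  obtain y where y: "int p ^ n = 1 + int (w * P ^ x) * y"
  proof -
    have "[int p ^ n = 1] (mod int (w * P ^ x))" using c1 by (metis cong_int_iff of_nat_1 of_nat_power)
    then obtain y where "int p ^ n - 1 = int (w * P ^ x) * y" by (metis cong_iff_dvd_diff dvdE)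
    then show ?thesis using that[of y] by simp
  qed
  have "\<not> int P dvd y"
  proof
    assume "int P dvd y"
    then have "int (w * P ^ Suc x) dvd int p ^ n - 1" using y by (auto simp: mult_ac)
    then have "[int p ^ n = 1] (mod int (w * P ^ Suc x))" by (simp add: cong_iff_dvd_diff)
    then show False using c2 by (metis cong_int_iff of_nat_1 of_nat_power)
  qed
  then have "coprime (j' * y) (int P)"
    using j'(2) Pp by (metis coprime_commute prime_dvd_mult_iff prime_imp_coprime)
  then obtain v where v: "[j' * y * v = 1] (mod int P)" using cong_solve_coprime_int by blast
  \<comment> \<open>m solves j' y m = u modulo P. Each factor p^n adds k j' y to j modulo k P, so
    p^(n m) adds k u.\<close>
  define m where "m = nat ((u * v) mod int P)"
  have m: "[int m = u * v] (mod int P)" unfolding m_def using P1 by (simp add: cong_def)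
  have step: "[j * int p ^ (n * i) = j + k * (j' * y) * int i] (mod k * int P)" for i
  proof (induction i)
    case (Suc i)
    have "[j * int p ^ (n * i) * int p ^ n = (j + k * (j' * y) * int i) * int p ^ n] (mod k * int P)"
      using Suc by (rule cong_scalar_right)
    moreover have "(j + k * (j' * y) * int i) * int p ^ n
        = j + k * (j' * y) * int (Suc i) + k * int P * (int w * int P ^ (x - 1) * y * (j' * y) * int i)"
    proof -
      have jk: "j * int (w * P ^ x) = k * j'"
        unfolding k_def j'(1) x(2)[symmetric] by (simp add: power_add)
      have px: "int P ^ x = int P * int P ^ (x - 1)" using x(1) by (cases x) auto
      have "(j + k * (j' * y) * int i) * int p ^ n
          = j + (j * int (w * P ^ x)) * y + k * (j' * y) * int i + k * (j' * y) * int i * (int (w * P ^ x) * y)"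
        unfolding y by (simp add: algebra_simps)
      also have "\<dots> = j + k * j' * y + k * (j' * y) * int i + k * (j' * y) * int i * (int w * (int P * int P ^ (x - 1)) * y)"
        unfolding jk using px by simp
      finally show ?thesis by (simp add: algebra_simps)
    qed
    ultimately have "[j * int p ^ (n * i) * int p ^ n = j + k * (j' * y) * int (Suc i)] (mod k * int P)"
      by (simp add: cong_def)
    then show ?case by (simp add: power_add mult_ac)
  qed simp
  have "[k * (j' * y * int m) = k * u] (mod k * int P)"
  proof -
    have "[j' * y * int m = j' * y * (u * v)] (mod int P)" using m by (rule cong_scalar_left)
    moreover have "[(j' * y * v) * u = 1 * u] (mod int P)" using v by (rule cong_scalar_right)
    ultimately have "[j' * y * int m = u] (mod int P)"
      by (metis cong_trans mult.assoc mult.commute mult_1)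
    then show ?thesis using w P1 by (simp add: cong_cmult_leftI)
  qed
  then have "[j + k * (j' * y) * int m = j + k * u] (mod k * int P)"
    by (simp add: mult.assoc cong_add_lcancel)
  then have "[j * int p ^ (n * m) = j + k * u] (mod k * int P)" using step[of m] cong_trans by blast
  then show ?thesis unfolding k_def by (auto simp: mult_ac)
qed

text \<open>Since P divides k, the square of q - 1 vanishes modulo k P and q^i is 1 + i (q - 1). The
  linear terms sum to (q - 1) P (P - 1) / 2, which is a multiple of k P because P is odd.\<close>

lemma geometric_sum_cong:
  fixes q k P :: nat
  assumes q: "[q = 1] (mod k)" and P: "odd P" "P dvd k" "q > 0"
  shows "[(\<Sum>i<P. q ^ i) = P] (mod k * P)"
proof -
  obtain y where y: "int q = 1 + int k * y"
  proof -
    have "[int q = 1] (mod int k)" using q by (metis cong_int_iff of_nat_1)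
    then obtain y where "int q - 1 = int k * y" by (metis cong_iff_dvd_diff dvdE)
    then show ?thesis using that[of y] by simp
  qed
  obtain r where r: "k = P * r" using P by (elim dvdE)
  have pw: "[int q ^ i = 1 + int i * (int k * y)] (mod int k * int P)" for i
  proof (induction i)
    case (Suc i)
    have "[int q ^ i * int q = (1 + int i * (int k * y)) * int q] (mod int k * int P)"
      using Suc by (rule cong_scalar_right)
    moreover have "(1 + int i * (int k * y)) * int q = 1 + int (Suc i) * (int k * y) + int k * int P * (int r * y * int i * y)"
      unfolding y using r by (simp add: algebra_simps)
    ultimately show ?case by (simp add: cong_def mult.commute)
  qed simp
  have "[(\<Sum>i<P. int q ^ i) = (\<Sum>i<P. 1 + int i * (int k * y))] (mod int k * int P)"
    by (intro cong_sum pw)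
  also have "(\<Sum>i<P. 1 + int i * (int k * y)) = int P + (\<Sum>i<P. int i) * (int k * y)"
    by (simp add: sum.distrib sum_distrib_right)
  also have "(\<Sum>i<P. int i) = int P * ((int P - 1) div 2)"
  proof -
    have "2 * (\<Sum>i<n. int i) = int n * (int n - 1)" for n by (induction n) (auto simp: algebra_simps)
    moreover have "even (int P - 1)" using P by simp
    ultimately show ?thesis by (metis (no_types, lifting) dvd_mult_div_cancel mult.left_commute mult_left_cancel zero_neq_numeral)
  qed
  also have "[int P + int P * ((int P - 1) div 2) * (int k * y) = int P] (mod int k * int P)"
    by (simp add: cong_iff_dvd_diff)
  finally show ?thesis by (metis (no_types, lifting) cong_int_iff of_nat_mult of_nat_power of_nat_sum sum.cong)
qed

text \<open>c = j + d t, where t is the product of the primes of n dividing neither j nor d. A prime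
  of n then divides exactly one of the summands j and d t.\<close>

lemma exists_coprime_lift:
  fixes d n j :: nat
  assumes d: "d dvd n" "n > 0" and j: "coprime j d"
  obtains c where "[c = j] (mod d)" "coprime c n"
proof -
  define A where "A = {r \<in> prime_factors n. \<not> r dvd j}"
  define t where "t = \<Prod>(A - prime_factors d)"
  define c where "c = j + d * t"
  have fin: "finite (A - prime_factors d)" unfolding A_def by simp
  have d0: "d > 0" using d by (meson dvd_pos_nat)
  have "coprime c n"
  proof (rule ccontr)
    assume "\<not> coprime c n"
    then have "gcd c n \<noteq> 1" by (simp only: coprime_iff_gcd_eq_1 not_False_eq_True)
    then obtain r where r': "prime r" "r dvd gcd c n" using prime_factor_nat by blast
    then have r: "prime r" "r dvd c" "r dvd n" by (auto intro: dvd_trans)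
    have rn: "r \<in> prime_factors n" using r d by (simp add: prime_factors_dvd)
    show False
    proof (cases "r dvd j")
      case True
      then have "\<not> r dvd d" using j r(1) by (meson coprime_common_divisor not_prime_unit)
      moreover have "r dvd d * t" using r(2) True unfolding c_def by (simp add: dvd_add_right_iff)
      ultimately have "r dvd t" using r(1) by (simp add: prime_dvd_mult_iff)
      then have "\<exists>s\<in>A - prime_factors d. r dvd s"
        unfolding t_def by (simp only: prime_dvd_prod_iff[OF fin r(1)])
      then obtain s where s: "s \<in> A - prime_factors d" "r dvd s" by (elim bexE)
      have "prime s" using s(1) unfolding A_def by (simp add: in_prime_factors_iff)
      then have "r = s" using r(1) s(2) by (intro primes_dvd_imp_eq)
      then show False using s True by (simp add: A_def)
    next
      case False
      then have "r \<in> A" using rn by (simp add: A_def)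
      have "r dvd d * t"
      proof (cases "r dvd d")
        case False
        then have "r \<in> A - prime_factors d" using \<open>r \<in> A\<close> by auto
        then have "r dvd t" unfolding t_def using fin dvd_prodI[of _ r "\<lambda>x. x"] by blast
        then show ?thesis by simp
      qed simp
      then show False using r(2) False unfolding c_def by (simp add: dvd_add_left_iff)
    qed
  qed
  moreover have "[c = j] (mod d)" by (simp add: c_def cong_def)
  ultimately show ?thesis using that by blast
qed

section \<open>Residue fields of cyclotomic rings\<close>

lemma zeta_power_self [simp]: "zeta n ^ n = 1"
  by (cases "n = 0") (simp_all add: zeta_def DeMoivre)

lemma zeta_power: "zeta n ^ i = cis (2 * pi * real i / real n)"
  by (simp add: zeta_def DeMoivre mult_ac)

lemma zeta_power_mult: "m > 0 \<Longrightarrow> zeta (n * m) ^ m = zeta n"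
  by (simp add: zeta_power) (simp add: zeta_def mult_ac)

lemma range_zeta:
  assumes n: "n > 0"
  shows "range (\<lambda>i :: nat. zeta n ^ i) = {z. z ^ n = 1}"
proof (intro equalityI subsetI)
  fix z assume "z \<in> range (\<lambda>i. zeta n ^ i)"
  then obtain i where "z = zeta n ^ i" by auto
  then show "z \<in> {z. z ^ n = 1}"
    by (simp flip: power_mult) (metis mult.commute power_mult power_one zeta_power_self)
next
  fix z :: complex assume "z \<in> {z. z ^ n = 1}"
  then have "z \<in> (\<lambda>k. cis (2 * pi * real k / real n)) ` {..<n}"
    using bij_betw_imp_surj_on[OF bij_betw_roots_unity[OF n]] by simp
  then show "z \<in> range (\<lambda>i. zeta n ^ i)" by (auto simp: zeta_power)
qed

lemma zeta_power_eq_1_iff: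
  assumes n: "n > 0" shows "zeta n ^ i = 1 \<longleftrightarrow> n dvd i"
proof
  assume e: "zeta n ^ i = 1"
  have "zeta n ^ i = zeta n ^ (i mod n) * (zeta n ^ n) ^ (i div n)"
    by (simp only: power_mult[symmetric] power_add[symmetric]) (simp add: add.commute)
  then have "zeta n ^ (i mod n) = zeta n ^ 0" using e by simp
  then have "i mod n = 0"
    using bij_betw_imp_inj_on[OF bij_betw_roots_unity[OF n]] n unfolding zeta_power inj_on_def by auto
  then show "n dvd i" by auto
next
  assume "n dvd i" then show "zeta n ^ i = 1" by (auto simp: power_mult)
qed

lemma carrier_cyclotomic_ring [simp]: "carrier (cyclotomic_ring n) = int_adjoin (zeta n)"
  and cyclotomic_ring_simps [simp]: "x \<otimes>\<^bsub>cyclotomic_ring n\<^esub> y = x * y" "\<one>\<^bsub>cyclotomic_ring n\<^esub> = 1"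
    "\<zero>\<^bsub>cyclotomic_ring n\<^esub> = 0" "x \<oplus>\<^bsub>cyclotomic_ring n\<^esub> y = x + y"
  by (simp_all add: cyclotomic_ring_def int_adjoin_def)

lemma cring_cyclotomic_ring: "cring (cyclotomic_ring n)"
proof (rule cringI)
  show "abelian_group (cyclotomic_ring n)"
  proof (rule abelian_groupI)
    fix x assume "x \<in> carrier (cyclotomic_ring n)"
    then show "\<exists>y\<in>carrier (cyclotomic_ring n). y \<oplus>\<^bsub>cyclotomic_ring n\<^esub> x = \<zero>\<^bsub>cyclotomic_ring n\<^esub>"
      by (intro bexI[of _ "- x"]) auto
  qed auto
  show "comm_monoid (cyclotomic_ring n)" by (rule comm_monoidI) auto
qed (auto simp: algebra_simps)

lemma cyclotomic_ring_a_inv: "x \<in> int_adjoin (zeta n) \<Longrightarrow> \<ominus>\<^bsub>cyclotomic_ring n\<^esub> x = - x"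
proof -
  assume x: "x \<in> int_adjoin (zeta n)"
  interpret cring "cyclotomic_ring n" by (rule cring_cyclotomic_ring)
  show ?thesis by (rule minus_equality) (use x in auto)
qed

text \<open>In each step the accumulated exponent is moved into the polynomial by composition with a
  monomial, so that the congruence for a single r-th power applies again.\<close>

lemma ipoly_power_prime_power_cong:
  assumes r: "prime (r :: nat)"
  shows "adj_cong x (of_nat r) (ipoly h x ^ (r ^ m)) (ipoly h (x ^ (r ^ m)))"
proof (induction m)
  case (Suc m)
  obtain g where g: "\<And>y. ipoly h (y ^ (r ^ m)) = ipoly g y"
    using ipoly_pcompose_monom[of h "r ^ m"] by metis
  have "adj_cong x (of_nat r) ((ipoly h x ^ (r ^ m)) ^ r) (ipoly h (x ^ (r ^ m)) ^ r)"
    using Suc by (rule adj_cong_power) (auto simp: g)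
  also have "adj_cong x (of_nat r) (ipoly h (x ^ (r ^ m)) ^ r) (ipoly h ((x ^ r) ^ (r ^ m)))"
    unfolding g by (rule ipoly_power_prime_cong[OF r])
  finally show ?case by (simp flip: power_mult) (simp add: mult.commute)
qed simp

text \<open>Finiteness has to be derived. By x^(p^f) = x the generator g has finite order at most
  p^f - 1, which bounds the size from above. The size is a power p^r, since a nonzero element of an
  additive subgroup of another prime order would be killed by two distinct primes. The element z of
  order n gives n | p^r - 1, hence f <= r.\<close>

lemma (in domain) finite_field_card:
  fixes p f n :: nat
  assumes p: "prime p" "[p] \<cdot> \<one> = \<zero>" and f: "f = Pocklington.ord n p" "coprime p n"
    and pow: "\<And>x. x \<in> carrier R \<Longrightarrow> x [^] (p ^ f) = x"
    and g: "primitive_element R g"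
    and z: "z \<in> carrier R" "\<And>i :: nat. z [^] i = \<one> \<longleftrightarrow> n dvd i"
  shows "field R" "finite (carrier R)" "card (carrier R) = p ^ f" "f > 0"
proof -
  have f0: "f > 0" unfolding f(1) using f(2) by (simp add: coprime_commute)
  then show "f > 0" .
  define q where "q = p ^ f"
  have q1: "q > 1" unfolding q_def by (rule one_less_power[OF prime_gt_1_nat[OF p(1)] f0])
  have inv: "x [^] (q - 1) = \<one>" if x: "x \<in> carrier R" "x \<noteq> \<zero>" for x
  proof -
    have "x \<otimes> x [^] (q - 1) = x [^] Suc (q - 1)" using nat_pow_Suc2[OF x(1)] by simp
    also have "Suc (q - 1) = q" using q1 by simp
    finally have "x \<otimes> x [^] (q - 1) = x \<otimes> \<one>" using pow[OF x(1)] x by (simp add: q_def)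
    then show ?thesis using m_lcancel[OF x(2,1), of "x [^] (q - 1)" \<one>] x by simp
  qed
  have "x \<in> Units R" if x: "x \<in> carrier R" "x \<noteq> \<zero>" for x
  proof -
    have "x \<otimes> x [^] (q - 2) = x [^] Suc (q - 2)" using nat_pow_Suc2[OF x(1)] by simp
    also have "Suc (q - 2) = q - 1" using q1 by simp
    also have "x [^] (q - 1) = \<one>" by (rule inv[OF x])
    finally show ?thesis using x by (auto simp: Units_def m_comm intro!: bexI[of _ "x [^] (q - 2)"])
  qed
  moreover have "\<zero> \<notin> Units R" by (auto simp: Units_def)
  ultimately have "Units R = carrier R - {\<zero>}" by (auto simp: Units_def)
  then show F: "field R" by (intro field.intro field_axioms.intro domain_axioms) 
  interpret field R by (rule F)
  interpret G: group "mult_of R" by (rule field_mult_group)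
  have gc: "g \<in> carrier R" "g \<noteq> \<zero>" and gen: "generate (mult_of R) {g} = carrier R - {\<zero>}"
    using g by (auto simp: primitive_element_def)
  have gq: "g [^]\<^bsub>mult_of R\<^esub> (q - 1) = \<one>\<^bsub>mult_of R\<^esub>"
    using inv[OF gc] by (simp add: Multiplicative_Group.nat_pow_mult_of)
  then have "G.ord g dvd q - 1" using G.pow_eq_id[of g "q - 1"] gc by simp
  have "G.ord g \<noteq> 0"
  proof
    assume "G.ord g = 0"
    then have "q - 1 = 0" using \<open>G.ord g dvd q - 1\<close> by simp
    then show False using q1 by simp
  qed
  then have ogq: "G.ord g \<le> q - 1" using \<open>G.ord g dvd q - 1\<close> q1 by (intro dvd_imp_le) auto
  have "card (carrier R - {\<zero>}) = G.ord g" using G.generate_pow_card[of g] gc gen by simp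
  then have c1: "card (carrier R - {\<zero>}) = G.ord g" "card (carrier R - {\<zero>}) \<noteq> 0"
    using \<open>G.ord g \<noteq> 0\<close> by auto
  from c1(2) have "finite (carrier R - {\<zero>})" by (intro card_ge_0_finite) simp
  then show fin: "finite (carrier R)" by simp
  have card: "card (carrier R) = Suc (card (carrier R - {\<zero>}))"
    using card.remove[OF fin zero_closed] .
  have le: "card (carrier R) \<le> q" using card c1(1) ogq q1 by simp
  have smul: "[p] \<cdot> x = \<zero>" if "x \<in> carrier R" for x
  proof -
    have "[p] \<cdot> x = ([p] \<cdot> \<one>) \<otimes> x" using that by (simp add: add_pow_ldistr)
    then show ?thesis using p(2) that by simp
  qed
  have onlyp: "r = p" if r: "prime r" "r dvd card (carrier R)" for r
  proof (rule ccontr)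
    assume ne: "r \<noteq> p"
    obtain m where "card (carrier R) = r ^ 1 * m" using r(2) by auto
    then obtain H where H: "subgroup H (add_monoid R)" "card H = r"
      using sylow_thm[of r "add_monoid R" 1 m] r(1) fin a_group by (auto simp: order_def)
    have "\<exists>x\<in>H. x \<noteq> \<zero>"
    proof (rule ccontr)
      assume "\<not> ?thesis"
      then have "H \<subseteq> {\<zero>}" by auto
      then have "card H \<le> card {\<zero>}" by (intro card_mono) auto
      then show False using H(2) prime_gt_1_nat[OF r(1)] by simp
    qed
    then obtain x where x: "x \<in> H" "x \<noteq> \<zero>" by auto
    have xc: "x \<in> carrier R" using subgroup.subset[OF H(1)] x by auto
    interpret H: group "add_monoid R\<lparr>carrier := H\<rparr>"
      by (rule subgroup.subgroup_is_group[OF H(1) a_group])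
    have "x [^]\<^bsub>add_monoid R\<lparr>carrier := H\<rparr>\<^esub> order (add_monoid R\<lparr>carrier := H\<rparr>) = \<one>\<^bsub>add_monoid R\<lparr>carrier := H\<rparr>\<^esub>"
      by (rule H.pow_order_eq_1) (use x in simp)
    then have "[r] \<cdot> x = \<zero>" using H(2)
      by (simp add: order_def add_pow_def nat_pow_def)
    then have "add.ord x dvd r" using add.pow_eq_id[of x r] xc by simp
    moreover have "add.ord x dvd p" using add.pow_eq_id[of x p] xc smul[OF xc] by simp
    ultimately have "add.ord x = 1" using ne r(1) p(1)
      by (metis prime_nat_iff)
    then show False using add.ord_eq_1[of x] xc x(2) by simp
  qed
  have c0: "card (carrier R) \<noteq> 0" using card by simp
  define r where "r = multiplicity p (card (carrier R))"
  obtain m where m: "card (carrier R) = p ^ r * m" "\<not> p dvd m"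
    unfolding r_def
    by (rule multiplicity_decompose'[OF c0, of p]) (use prime_gt_1_nat[OF p(1)] in auto)
  have "m = 1"
  proof (rule ccontr)
    assume "m \<noteq> 1"
    then obtain s where "prime s" "s dvd m" using prime_factor_nat by blast
    then show False using onlyp[of s] m by auto
  qed
  then have cr: "card (carrier R) = p ^ r" using m by simp
  have zn: "z \<noteq> \<zero>"
  proof
    assume "z = \<zero>"
    then have n0: "n = 0" using z(2)[of n] nat_pow_zero[of n] by auto
    then have "p = 1" using f(2) by simp
    then show False using p(1) by simp
  qed
  have "z [^]\<^bsub>mult_of R\<^esub> order (mult_of R) = \<one>\<^bsub>mult_of R\<^esub>"
    by (rule G.pow_order_eq_1) (use z zn in simp)
  then have "z [^] (p ^ r - 1) = \<one>"
    using order_mult_of[OF fin] cr by (simp add: Multiplicative_Group.nat_pow_mult_of order_def)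
  then have "n dvd p ^ r - 1" using z(2) by simp
  moreover have "p ^ r > 0" using p(1) prime_gt_0_nat by simp
  ultimately have "[p ^ r = 1] (mod n)" using cong_altdef_nat[of 1 "p ^ r" n] by linarith
  then have "f dvd r" unfolding f(1) using ord_divides by blast
  moreover have "r \<noteq> 0"
  proof
    assume "r = 0"
    then have "card (carrier R) = 1" using cr by simp
    then show False using card c1(2) by linarith
  qed
  ultimately have "f \<le> r" by (simp add: dvd_imp_le)
  then have "q \<le> card (carrier R)" unfolding cr q_def using prime_gt_0_nat[OF p(1)] by (intro power_increasing) auto
  then show "card (carrier R) = p ^ f" using le by (simp add: q_def)
qed

locale residue =
  fixes n p :: nat and P :: "complex set"
  assumes n0: "n > 0" and p: "prime p" "\<not> p dvd n" and P: "prime_ideal_over n p P"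
begin

abbreviation "Z \<equiv> int_adjoin (zeta n)"
abbreviation "F \<equiv> residue_field n P"

definition cl :: "complex \<Rightarrow> complex set" where
  "cl a = P +>\<^bsub>cyclotomic_ring n\<^esub> a"

sublocale I: primeideal P "cyclotomic_ring n"
  using P by (simp add: prime_ideal_over_def)

sublocale F: domain F
  by (rule I.quotient_is_domain)

lemma P_subset: "a \<in> P \<Longrightarrow> a \<in> Z"
  using I.a_subset by auto

lemma P_int_iff: "of_int a \<in> P \<longleftrightarrow> int p dvd a"
  using P by (auto simp: prime_ideal_over_def)

lemma P_0: "0 \<in> P" using P_int_iff[of 0] by simp

lemma P_add: "a \<in> P \<Longrightarrow> b \<in> P \<Longrightarrow> a + b \<in> P"
  using additive_subgroup.a_closed[OF I.additive_subgroup_axioms, of a b] by simp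

lemma P_mult: "a \<in> P \<Longrightarrow> b \<in> Z \<Longrightarrow> b * a \<in> P"
  using I.I_l_closed[of a b] by simp

lemma P_uminus: "a \<in> P \<Longrightarrow> - a \<in> P"
  using P_mult[of a "- 1"] by auto

lemma mem_cl_iff: "b \<in> cl a \<longleftrightarrow> b - a \<in> P"
  unfolding cl_def a_r_coset_def' by (auto intro: bexI[of _ "b - a"])

lemma cl_eq_iff: "a \<in> Z \<Longrightarrow> b \<in> Z \<Longrightarrow> cl a = cl b \<longleftrightarrow> a - b \<in> P"
proof
  assume "cl a = cl b" then show "a - b \<in> P" using mem_cl_iff P_0 by (metis diff_self)
next
  assume ab: "a - b \<in> P"
  show "cl a = cl b"
  proof (rule Set.set_eqI)
    fix c
    have "c - a \<in> P \<longleftrightarrow> c - b \<in> P"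
      using P_add[OF ab, of "c - a"] P_add[OF P_uminus[OF ab], of "c - b"] by auto
    then show "c \<in> cl a \<longleftrightarrow> c \<in> cl b" by (simp add: mem_cl_iff)
  qed
qed

lemma cl_closed [simp, intro]: "a \<in> Z \<Longrightarrow> cl a \<in> carrier F"
  unfolding cl_def by (simp add: FactRing_def A_RCOSETS_def' a_r_coset_def) blast

lemma carrierE:
  assumes "Y \<in> carrier F" obtains a where "a \<in> Z" "Y = cl a"
  using assms that unfolding cl_def FactRing_def A_RCOSETS_def' by auto

lemma cl_hom: "cl \<in> ring_hom (cyclotomic_ring n) F"
  using I.rcos_ring_hom unfolding cl_def[abs_def] .

sublocale C: ring_hom_cring "cyclotomic_ring n" F cl
  by unfold_locales (rule cl_hom)

lemma cl_add: "a \<in> Z \<Longrightarrow> b \<in> Z \<Longrightarrow> cl (a + b) = cl a \<oplus>\<^bsub>F\<^esub> cl b"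
  using C.hom_add[of a b] by simp

lemma cl_mult: "a \<in> Z \<Longrightarrow> b \<in> Z \<Longrightarrow> cl (a * b) = cl a \<otimes>\<^bsub>F\<^esub> cl b"
  using C.hom_mult[of a b] by simp

lemma cl_one: "cl 1 = \<one>\<^bsub>F\<^esub>" using C.hom_one by simp

lemma cl_zero: "cl 0 = \<zero>\<^bsub>F\<^esub>" using C.hom_zero by simp

lemma cl_zero_eq: "\<zero>\<^bsub>F\<^esub> = P" by (simp add: FactRing_def)

lemma cl_power: "a \<in> Z \<Longrightarrow> cl (a ^ i) = cl a [^]\<^bsub>F\<^esub> i"
  by (induction i) (simp_all add: cl_one cl_mult adj_power mult.commute F.m_comm)

lemma cl_of_nat: "cl (of_nat m) = [m] \<cdot>\<^bsub>F\<^esub> \<one>\<^bsub>F\<^esub>"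
  by (induction m) (simp_all add: cl_zero cl_one[symmetric] cl_add F.add.nat_pow_Suc add.commute F.a_comm)

lemma char_p: "[p] \<cdot>\<^bsub>F\<^esub> \<one>\<^bsub>F\<^esub> = \<zero>\<^bsub>F\<^esub>"
proof -
  have "of_nat p \<in> P" using P_int_iff[of "int p"] by simp
  then show ?thesis unfolding cl_of_nat[symmetric] cl_zero[symmetric] by (subst cl_eq_iff) auto
qed

lemma adj_cong_imp_cl_eq:
  assumes "adj_cong (zeta n) (of_nat p) a b" "a \<in> Z" "b \<in> Z" shows "cl a = cl b"
proof -
  obtain y where "y \<in> Z" "a - b = of_nat p * y" using assms(1) by (auto simp: adj_cong_def)
  moreover have "of_nat p \<in> P" using P_int_iff[of "int p"] by simp
  ultimately have "a - b \<in> P" using P_mult[of "of_nat p" y] by (simp add: mult.commute)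
  then show ?thesis using cl_eq_iff assms by simp
qed

lemma zeta_power_in [simp, intro]: "zeta n ^ i \<in> Z" by auto

text \<open>If z is not 1, its powers z^i with i < n sum to 0; if its class is 1, the same sum has
  the class of n, which is nonzero as p does not divide n.\<close>

lemma cl_root_eq_one:
  assumes z: "z \<in> Z" "z ^ n = 1" and e: "cl z = \<one>\<^bsub>F\<^esub>"
  shows "z = 1"
proof (rule ccontr)
  assume ne: "z \<noteq> 1"
  have "z ^ n - 1 = (z - 1) * (\<Sum>i<n. z ^ i)" by (rule power_diff_1_eq)
  then have s: "(\<Sum>i<n. z ^ i) = 0" using z ne by simp
  have "cl (\<Sum>i<m. z ^ i) = cl (of_nat m)" for m
  proof (induction m)
    case (Suc m)
    have "cl (\<Sum>i<Suc m. z ^ i) = cl (\<Sum>i<m. z ^ i) \<oplus>\<^bsub>F\<^esub> cl (z ^ m)"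
      by (simp add: cl_add adj_sum adj_power z)
    also have "cl (z ^ m) = cl 1" using e z by (simp add: cl_power cl_one)
    finally show ?case by (simp add: Suc cl_add[symmetric] add.commute)
  qed simp
  from this[of n] have "of_int (int n) - 0 \<in> P" using cl_eq_iff[of "of_nat n" 0] s by simp
  then show False using P_int_iff[of "int n"] p(2) by simp
qed

lemma root_in_Z: "z ^ n = 1 \<Longrightarrow> z \<in> Z"
  using range_zeta[OF n0] by (metis (mono_tags, lifting) imageE mem_Collect_eq zeta_power_in)

lemma cl_inj_roots:
  assumes a: "a ^ n = 1" and b: "b ^ n = 1" and e: "cl a = cl b"
  shows "a = b"
proof -
  have bb: "b * b ^ (n - 1) = 1" using b n0 by (simp flip: power_Suc)
  note Zr = root_in_Z[OF a] root_in_Z[OF b]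
  have "cl (a * b ^ (n - 1)) = cl (b * b ^ (n - 1))" using e Zr by (simp add: cl_mult adj_power)
  then have "cl (a * b ^ (n - 1)) = \<one>\<^bsub>F\<^esub>" using bb cl_one by simp
  moreover have "(a * b ^ (n - 1)) ^ n = 1" using a b
    by (simp add: power_mult_distrib) (metis mult.commute power_mult power_one)
  ultimately have "a * b ^ (n - 1) = b * b ^ (n - 1)"
    using cl_root_eq_one[of "a * b ^ (n - 1)"] Zr bb by (auto intro!: adj_mult adj_power)
  then show "a = b" using bb by (metis mult_right_cancel mult_zero_right zero_neq_one)
qed

lemma cl_zeta_power_eq_1: "cl (zeta n) [^]\<^bsub>F\<^esub> (i :: nat) = \<one>\<^bsub>F\<^esub> \<longleftrightarrow> n dvd i"
proof -
  have r: "(zeta n ^ i) ^ n = 1" by (metis mult.commute power_mult power_one zeta_power_self)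
  have "cl (zeta n) [^]\<^bsub>F\<^esub> i = cl (zeta n ^ i)" by (simp add: cl_power)
  then show ?thesis using cl_root_eq_one[of "zeta n ^ i"] r zeta_power_eq_1_iff[OF n0, of i] cl_one by auto
qed

lemma frob_add:
  assumes x: "x \<in> carrier F" "y \<in> carrier F"
  shows "(x \<oplus>\<^bsub>F\<^esub> y) [^]\<^bsub>F\<^esub> p = x [^]\<^bsub>F\<^esub> p \<oplus>\<^bsub>F\<^esub> y [^]\<^bsub>F\<^esub> p"
proof -
  obtain a b where ab: "a \<in> Z" "b \<in> Z" "x = cl a" "y = cl b" using x by (metis carrierE)
  have "cl ((a + b) ^ p) = cl (a ^ p + b ^ p)"
    using ab by (intro adj_cong_imp_cl_eq adj_cong_power_add_prime p adj_power adj_add) auto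
  then show ?thesis using ab by (simp add: cl_power cl_add adj_add adj_power)
qed

abbreviation "f \<equiv> Pocklington.ord n p"
abbreviation "q \<equiv> p ^ f"

lemma coprime_p: "coprime p n" using p prime_imp_coprime by blast

lemma q_cong: "[q = 1] (mod n)" by (rule Pocklington.ord)

text \<open>Writing an element as g(zeta_n), its q-th power is g(zeta_n^q) modulo p, and zeta_n^q =
  zeta_n because q is 1 modulo n.\<close>

lemma pow_q:
  assumes x: "x \<in> carrier F" shows "x [^]\<^bsub>F\<^esub> q = x"
proof -
  obtain a where a: "a \<in> Z" "x = cl a" using x by (rule carrierE)
  obtain g where g: "a = ipoly g (zeta n)" using a(1) by (rule int_adjoinE)
  have "zeta n ^ q = zeta n"
  proof -
    have "q \<ge> 1" using p(1) prime_gt_0_nat by (simp add: Suc_leI)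
    then have "n dvd q - 1" using q_cong by (metis cong_altdef_nat)
    then have "zeta n ^ (q - 1) = 1" using zeta_power_eq_1_iff[OF n0] by simp
    then have "zeta n ^ Suc (q - 1) = zeta n" by simp
    also have "Suc (q - 1) = q" using \<open>q \<ge> 1\<close> by simp
    finally show ?thesis .
  qed
  then have "cl (a ^ q) = cl a"
    using ipoly_power_prime_power_cong[OF p(1), of "zeta n" g f] a(1) g
    by (intro adj_cong_imp_cl_eq adj_power) auto
  then show ?thesis using a by (simp add: cl_power)
qed

end

locale residue_gen = residue +
  fixes g :: "complex set"
  assumes g: "primitive_element F g"
begin

lemma field_F: "field F" and finite_F: "finite (carrier F)" and card_F: "card (carrier F) = q"
  and f_gt_0: "f > 0"
  using F.finite_field_card[OF p(1) char_p refl coprime_p pow_q g cl_closed[OF adj_self] cl_zeta_power_eq_1] by auto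

sublocale F: field F by (rule field_F)

lemma q_gt_1: "q > 1"
  by (rule one_less_power[OF prime_gt_1_nat[OF p(1)] f_gt_0])

lemma g_carrier: "g \<in> carrier F" "g \<noteq> \<zero>\<^bsub>F\<^esub>"
  using g by (auto simp: primitive_element_def)

lemma g_power_nonzero: "g [^]\<^bsub>F\<^esub> (i :: nat) \<noteq> \<zero>\<^bsub>F\<^esub>"
  by (induction i) (use g_carrier in \<open>simp_all add: F.integral_iff\<close>)

lemma g_order: "g [^]\<^bsub>F\<^esub> (i :: nat) = \<one>\<^bsub>F\<^esub> \<longleftrightarrow> q - 1 dvd i"
proof -
  interpret G: group "mult_of F" by (rule F.field_mult_group)
  have "G.ord g = card (generate (mult_of F) {g})" by (rule G.generate_pow_card) (use g_carrier in simp)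
  also have "\<dots> = q - 1" using g card_F finite_F by (simp add: primitive_element_def)
  finally show ?thesis using G.pow_eq_id[of g i] g_carrier
    by (simp add: Multiplicative_Group.nat_pow_mult_of)
qed

lemma g_powers: "carrier F - {\<zero>\<^bsub>F\<^esub>} = (\<lambda>i. g [^]\<^bsub>F\<^esub> i) ` {..<q - 1}"
proof (rule sym, rule card_subset_eq)
  show "finite (carrier F - {\<zero>\<^bsub>F\<^esub>})" using finite_F by simp
  have nz: "g [^]\<^bsub>F\<^esub> i \<noteq> \<zero>\<^bsub>F\<^esub>" for i :: nat by (rule g_power_nonzero)
  then show "(\<lambda>i. g [^]\<^bsub>F\<^esub> i) ` {..<q - 1} \<subseteq> carrier F - {\<zero>\<^bsub>F\<^esub>}" using g_carrier by auto
  have "inj_on (\<lambda>i. g [^]\<^bsub>F\<^esub> i) {..<q - 1}"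
  proof -
    have False if ij: "i < j" "j < q - 1" "g [^]\<^bsub>F\<^esub> i = g [^]\<^bsub>F\<^esub> j" for i j :: nat
    proof -
      have "g [^]\<^bsub>F\<^esub> i \<otimes>\<^bsub>F\<^esub> g [^]\<^bsub>F\<^esub> (j - i) = g [^]\<^bsub>F\<^esub> (i + (j - i))"
        by (rule F.nat_pow_mult[OF g_carrier(1)])
      also have "\<dots> = g [^]\<^bsub>F\<^esub> i \<otimes>\<^bsub>F\<^esub> \<one>\<^bsub>F\<^esub>" using ij g_carrier by simp
      finally have "g [^]\<^bsub>F\<^esub> (j - i) = \<one>\<^bsub>F\<^esub>"
        using F.m_lcancel[OF nz, of i "g [^]\<^bsub>F\<^esub> (j - i)" "\<one>\<^bsub>F\<^esub>"] g_carrier by simp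
      then have "q - 1 dvd j - i" using g_order by blast
      then show False using ij by (auto dest: dvd_imp_le)
    qed
    then show ?thesis by (intro inj_onI) (metis lessThan_iff linorder_neqE_nat)
  qed
  then have "card ((\<lambda>i. g [^]\<^bsub>F\<^esub> i) ` {..<q - 1}) = q - 1" by (simp add: card_image)
  also have "\<dots> = card (carrier F - {\<zero>\<^bsub>F\<^esub>})" using card_F finite_F by simp
  finally show "card ((\<lambda>i. g [^]\<^bsub>F\<^esub> i) ` {..<q - 1}) = card (carrier F - {\<zero>\<^bsub>F\<^esub>})" .
qed

lemma n_dvd: "n dvd q - 1"
  using q_cong q_gt_1 by (metis cong_altdef_nat less_imp_le)

text \<open>Reduction is injective on the complex n-th roots of unity, so their images already
  exhaust the at most n solutions.\<close>

lemma roots_of_unity_F: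
  assumes y: "y \<in> carrier F" "y [^]\<^bsub>F\<^esub> n = \<one>\<^bsub>F\<^esub>"
  obtains z where "z ^ n = 1" "y = cl z"
proof -
  let ?B = "cl ` {z. z ^ n = 1}" and ?A = "{y \<in> carrier F. y [^]\<^bsub>F\<^esub> n = \<one>\<^bsub>F\<^esub>}"
  have Zr: "z \<in> Z" if "z ^ n = 1" for z
    using that range_zeta[OF n0] by (metis (mono_tags, lifting) imageE mem_Collect_eq zeta_power_in)
  have "inj_on cl {z. z ^ n = 1}"
    using cl_inj_roots by (auto simp: inj_on_def)
  then have cB: "card ?B = n" using card_roots_unity_eq[OF n0] by (simp add: card_image)
  have sub: "?B \<subseteq> ?A" using Zr by (auto simp: cl_power[symmetric] cl_one)
  have "card ?A \<le> n" using F.num_roots_le_deg[OF finite_F, of n] n0 by simp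
  moreover have finA: "finite ?A" using finite_F by simp
  ultimately have "?B = ?A" using sub cB card_mono[OF finA sub] by (intro card_subset_eq) auto
  then show ?thesis using y that by blast
qed

abbreviation "\<chi> \<equiv> teichmueller n P q"

text \<open>The condition on all representatives of Y is one equation between classes, and reduction
  separates the roots of unity; this turns the definite description into a criterion.\<close>

lemma teichmueller_unique:
  assumes Y: "Y \<in> carrier F" "Y \<noteq> \<zero>\<^bsub>F\<^esub>" and z: "z ^ n = 1" "cl z = Y [^]\<^bsub>F\<^esub> ((q - 1) div n)"
  shows "\<chi> Y = z"
proof -
  obtain a where a: "a \<in> Z" "Y = cl a" using Y(1) by (rule carrierE)
  have Zr: "z \<in> Z" if "z ^ n = 1" for z
    using that range_zeta[OF n0] by (metis (mono_tags, lifting) imageE mem_Collect_eq zeta_power_in)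
  have iff: "(\<forall>\<alpha>\<in>Y. \<alpha> ^ ((q - 1) div n) - z' \<in> P) \<longleftrightarrow> cl z' = Y [^]\<^bsub>F\<^esub> ((q - 1) div n)" if z': "z' \<in> Z" for z'
  proof
    assume "\<forall>\<alpha>\<in>Y. \<alpha> ^ ((q - 1) div n) - z' \<in> P"
    then have "a ^ ((q - 1) div n) - z' \<in> P" using a(2) mem_cl_iff[of a a] P_0 by auto
    then show "cl z' = Y [^]\<^bsub>F\<^esub> ((q - 1) div n)" using cl_eq_iff[OF adj_power[OF a(1)] z'] unfolding a(2) cl_power[OF a(1), symmetric] by blast
  next
    assume e: "cl z' = Y [^]\<^bsub>F\<^esub> ((q - 1) div n)"
    show "\<forall>\<alpha>\<in>Y. \<alpha> ^ ((q - 1) div n) - z' \<in> P"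
    proof
      fix b assume "b \<in> Y"
      then have "b - a \<in> P" using a mem_cl_iff by simp
      then have b: "b \<in> Z" "cl b = Y" using a P_subset[of "b - a"] cl_eq_iff[of b a] adj_add[of "b - a" "zeta n" a] by auto
      then have "cl (b ^ ((q - 1) div n)) = cl z'" using e by (simp add: cl_power)
      then show "b ^ ((q - 1) div n) - z' \<in> P" using cl_eq_iff[OF adj_power[OF b(1)] z'] by blast
    qed
  qed
  have uniq: "z' = z" if z': "z' ^ n = 1" "cl z' = cl z" for z'
    by (rule cl_inj_roots[OF z'(1) z(1) z'(2)])
  have "(THE z. z \<in> range (\<lambda>i. zeta n ^ i) \<and> (\<forall>\<alpha>\<in>Y. \<alpha> ^ ((q - 1) div n) - z \<in> P)) = z"
  proof (rule the_equality)
    show "z \<in> range (\<lambda>i. zeta n ^ i) \<and> (\<forall>\<alpha>\<in>Y. \<alpha> ^ ((q - 1) div n) - z \<in> P)"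
      using z range_zeta[OF n0] iff[OF Zr[OF z(1)]] by auto
    fix z' assume z': "z' \<in> range (\<lambda>i. zeta n ^ i) \<and> (\<forall>\<alpha>\<in>Y. \<alpha> ^ ((q - 1) div n) - z' \<in> P)"
    then have "z' ^ n = 1" using range_zeta[OF n0] by blast
    then show "z' = z" using z' iff[OF Zr] uniq z by metis
  qed
  then show ?thesis using Y cl_zero_eq by (simp add: teichmueller_def)
qed

lemma teichmueller_props:
  assumes Y: "Y \<in> carrier F" "Y \<noteq> \<zero>\<^bsub>F\<^esub>"
  shows "\<chi> Y ^ n = 1" "cl (\<chi> Y) = Y [^]\<^bsub>F\<^esub> ((q - 1) div n)"
proof -
  obtain i :: nat where "Y = g [^]\<^bsub>F\<^esub> i" using Y g_powers by auto
  then have "Y [^]\<^bsub>F\<^esub> (q - 1) = (g [^]\<^bsub>F\<^esub> (q - 1)) [^]\<^bsub>F\<^esub> i"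
    using g_carrier by (simp add: F.nat_pow_pow mult.commute)
  then have "Y [^]\<^bsub>F\<^esub> (q - 1) = \<one>\<^bsub>F\<^esub>" using g_order[of "q - 1"] by simp
  then have "(Y [^]\<^bsub>F\<^esub> ((q - 1) div n)) [^]\<^bsub>F\<^esub> n = \<one>\<^bsub>F\<^esub>" using n_dvd Y by (simp add: F.nat_pow_pow)
  then obtain z where z: "z ^ n = 1" "Y [^]\<^bsub>F\<^esub> ((q - 1) div n) = cl z"
    using roots_of_unity_F[of "Y [^]\<^bsub>F\<^esub> ((q - 1) div n)"] Y by auto
  then have "\<chi> Y = z" using teichmueller_unique[OF Y] by simp
  then show "\<chi> Y ^ n = 1" "cl (\<chi> Y) = Y [^]\<^bsub>F\<^esub> ((q - 1) div n)" using z by auto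
qed

lemma teichmueller_power:
  "\<chi> (g [^]\<^bsub>F\<^esub> (a :: nat)) = \<chi> g ^ a"
proof (rule teichmueller_unique)
  show "g [^]\<^bsub>F\<^esub> a \<noteq> \<zero>\<^bsub>F\<^esub>" by (rule g_power_nonzero)
  note t = teichmueller_props[OF g_carrier]
  show "(\<chi> g ^ a) ^ n = 1" using t(1) by (metis mult.commute power_mult power_one)
  show "cl (\<chi> g ^ a) = (g [^]\<^bsub>F\<^esub> a) [^]\<^bsub>F\<^esub> ((q - 1) div n)"
    using t(2) g_carrier root_in_Z[OF t(1)] by (simp add: cl_power F.nat_pow_pow mult.commute)
qed (use g_carrier in simp)

lemma teichmueller_g_primitive: "\<chi> g ^ i = 1 \<longleftrightarrow> n dvd i"
proof
  note t = teichmueller_props[OF g_carrier]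
  assume "\<chi> g ^ i = 1"
  then have "cl (\<chi> g) [^]\<^bsub>F\<^esub> i = \<one>\<^bsub>F\<^esub>" using root_in_Z[OF t(1)] by (simp flip: cl_power add: cl_one)
  then have "g [^]\<^bsub>F\<^esub> ((q - 1) div n * i) = \<one>\<^bsub>F\<^esub>" using g_carrier by (simp add: t(2) F.nat_pow_pow)
  then have "(q - 1) div n * n dvd (q - 1) div n * i" using g_order n_dvd by simp
  then show "n dvd i" using q_gt_1 n_dvd by (auto simp: dvd_div_eq_0_iff)
next
  assume "n dvd i" then show "\<chi> g ^ i = 1" using teichmueller_props(1)[OF g_carrier] by (auto simp: power_mult)
qed

end

section \<open>Additive characters and Gauss sums in an extension of prime degree\<close>

text \<open>The cyclotomic classes are the fibres of \<open>\<chi>\<close>, because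
  \<open>\<xi>\<close> has order exactly k.\<close>

lemma (in field) cyclotomic_class_translate:
  fixes Q k i a :: nat and \<xi> :: complex
  assumes fin: "finite (carrier R)" and g: "g \<in> carrier R" "g \<noteq> \<zero>"
    and ord: "\<And>i :: nat. g [^] i = \<one> \<longleftrightarrow> Q dvd i" and Q: "Q > 0" "k dvd Q"
    and gen: "carrier R - {\<zero>} = (\<lambda>i. g [^] i) ` {..<Q}"
    and chi: "\<And>i :: nat. \<chi> (g [^] i) = \<xi> ^ i" and xi: "\<And>i. \<xi> ^ i = 1 \<longleftrightarrow> k dvd i"
  shows "(g [^] a) <#\<^bsub>mult_of R\<^esub> cyclotomic_class R g k i = {x \<in> carrier R - {\<zero>}. \<chi> x = \<xi> ^ (a + i)}"
proof -
  interpret G: group "mult_of R" by (rule field_mult_group)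
  have nz: "g [^] i \<noteq> \<zero>" for i :: nat by (induction i) (use g in \<open>simp_all add: integral_iff\<close>)
  have k0: "k > 0" using Q by (auto intro: Nat.gr0I)
  have x0: "\<xi> \<noteq> 0" using xi[of k] k0 by (auto simp: power_0_left)
  have "generate (mult_of R) {g [^] k} = {(g [^] k) [^]\<^bsub>mult_of R\<^esub> m | m :: nat. m \<in> UNIV}"
    by (rule G.generate_pow_on_finite_carrier) (use fin g nz in auto)
  then have gk: "generate (mult_of R) {g [^] k} = {g [^] (k * m) | m :: nat. True}"
    using g by (simp add: Multiplicative_Group.nat_pow_mult_of nat_pow_pow)
  have cl: "(g [^] a) <#\<^bsub>mult_of R\<^esub> cyclotomic_class R g k i = {g [^] (a + i + k * m) | m :: nat. True}"
  proof -
    have "g [^] a \<otimes> (g [^] i \<otimes> g [^] (k * m)) = g [^] (a + i + k * m)" for m :: nat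
      using g by (simp add: nat_pow_mult add.assoc)
    then show ?thesis unfolding cyclotomic_class_def gk l_coset_def by auto
  qed
  show ?thesis unfolding cl
  proof (intro equalityI subsetI)
    fix x assume "x \<in> {g [^] (a + i + k * m) | m :: nat. True}"
    then obtain m :: nat where x: "x = g [^] (a + i + k * m)" by auto
    have "\<xi> ^ k = 1" using xi by simp
    then have "\<chi> x = \<xi> ^ (a + i)" unfolding x chi by (simp add: power_add power_mult)
    then show "x \<in> {x \<in> carrier R - {\<zero>}. \<chi> x = \<xi> ^ (a + i)}" using x nz g by simp
  next
    fix x assume x: "x \<in> {x \<in> carrier R - {\<zero>}. \<chi> x = \<xi> ^ (a + i)}"
    then obtain b :: nat where b: "x = g [^] b" using gen by auto
    \<comment> \<open>A multiple of Q does not change the power of g and makes the natural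
      subtraction of a + i below exact.\<close>
    define b' where "b' = b + Q * (a + i)"
    have b': "x = g [^] b'"
    proof -
      have "g [^] (Q * (a + i)) = \<one>" using ord by simp
      then show ?thesis unfolding b'_def b using g by (simp add: nat_pow_mult[symmetric])
    qed
    have ge: "a + i \<le> b'" unfolding b'_def using Q(1) by (simp add: trans_le_add2)
    have "\<xi> ^ b' = \<xi> ^ (a + i)" using x b' chi by simp
    then have "\<xi> ^ (a + i) * \<xi> ^ (b' - (a + i)) = \<xi> ^ (a + i)" using ge by (simp flip: power_add)
    then have "\<xi> ^ (b' - (a + i)) = 1" using x0 by simp
    then obtain m where "b' - (a + i) = k * m" using xi by auto
    then have "b' = a + i + k * m" using ge by simp
    then show "x \<in> {g [^] (a + i + k * m) | m :: nat. True}" using b' by auto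
  qed
qed

lemma sum_roots_of_unity_power:
  fixes \<xi> :: complex
  assumes xi: "\<xi> ^ k = 1" and k: "k > 0" and m: "\<xi> ^ m \<noteq> 1"
  shows "(\<Sum>j<k. \<xi> ^ (j * m)) = 0"
proof -
  have "(\<xi> ^ m) ^ k - 1 = (\<xi> ^ m - 1) * (\<Sum>j<k. (\<xi> ^ m) ^ j)" by (rule power_diff_1_eq)
  moreover have "(\<xi> ^ m) ^ k = 1" using xi by (metis mult.commute power_mult power_one)
  ultimately have "(\<Sum>j<k. (\<xi> ^ m) ^ j) = 0" using m by simp
  then show ?thesis by (simp add: power_mult[symmetric] mult.commute)
qed

text \<open>Orthogonality of the powers of \<open>\<chi>\<close>. The abstract index map c serves
  both D and D', whose classes are indexed by I and by pairs; its injectivity modulo k makes the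
  union disjoint.\<close>

lemma (in field) period_sum:
  fixes Q k a :: nat and \<xi> :: complex and c :: "'s \<Rightarrow> nat" and \<psi> :: "'a \<Rightarrow> complex"
  assumes fin: "finite (carrier R)" and g: "g \<in> carrier R" "g \<noteq> \<zero>"
    and ord: "\<And>i :: nat. g [^] i = \<one> \<longleftrightarrow> Q dvd i" and Q: "Q > 0" "k dvd Q"
    and gen: "carrier R - {\<zero>} = (\<lambda>i. g [^] i) ` {..<Q}"
    and chi: "\<And>i :: nat. \<chi> (g [^] i) = \<xi> ^ i" and xi: "\<And>i. \<xi> ^ i = 1 \<longleftrightarrow> k dvd i"
    and S: "finite S" and c: "\<And>s s'. s \<in> S \<Longrightarrow> s' \<in> S \<Longrightarrow> [c s = c s'] (mod k) \<Longrightarrow> s = s'"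
  shows "of_nat k * (\<Sum>x\<in>(g [^] a) <#\<^bsub>mult_of R\<^esub> (\<Union>s\<in>S. cyclotomic_class R g k (c s)). \<psi> x)
    = (\<Sum>j<k. (\<Sum>x\<in>carrier R - {\<zero>}. \<chi> x powi (- int j) * \<psi> x) * \<xi> ^ (j * a) * (\<Sum>s\<in>S. \<xi> ^ (j * c s)))"
proof -
  let ?U = "carrier R - {\<zero>}"
  let ?T = "\<lambda>s. {x \<in> ?U. \<chi> x = \<xi> ^ (a + c s)}"
  have k0: "k > 0" using Q by (auto intro: Nat.gr0I)
  have xik: "\<xi> ^ k = 1" using xi by simp
  have x0: "\<xi> \<noteq> 0" using xik k0 by (auto simp: power_0_left)
  have eqi: "\<xi> ^ i = \<xi> ^ j \<longleftrightarrow> [i = j] (mod k)" for i j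
  proof -
    have "\<xi> ^ i = \<xi> ^ j \<longleftrightarrow> [i = j] (mod k)" if "i \<le> j" for i j
    proof -
      have "\<xi> ^ i = \<xi> ^ j \<longleftrightarrow> \<xi> ^ i * 1 = \<xi> ^ i * \<xi> ^ (j - i)" using that by (simp flip: power_add)
      also have "\<dots> \<longleftrightarrow> \<xi> ^ (j - i) = 1" using x0 by auto
      also have "\<dots> \<longleftrightarrow> [j = i] (mod k)" using xi that by (simp add: cong_altdef_nat)
      finally show ?thesis using cong_sym by blast
    qed
    from this[of i j] this[of j i] show ?thesis by (cases "i \<le> j") (auto simp: cong_sym_eq)
  qed
  have "(g [^] a) <#\<^bsub>mult_of R\<^esub> (\<Union>s\<in>S. cyclotomic_class R g k (c s))
      = (\<Union>s\<in>S. (g [^] a) <#\<^bsub>mult_of R\<^esub> cyclotomic_class R g k (c s))"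
    by (auto simp: l_coset_def)
  also have "\<dots> = (\<Union>s\<in>S. ?T s)"
    using cyclotomic_class_translate[OF fin g ord Q gen chi xi] by simp
  finally have D: "(g [^] a) <#\<^bsub>mult_of R\<^esub> (\<Union>s\<in>S. cyclotomic_class R g k (c s)) = (\<Union>s\<in>S. ?T s)" .
  have "(\<Sum>x\<in>(\<Union>s\<in>S. ?T s). \<psi> x) = (\<Sum>s\<in>S. \<Sum>x\<in>?T s. \<psi> x)"
  proof (rule sum.UNION_disjoint[OF S])
    show "\<forall>s\<in>S. finite (?T s)" using fin by simp
    show "\<forall>s\<in>S. \<forall>s'\<in>S. s \<noteq> s' \<longrightarrow> ?T s \<inter> ?T s' = {}"
    proof (intro ballI impI)
      fix s s' assume s: "s \<in> S" "s' \<in> S" "s \<noteq> s'"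
      have "\<not> [a + c s = a + c s'] (mod k)" using c[OF s(1,2)] s(3) by (auto simp: cong_add_lcancel_nat)
      then have "\<xi> ^ (a + c s) \<noteq> \<xi> ^ (a + c s')" by (simp only: eqi not_False_eq_True)
      then show "?T s \<inter> ?T s' = {}" by auto
    qed
  qed
  also have "of_nat k * \<dots> = (\<Sum>s\<in>S. \<Sum>x\<in>?U. \<Sum>j<k. \<chi> x powi (- int j) * \<psi> x * \<xi> ^ (j * (a + c s)))"
    unfolding sum_distrib_left
  proof (rule sum.cong[OF refl])
    fix s
    have "(\<Sum>x\<in>?T s. of_nat k * \<psi> x) = (\<Sum>x\<in>?U. if \<chi> x = \<xi> ^ (a + c s) then of_nat k * \<psi> x else 0)"
      by (rule sum.inter_filter) (use fin in simp)
    also have "\<dots> = (\<Sum>x\<in>?U. \<Sum>j<k. \<chi> x powi (- int j) * \<psi> x * \<xi> ^ (j * (a + c s)))"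
    proof (rule sum.cong[OF refl])
      fix x assume "x \<in> ?U"
      then obtain b :: nat where b: "x = g [^] b" using gen by auto
      \<comment> \<open>\<open>\<xi>\<close> to the power d is the quotient of the target value by
        \<open>\<chi>\<close> x; the inverse of the b-th power is written with the exponent (k - 1)
        b to stay within natural numbers.\<close>
      define d where "d = (k - 1) * b + (a + c s)"
      have xb: "\<xi> ^ b * \<xi> ^ ((k - 1) * b) = 1"
      proof -
        have "b + (k - 1) * b = k * b" using k0 by (cases k) auto
        then have "\<xi> ^ b * \<xi> ^ ((k - 1) * b) = (\<xi> ^ k) ^ b"
          by (simp only: power_add[symmetric] power_mult[symmetric])
        then show ?thesis unfolding xik by simp
      qed
      then have inv: "inverse (\<xi> ^ b) = \<xi> ^ ((k - 1) * b)" using x0 by (simp add: field_simps)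
      have "\<chi> x powi (- int j) * \<psi> x * \<xi> ^ (j * (a + c s)) = \<psi> x * \<xi> ^ (j * d)" for j
      proof -
        have "\<chi> x powi (- int j) = inverse (\<xi> ^ b) ^ j"
          unfolding b chi by (simp add: power_int_minus power_inverse)
        then have "\<chi> x powi (- int j) = \<xi> ^ (j * ((k - 1) * b))"
          unfolding inv by (simp add: power_mult[symmetric] mult_ac)
        then show ?thesis by (simp add: d_def power_add[symmetric] algebra_simps)
      qed
      then have e: "(\<Sum>j<k. \<chi> x powi (- int j) * \<psi> x * \<xi> ^ (j * (a + c s))) = \<psi> x * (\<Sum>j<k. \<xi> ^ (j * d))"
        unfolding sum_distrib_left by (intro sum.cong refl)
      have d1: "\<xi> ^ d = 1 \<longleftrightarrow> \<chi> x = \<xi> ^ (a + c s)"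
      proof -
        have "\<xi> ^ b * \<xi> ^ d = \<xi> ^ (a + c s)" using xb unfolding d_def by (simp add: power_add mult.assoc[symmetric])
        then show ?thesis using x0 b chi by (auto simp: mult_cancel_left1)
      qed
      show "(if \<chi> x = \<xi> ^ (a + c s) then of_nat k * \<psi> x else 0)
          = (\<Sum>j<k. \<chi> x powi (- int j) * \<psi> x * \<xi> ^ (j * (a + c s)))"
      proof (cases "\<xi> ^ d = 1")
        case True
        then have "\<xi> ^ (j * d) = 1" for j by (metis mult.commute power_mult power_one)
        then have "(\<Sum>j<k. \<xi> ^ (j * d)) = of_nat k" by simp
        then show ?thesis unfolding e using True d1 by (simp add: mult.commute)
      next
        case False
        then show ?thesis unfolding e using sum_roots_of_unity_power[OF xik k0 False] d1 by simp
      qed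
    qed
    finally show "(\<Sum>x\<in>?T s. of_nat k * \<psi> x) = \<dots>" .
  qed
  also have "\<dots> = (\<Sum>s\<in>S. \<Sum>j<k. \<Sum>x\<in>?U. \<chi> x powi (- int j) * \<psi> x * \<xi> ^ (j * (a + c s)))"
    by (intro sum.cong refl sum.swap)
  also have "\<dots> = (\<Sum>j<k. \<Sum>s\<in>S. \<Sum>x\<in>?U. \<chi> x powi (- int j) * \<psi> x * \<xi> ^ (j * (a + c s)))"
    by (rule sum.swap)
  also have "\<dots> = (\<Sum>j<k. (\<Sum>x\<in>?U. \<chi> x powi (- int j) * \<psi> x) * \<xi> ^ (j * a) * (\<Sum>s\<in>S. \<xi> ^ (j * c s)))"
  proof (intro sum.cong refl)
    fix j
    have "(\<Sum>s\<in>S. \<Sum>x\<in>?U. \<chi> x powi (- int j) * \<psi> x * \<xi> ^ (j * (a + c s)))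
        = (\<Sum>s\<in>S. (\<Sum>x\<in>?U. \<chi> x powi (- int j) * \<psi> x) * (\<xi> ^ (j * a) * \<xi> ^ (j * c s)))"
      unfolding sum_distrib_right by (intro sum.cong refl) (simp add: power_add distrib_left)
    then show "(\<Sum>s\<in>S. \<Sum>x\<in>?U. \<chi> x powi (- int j) * \<psi> x * \<xi> ^ (j * (a + c s)))
        = (\<Sum>x\<in>?U. \<chi> x powi (- int j) * \<psi> x) * \<xi> ^ (j * a) * (\<Sum>s\<in>S. \<xi> ^ (j * c s))"
      by (simp add: sum_distrib_left mult.assoc)
  qed
  finally show ?thesis unfolding D by simp
qed

text \<open>Every orbit has exactly n elements, on which h is constant modulo d, so it contributes a
  multiple of n. Orbits are removed one by one.\<close>

lemma sum_cong_zero_of_orbits: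
  fixes h :: "'x \<Rightarrow> complex" and \<phi> :: "'x \<Rightarrow> 'x"
  assumes "finite A" "\<And>x. x \<in> A \<Longrightarrow> \<phi> x \<in> A" "\<And>x. x \<in> A \<Longrightarrow> (\<phi> ^^ n) x = x"
    and "\<And>x. x \<in> A \<Longrightarrow> inj_on (\<lambda>i. (\<phi> ^^ i) x) {..<n}"
    and "\<And>x. x \<in> A \<Longrightarrow> adj_cong z d (h (\<phi> x)) (h x)" and "\<And>x. x \<in> A \<Longrightarrow> h x \<in> int_adjoin z"
    and n: "adj_cong z d (of_nat n) 0" "n > 0"
  shows "adj_cong z d (\<Sum>x\<in>A. h x) 0"
  using assms(1-6)
proof (induction "card A" arbitrary: A rule: less_induct)
  case less
  show ?case
  proof (cases "A = {}")
    case False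
    then obtain x where x: "x \<in> A" by auto
    define Ob where "Ob = (\<lambda>i. (\<phi> ^^ i) x) ` {..<n}"
    have itA: "(\<phi> ^^ i) y \<in> A" if "y \<in> A" for i y by (induction i) (use that less.prems(2) in auto)
    have OA: "Ob \<subseteq> A" using itA[OF x] by (auto simp: Ob_def)
    have xO: "x \<in> Ob" unfolding Ob_def using n(2) by (auto intro!: image_eqI[of _ _ 0])
    have hx: "adj_cong z d (h ((\<phi> ^^ i) x)) (h x)" for i
      by (induction i) (auto intro: adj_cong_trans[OF less.prems(5)[OF itA[OF x]]])
    have "(\<Sum>y\<in>Ob. h y) = (\<Sum>i<n. h ((\<phi> ^^ i) x))"
      unfolding Ob_def using less.prems(4)[OF x] by (simp add: sum.reindex)
    also have "adj_cong z d \<dots> (\<Sum>i<n. h x)" by (intro adj_cong_sum hx)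
    also have "(\<Sum>i<n. h x) = h x * of_nat n" by simp
    also have "adj_cong z d \<dots> (h x * 0)" by (rule adj_cong_mult_left[OF n(1) less.prems(6)[OF x]])
    finally have Obz: "adj_cong z d (\<Sum>y\<in>Ob. h y) 0" by simp
    \<comment> \<open>What remains must again be stable: \<open>\<phi>\<close> has the inverse given
      by its (n - 1)-st iterate, so nothing outside the orbit enters it.\<close>
    have closed_back: "y \<in> Ob" if y: "y \<in> A" "\<phi> y \<in> Ob" for y
    proof -
      obtain i where i: "i < n" "\<phi> y = (\<phi> ^^ i) x" using y(2) by (auto simp: Ob_def)
      have "y = (\<phi> ^^ n) y" using less.prems(3) y by simp
      also have "\<dots> = (\<phi> ^^ (n - 1)) (\<phi> y)" using n(2) by (cases n) (auto simp: funpow_swap1)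
      also have "\<dots> = (\<phi> ^^ (n - 1 + i)) x" unfolding i by (simp add: funpow_add)
      finally have y': "y = (\<phi> ^^ (n - 1 + i)) x" .
      show ?thesis
      proof (cases "i = 0")
        case True then show ?thesis using y' n(2) by (auto simp: Ob_def)
      next
        case False
        then have e: "n - 1 + i = (i - 1) + n" using n(2) by simp
        have "y = (\<phi> ^^ (i - 1)) ((\<phi> ^^ n) x)" unfolding y' e by (simp add: funpow_add)
        then have "y = (\<phi> ^^ (i - 1)) x" using less.prems(3)[OF x] by simp
        then show ?thesis using i(1) by (auto simp: Ob_def)
      qed
    qed
    have "adj_cong z d (\<Sum>y\<in>A - Ob. h y) 0"
    proof (rule less.hyps)
      show "card (A - Ob) < card A" using less.prems(1) xO x by (intro psubset_card_mono) auto
      show "\<phi> y \<in> A - Ob" if "y \<in> A - Ob" for y using that closed_back less.prems(2) by auto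
    qed (use less.prems in auto)
    then have "adj_cong z d ((\<Sum>y\<in>A - Ob. h y) + (\<Sum>y\<in>Ob. h y)) (0 + 0)" using Obz by (rule adj_cong_add)
    then show ?thesis using sum.subset_diff[OF OA less.prems(1), of h] by simp
  qed simp
qed

text \<open>\<open>R\<close> plays the part of \<open>F'\<close>, and the fixed points \<open>base_field\<close> of its \<open>q\<close>-Frobenius that of \<open>F\<close>, so
  that \<open>\<chi>\<^sub>P\<close> becomes the restriction of the single character \<open>\<chi> = \<chi>\<^sub>P\<^sub>'\<close>.\<close>

locale cyclo_ext = finite_field_ext R q n for R (structure) and q n :: nat +
  fixes p f w a e :: nat and \<chi> :: "'a \<Rightarrow> complex" and g :: 'a
  assumes p: "prime p" "q = p ^ f" "coprime p (w * n)" and f0: "f > 0"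
    and w: "w > 0" "\<not> n dvd w" and a: "a \<ge> 1"
    and idx: "\<And>x. x \<ge> 1 \<Longrightarrow> unit_index (w * n ^ x) p = e"
    and qk: "[q = 1] (mod w * n ^ a)"
    and char: "[p] \<cdot> \<one> = \<zero>"
    and frob_p: "\<And>x y. x \<in> carrier R \<Longrightarrow> y \<in> carrier R \<Longrightarrow> (x \<oplus> y) [^] p = x [^] p \<oplus> y [^] p"
    and g: "g \<in> carrier R" "g \<noteq> \<zero>" "\<And>i :: nat. g [^] i = \<one> \<longleftrightarrow> q ^ n - 1 dvd i"
      "carrier R - {\<zero>} = (\<lambda>i. g [^] i) ` {..<q ^ n - 1}"
    and chi_power: "\<And>i :: nat. \<chi> (g [^] i) = \<chi> g ^ i"
    and chi_g: "\<And>i. \<chi> g ^ i = 1 \<longleftrightarrow> w * n ^ Suc a dvd i"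
begin

abbreviation k :: nat where "k \<equiv> w * n ^ a"

lemma p_gt_1: "p > 1" using p prime_gt_1_nat by blast

lemma n_gt_1: "n > 1" using prime_n prime_gt_1_nat by blast

lemma k_gt_0: "k > 0" using w n_gt_0 by simp

lemma n_dvd_k: "n dvd k" using a by (cases a) auto

lemma k_dvd: "k dvd q - 1"
  using qk q1 by (metis cong_altdef_nat less_imp_le)

lemma frob_p_hom: "ring_hom_cring R R (\<lambda>x. x [^] p)"
  by unfold_locales (auto intro!: ring_hom_memI simp: frob_p nat_pow_distrib)

lemma nat_mult_one_eq_zero: "[m] \<cdot> \<one> = \<zero> \<longleftrightarrow> p dvd m"
proof -
  have "add.ord \<one> dvd p" using add.pow_eq_id[of \<one> p] char by simp
  moreover have "add.ord \<one> \<noteq> 1" using add.ord_eq_1[of \<one>] by simp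
  ultimately have "add.ord \<one> = p" using p(1) by (metis prime_nat_iff)
  then show ?thesis using add.pow_eq_id[of \<one> m] by simp
qed

lemma nat_mult_one_add: "[(m + m')] \<cdot> \<one> = [m] \<cdot> \<one> \<oplus> [m'] \<cdot> \<one>" for m m' :: nat
  by (simp add: add.nat_pow_mult)

lemma nat_mult_one_mod: "[(m mod p)] \<cdot> \<one> = [m] \<cdot> \<one>"
proof -
  have "[m] \<cdot> \<one> = [(m div p * p)] \<cdot> \<one> \<oplus> [(m mod p)] \<cdot> \<one>"
    unfolding nat_mult_one_add[symmetric] by simp
  also have "[(m div p * p)] \<cdot> \<one> = \<zero>" using nat_mult_one_eq_zero by simp
  finally show ?thesis by simp
qed

lemma nat_mult_one_inj:
  assumes "m < p" "m' < p" "[m] \<cdot> \<one> = [m'] \<cdot> \<one>" shows "m = m'"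
proof -
  have "m = m'" if "m \<le> m'" "m' < p" "[m] \<cdot> \<one> = [m'] \<cdot> \<one>" for m m'
  proof -
    have "[m] \<cdot> \<one> \<oplus> [(m' - m)] \<cdot> \<one> = [m] \<cdot> \<one> \<oplus> \<zero>"
      unfolding nat_mult_one_add[symmetric] using that by simp
    then have "[(m' - m)] \<cdot> \<one> = \<zero>" by (subst (asm) add.l_cancel) auto
    then have "p dvd m' - m" using nat_mult_one_eq_zero by simp
    then show ?thesis using that by (auto dest: dvd_imp_le)
  qed
  from this[of m m'] this[of m' m] show ?thesis using assms by (cases "m \<le> m'") auto
qed

definition prime_subfield :: "'a set" where
  "prime_subfield = {x \<in> carrier R. x [^] p = x}"

text \<open>The p multiples of 1 are fixed by x -> x^p, and there is room for only p fixed
  points.\<close>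

lemma prime_subfield_eq: "prime_subfield = (\<lambda>m :: nat. [m] \<cdot> \<one>) ` {..<p}"
proof (rule sym, rule card_seteq)
  show "finite prime_subfield" using fin by (simp add: prime_subfield_def)
  interpret h: ring_hom_cring R R "\<lambda>x. x [^] p" by (rule frob_p_hom)
  have "([m] \<cdot> \<one>) [^] p = [m] \<cdot> \<one>" for m :: nat
  proof (induction m)
    case 0 show ?case using p_gt_1 by (simp add: nat_pow_zero)
  next
    case (Suc m) then show ?case by (simp add: frob_p)
  qed
  then show "(\<lambda>m :: nat. [m] \<cdot> \<one>) ` {..<p} \<subseteq> prime_subfield" by (auto simp: prime_subfield_def)
  have "prime_subfield \<subseteq> insert \<zero> {x \<in> carrier R. x [^] (p - 1) = \<one>}"
  proof
    fix x assume x: "x \<in> prime_subfield"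
    then have xc: "x \<in> carrier R" "x [^] p = x" by (auto simp: prime_subfield_def)
    have "x \<otimes> x [^] (p - 1) = x [^] Suc (p - 1)" using nat_pow_Suc2[OF xc(1)] by simp
    also have "Suc (p - 1) = p" using p_gt_1 by simp
    finally have "x \<otimes> x [^] (p - 1) = x \<otimes> \<one>" using xc by simp
    then have "x = \<zero> \<or> x [^] (p - 1) = \<one>" using xc m_lcancel[of x "x [^] (p - 1)" \<one>] by auto
    then show "x \<in> insert \<zero> {x \<in> carrier R. x [^] (p - 1) = \<one>}" using xc by auto
  qed
  then have "card prime_subfield \<le> card (insert \<zero> {x \<in> carrier R. x [^] (p - 1) = \<one>})"
    using fin by (intro card_mono) auto
  also have "\<dots> \<le> Suc (card {x \<in> carrier R. x [^] (p - 1) = \<one>})" by (rule card_insert_le_m1[simplified]) (use fin in auto)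
  also have "\<dots> \<le> Suc (p - 1)" using num_roots_le_deg[OF fin, of "p - 1"] p_gt_1 by simp
  also have "\<dots> = p" using p_gt_1 by simp
  also have "p = card ((\<lambda>m :: nat. [m] \<cdot> \<one>) ` {..<p})"
    by (subst card_image) (auto simp: inj_on_def intro: nat_mult_one_inj)
  finally show "card prime_subfield \<le> card ((\<lambda>m :: nat. [m] \<cdot> \<one>) ` {..<p})" .
qed

text \<open>The definite description inside \<open>add_char\<close>, isolated as a character of the
  prime field; \<open>add_char\<close> is this function after the absolute trace.\<close>

definition pchar :: "'a \<Rightarrow> complex" where
  "pchar x = zeta p ^ (THE m :: nat. m < p \<and> [m] \<cdot> \<one> = x)"

lemma pchar_nat: "pchar ([m] \<cdot> \<one>) = zeta p ^ m"
proof -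
  have "(THE m' :: nat. m' < p \<and> [m'] \<cdot> \<one> = [m] \<cdot> \<one>) = m mod p"
  proof (rule the_equality)
    show "m mod p < p \<and> [(m mod p)] \<cdot> \<one> = [m] \<cdot> \<one>" using p_gt_1 nat_mult_one_mod by simp
    fix m' assume "m' < p \<and> [m'] \<cdot> \<one> = [m] \<cdot> \<one>"
    then show "m' = m mod p" using nat_mult_one_inj[of m' "m mod p"] p_gt_1 nat_mult_one_mod by simp
  qed
  then have "pchar ([m] \<cdot> \<one>) = zeta p ^ (m mod p) * (zeta p ^ p) ^ (m div p)" by (simp add: pchar_def)
  also have "\<dots> = zeta p ^ m" by (simp only: power_mult[symmetric] power_add[symmetric]) (simp add: add.commute)
  finally show ?thesis .
qed

lemma pchar_add:
  assumes "x \<in> prime_subfield" "y \<in> prime_subfield" shows "pchar (x \<oplus> y) = pchar x * pchar y"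
proof -
  obtain m m' :: nat where "x = [m] \<cdot> \<one>" "y = [m'] \<cdot> \<one>" using assms by (auto simp: prime_subfield_eq)
  then show ?thesis by (simp add: nat_mult_one_add[symmetric] pchar_nat power_add del: add.nat_pow_mult)
qed

lemma add_char_eq: "add_char R p r x = pchar (abs_trace R p r x)"
  by (simp add: add_char_def pchar_def)

lemma finsum_shift:
  assumes h: "\<And>i. h i \<in> carrier R" and e: "h (0 :: nat) = h m"
  shows "(\<Oplus>i\<in>{..<m}. h (Suc i)) = (\<Oplus>i\<in>{..<m}. h i)"
proof -
  have "(\<Oplus>i\<in>{..<m}. h (Suc i)) \<oplus> h 0 = (\<Oplus>i\<in>{..<m}. h i) \<oplus> h m" for m
  proof (induction m)
    case (Suc m)
    have "(\<Oplus>i\<in>{..<Suc m}. h (Suc i)) \<oplus> h 0 = h (Suc m) \<oplus> ((\<Oplus>i\<in>{..<m}. h (Suc i)) \<oplus> h 0)"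
      using h by (simp add: lessThan_Suc a_assoc)
    also have "\<dots> = (\<Oplus>i\<in>{..<Suc m}. h i) \<oplus> h (Suc m)"
      unfolding Suc using h by (simp add: lessThan_Suc a_ac)
    finally show ?case .
  qed (use h in simp)
  from this[of m] show ?thesis using h e by (subst (asm) add.r_cancel) auto
qed

lemma finsum_lessThan_add:
  assumes h: "\<And>i. h i \<in> carrier R"
  shows "(\<Oplus>i\<in>{..<m + m'}. h i) = (\<Oplus>i\<in>{..<m}. h i) \<oplus> (\<Oplus>i\<in>{..<m' :: nat}. h (m + i))"
  by (induction m') (use h in \<open>simp_all add: lessThan_Suc a_ac\<close>)

lemma pow_p_power_add:
  assumes "x \<in> carrier R" "y \<in> carrier R"
  shows "(x \<oplus> y) [^] (p ^ i) = x [^] (p ^ i) \<oplus> y [^] (p ^ i)"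
proof (induction i)
  case (Suc i)
  have s: "z [^] (p ^ Suc i) = (z [^] (p ^ i)) [^] p" if "z \<in> carrier R" for z
    using that by (simp add: nat_pow_pow mult.commute)
  show ?case using assms Suc by (simp add: s frob_p del: power_Suc)
qed (use assms in simp)

lemma abs_trace_closed: "x \<in> carrier R \<Longrightarrow> abs_trace R p r x \<in> carrier R"
  by (simp add: abs_trace_def)

lemma abs_trace_add:
  assumes "x \<in> carrier R" "y \<in> carrier R"
  shows "abs_trace R p r (x \<oplus> y) = abs_trace R p r x \<oplus> abs_trace R p r y"
  unfolding abs_trace_def using assms
  by (subst finsum_addf[symmetric]) (auto simp: pow_p_power_add)

lemma abs_trace_pow_p:
  assumes x: "x \<in> carrier R" "x [^] (p ^ r) = x"
  shows "abs_trace R p r (x [^] p) = abs_trace R p r x"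
proof -
  have "abs_trace R p r (x [^] p) = (\<Oplus>i\<in>{..<r}. x [^] (p ^ Suc i))"
    unfolding abs_trace_def using x by (simp add: nat_pow_pow)
  also have "\<dots> = (\<Oplus>i\<in>{..<r}. x [^] (p ^ i))"
    by (rule finsum_shift[where h = "\<lambda>i. x [^] (p ^ i)"]) (use x in auto)
  finally show ?thesis by (simp add: abs_trace_def)
qed

lemma abs_trace_prime_subfield:
  assumes x: "x \<in> carrier R" "x [^] (p ^ r) = x"
  shows "abs_trace R p r x \<in> prime_subfield"
proof -
  interpret h: ring_hom_cring R R "\<lambda>x. x [^] p" by (rule frob_p_hom)
  have "abs_trace R p r x [^] p = (\<Oplus>i\<in>{..<r}. (x [^] (p ^ i)) [^] p)"
    unfolding abs_trace_def using h.hom_finsum[of "\<lambda>i. x [^] (p ^ i)" "{..<r}"] x by (simp add: comp_def)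
  also have "\<dots> = abs_trace R p r (x [^] p)"
    unfolding abs_trace_def using x by (simp add: nat_pow_pow mult.commute)
  finally show ?thesis using abs_trace_pow_p[OF x] abs_trace_closed[OF x(1)] by (simp add: prime_subfield_def)
qed

definition Tr :: "'a \<Rightarrow> 'a" where
  "Tr x = (\<Oplus>i\<in>{..<n}. conj x i)"

lemma Tr_conj:
  assumes x: "x \<in> carrier R" shows "Tr (x [^] q) = Tr x"
proof -
  have "Tr (x [^] q) = (\<Oplus>i\<in>{..<n}. conj x (Suc i))" unfolding Tr_def using x by (simp add: nat_pow_pow)
  also have "\<dots> = Tr x" unfolding Tr_def
    by (rule finsum_shift[where h = "conj x"]) (use x pow_card in auto)
  finally show ?thesis .
qed

text \<open>Transitivity of the trace: the exponents p^(f m + i) with i < f make up the absolute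
  trace of the m-th conjugate.\<close>

lemma abs_trace_Tr:
  assumes x: "x \<in> carrier R"
  shows "abs_trace R p (f * n) x = abs_trace R p f (Tr x)"
proof -
  have "abs_trace R p (f * m) x = abs_trace R p f (\<Oplus>i\<in>{..<m}. conj x i)" for m
  proof (induction m)
    case 0
    show ?case using p_gt_1 by (simp add: abs_trace_def nat_pow_zero)
  next
    case (Suc m)
    have "abs_trace R p (f * Suc m) x = (\<Oplus>i\<in>{..<f * m + f}. x [^] (p ^ i))"
      unfolding abs_trace_def by (simp add: add.commute)
    also have "\<dots> = abs_trace R p (f * m) x \<oplus> (\<Oplus>i\<in>{..<f}. x [^] (p ^ (f * m + i)))"
      unfolding abs_trace_def by (rule finsum_lessThan_add) (use x in simp)
    also have "(\<Oplus>i\<in>{..<f}. x [^] (p ^ (f * m + i))) = abs_trace R p f (conj x m)"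
      unfolding abs_trace_def using x p(2) by (simp add: nat_pow_pow power_add power_mult)
    also have "abs_trace R p (f * m) x \<oplus> abs_trace R p f (conj x m)
        = abs_trace R p f ((\<Oplus>i\<in>{..<m}. conj x i) \<oplus> conj x m)"
      unfolding Suc using x by (intro abs_trace_add[symmetric]) auto
    also have "(\<Oplus>i\<in>{..<m}. conj x i) \<oplus> conj x m = (\<Oplus>i\<in>{..<Suc m}. conj x i)"
      using x by (simp add: lessThan_Suc a_ac)
    finally show ?case .
  qed
  then show ?thesis by (simp add: Tr_def)
qed

abbreviation \<psi>1 :: "'a \<Rightarrow> complex" where "\<psi>1 \<equiv> add_char R p f"
abbreviation \<psi>2 :: "'a \<Rightarrow> complex" where "\<psi>2 \<equiv> add_char R p (f * n)"

lemma base_pow: "x \<in> base_field \<Longrightarrow> x [^] (p ^ f) = x"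
  using base_fieldD(2) p(2) by simp

lemma psi1_add: "x \<in> base_field \<Longrightarrow> y \<in> base_field \<Longrightarrow> \<psi>1 (x \<oplus> y) = \<psi>1 x * \<psi>1 y"
  using base_pow base_fieldD(1)
  by (simp add: add_char_eq abs_trace_add pchar_add abs_trace_prime_subfield)

lemma psi1_zero: "\<psi>1 \<zero> = 1"
proof -
  have "abs_trace R p f \<zero> = [(0 :: nat)] \<cdot> \<one>" using p_gt_1 by (simp add: abs_trace_def nat_pow_zero)
  then show ?thesis unfolding add_char_eq by (simp only: pchar_nat) simp
qed

lemma psi2_eq: "x \<in> carrier R \<Longrightarrow> \<psi>2 x = \<psi>1 (Tr x)"
  by (simp add: add_char_eq abs_trace_Tr)

lemma psi2_conj: "x \<in> carrier R \<Longrightarrow> \<psi>2 (x [^] q) = \<psi>2 x"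
  by (simp add: psi2_eq Tr_conj)

lemma psi2_pow_p: "x \<in> carrier R \<Longrightarrow> \<psi>2 (x [^] p) = \<psi>2 x"
proof -
  assume x: "x \<in> carrier R"
  have "x [^] (p ^ (f * n)) = x" using pow_card[OF x] p(2) by (simp add: power_mult)
  then show ?thesis using abs_trace_pow_p[OF x] by (simp add: add_char_eq)
qed

text \<open>Origin of the factor \<open>\<chi>\<close> (n): on the base field \<open>\<psi>2\<close>
  is \<open>\<psi>1\<close> after multiplication by n.\<close>

lemma Tr_of_base: "x \<in> base_field \<Longrightarrow> Tr x = ([n] \<cdot> \<one>) \<otimes> x"
proof -
  assume x: "x \<in> base_field"
  then have xc: "x \<in> carrier R" by (rule base_fieldD)
  have "(\<Oplus>i\<in>{..<m}. conj x i) = ([m] \<cdot> \<one>) \<otimes> x" for m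
    by (induction m) (use xc in \<open>simp_all add: lessThan_Suc conj_base[OF x] l_distr a_ac\<close>)
  then show ?thesis by (simp add: Tr_def)
qed

end

lemma adj_cong_one_minus_power:
  "z \<in> int_adjoin x \<Longrightarrow> adj_cong x (1 - z) (z ^ i) 1"
proof (induction i)
  case (Suc i)
  have "adj_cong x (1 - z) (z * z ^ i) (z * 1)" using Suc by (intro adj_cong_mult_left) auto
  also have "adj_cong x (1 - z) (z * 1) 1"
    by (auto simp: adj_cong_def intro!: bexI[of _ "- 1"])
  finally show ?case by simp
qed simp

section \<open>Gauss sums over the extension and over its base field\<close>

context cyclo_ext
begin

abbreviation U :: "'a set" where "U \<equiv> carrier R - {\<zero>}"
abbreviation U0 :: "'a set" where "U0 \<equiv> base_field - {\<zero>}"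

lemma g_pow_nonzero: "g [^] (i :: nat) \<noteq> \<zero>"
  by (induction i) (use g in \<open>simp_all add: integral_iff\<close>)

lemma UE:
  assumes "x \<in> U" obtains i :: nat where "x = g [^] i"
  using assms g(4) by auto

lemma chi_mult: "x \<in> U \<Longrightarrow> y \<in> U \<Longrightarrow> \<chi> (x \<otimes> y) = \<chi> x * \<chi> y"
  by (elim UE) (use g(1) in \<open>simp add: nat_pow_mult chi_power power_add\<close>)

lemma chi_pow: "x \<in> U \<Longrightarrow> \<chi> (x [^] (i :: nat)) = \<chi> x ^ i"
  by (elim UE) (use g(1) in \<open>simp add: nat_pow_pow chi_power power_mult\<close>)

lemma chi_one: "\<chi> \<one> = 1"
  using chi_power[of 0] by simp

lemma chi_g_k': "\<chi> g ^ (k * n) = 1"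
  using chi_g[of "k * n"] by (simp add: mult_ac)

lemma chi_root: "x \<in> U \<Longrightarrow> \<chi> x ^ (k * n) = 1"
proof (elim UE)
  fix i :: nat assume x: "x = g [^] i"
  have "\<chi> x ^ (k * n) = (\<chi> g ^ (k * n)) ^ i"
    unfolding x chi_power by (simp only: power_mult[symmetric] mult.commute)
  then show ?thesis using chi_g_k' by simp
qed

lemma chi_nonzero: "x \<in> U \<Longrightarrow> \<chi> x \<noteq> 0"
  using chi_root[of x] k_gt_0 n_gt_0 by (auto simp: power_0_left)

text \<open>The norm to the base field is the power with this exponent, which is also the index of
  the two multiplicative groups.\<close>

definition norm_exp :: nat where "norm_exp = (\<Sum>i<n. q ^ i)"

lemma norm_exp_mult: "(q - 1) * norm_exp = q ^ n - 1"
proof -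
  have "int ((q - 1) * norm_exp) = int (q ^ n - 1)"
    using power_diff_1_eq[of "int q" n] q1 by (simp add: norm_exp_def of_nat_diff)
  then show ?thesis by (simp only: of_nat_eq_iff)
qed

lemma norm_exp_cong: "[norm_exp = n] (mod k * n)"
  unfolding norm_exp_def by (rule geometric_sum_cong[OF qk odd_n n_dvd_k]) (use q1 in simp)

text \<open>The norm exponent is n modulo k n and not merely modulo k; this is why
  \<open>\<chi>\<close> after the norm is the n-th power of \<open>\<chi>\<close>.\<close>

lemma chi_g_norm: "\<chi> g ^ norm_exp = \<chi> g ^ n"
proof -
  have e: "\<chi> g ^ i = \<chi> g ^ (i mod (k * n))" for i
  proof -
    have "\<chi> g ^ i = (\<chi> g ^ (k * n)) ^ (i div (k * n)) * \<chi> g ^ (i mod (k * n))"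
      by (simp only: power_mult[symmetric] power_add[symmetric] mult_div_mod_eq)
    then show ?thesis using chi_g_k' by simp
  qed
  show ?thesis using norm_exp_cong e[of norm_exp] e[of n] by (simp only: cong_def)
qed

lemma base_elem: "g [^] (norm_exp * i) \<in> U0"
proof -
  have "(g [^] norm_exp) [^] (q - 1) = \<one>"
    using g(1,3) norm_exp_mult by (simp add: nat_pow_pow mult.commute)
  then have "(g [^] norm_exp) [^] Suc (q - 1) = g [^] norm_exp" using g(1) by simp
  also have "Suc (q - 1) = q" using q1 by simp
  finally have b: "g [^] norm_exp \<in> base_field" using g(1) by (simp add: base_field_def)
  have "(g [^] norm_exp) [^] i \<in> base_field"
    by (induction i) (use b one_base subringE(6)[OF subfieldE(1)[OF subfield_base]] in auto)
  then show ?thesis using g_pow_nonzero g(1) by (simp add: nat_pow_pow)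
qed

lemma baseE:
  assumes x: "x \<in> U0" obtains i :: nat where "x = g [^] (norm_exp * i)"
proof -
  have xc: "x \<in> U" "x [^] q = x" using x by (auto simp: base_field_def)
  obtain b :: nat where b: "x = g [^] b" using xc(1) by (rule UE)
  have "x \<otimes> x [^] (q - 1) = x [^] Suc (q - 1)" using nat_pow_Suc2 xc(1) by simp
  also have "Suc (q - 1) = q" using q1 by simp
  finally have "x \<otimes> x [^] (q - 1) = x \<otimes> \<one>" using xc by simp
  then have "x [^] (q - 1) = \<one>" using m_lcancel[of x "x [^] (q - 1)" \<one>] xc(1) by simp
  then have "q ^ n - 1 dvd b * (q - 1)" using g(1,3) unfolding b by (simp add: nat_pow_pow)
  then have "(q - 1) * norm_exp dvd (q - 1) * b" unfolding norm_exp_mult by (simp add: mult.commute)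
  then have "norm_exp dvd b" using q1 by simp
  then show ?thesis using that b by (auto elim: dvdE)
qed

lemma chi_base_elem: "\<chi> (g [^] (norm_exp * i)) = (\<chi> g ^ n) ^ i"
  by (simp add: chi_power power_mult chi_g_norm)

lemma chi_base_root: "x \<in> U0 \<Longrightarrow> \<chi> x ^ k = 1"
proof -
  assume "x \<in> U0"
  then obtain i where x: "x = g [^] (norm_exp * i)" by (rule baseE)
  have "((\<chi> g ^ n) ^ i) ^ k = (\<chi> g ^ (k * n)) ^ i"
    by (simp only: power_mult[symmetric]) (simp add: mult_ac)
  then show ?thesis unfolding x chi_base_elem using chi_g_k' by simp
qed

lemma U0_subset: "U0 \<subseteq> U" using base_fieldD(1) by auto

lemma xi_primitive: "(\<chi> g ^ n) ^ i = 1 \<longleftrightarrow> k dvd i"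
  using chi_g[of "n * i"] n_gt_0 by (simp add: power_mult[symmetric] mult_ac)

lemma powi_mod:
  fixes z :: complex assumes z: "z ^ m = 1" "m > 0" and ij: "[i = j] (mod int m)"
  shows "z powi i = z powi j"
proof -
  have z0: "z \<noteq> 0" using z by (auto simp: power_0_left)
  obtain t where t: "i = j + int m * t" using ij by (metis cong_iff_lin cong_sym)
  have "z powi (int m * t) = (z powi int m) powi t" by (rule power_int_mult)
  also have "\<dots> = 1" using z by simp
  finally show ?thesis unfolding t using z0 by (simp add: power_int_add)
qed

lemma mult_base_bij:
  assumes c: "c \<in> U0" shows "bij_betw (\<lambda>x. c \<otimes> x) U0 U0"
proof (rule bij_betwI[where g = "\<lambda>x. inv c \<otimes> x"])
  have K: "subfield base_field R" by (rule subfield_base)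
  have cU: "c \<in> U" using c U0_subset by auto
  have ic: "inv c \<in> U0" using subfield_m_inv(1)[OF K c(1)] by simp
  have mc: "x \<otimes> y \<in> U0" if "x \<in> U0" "y \<in> U0" for x y
    using that subringE(6)[OF subfieldE(1)[OF K]] U0_subset by (auto simp: integral_iff base_fieldD)
  show "(\<lambda>x. c \<otimes> x) \<in> U0 \<rightarrow> U0" using mc c by auto
  show "(\<lambda>x. inv c \<otimes> x) \<in> U0 \<rightarrow> U0" using mc ic by auto
  have cu: "c \<in> Units R" using cU field_Units by auto
  show "inv c \<otimes> (c \<otimes> x) = x" if "x \<in> U0" for x
    using that cu cU base_fieldD(1) by (simp add: m_assoc[symmetric])
  show "c \<otimes> (inv c \<otimes> x) = x" if "x \<in> U0" for x
    using that cu cU base_fieldD(1) by (simp add: m_assoc[symmetric])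
qed

text \<open>The element g^norm_exp of the base field has a character value of order exactly k, so
  multiplication by it rescales the sum by a factor other than 1.\<close>

lemma sum_chi_powi_zero:
  assumes j: "\<not> int k dvd j"
  shows "(\<Sum>x\<in>U0. \<chi> x powi j) = 0"
proof -
  define c where "c = g [^] norm_exp"
  have c: "c \<in> U0" "\<chi> c = \<chi> g ^ n" using base_elem[of 1] chi_base_elem[of 1] by (simp_all add: c_def)
  have cU: "c \<in> U" using c U0_subset by auto
  have ne: "\<chi> c powi j \<noteq> 1"
  proof
    assume h: "\<chi> c powi j = 1"
    have "0 \<le> j mod int k" using k_gt_0 by (intro pos_mod_sign) (simp only: of_nat_0_less_iff)
    then obtain r where r: "j mod int k = int r" using nonneg_int_cases by blast
    have "\<chi> c powi j = \<chi> c powi int r"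
      by (rule powi_mod[OF chi_base_root[OF c(1)] k_gt_0]) (simp only: cong_def r[symmetric] mod_mod_trivial)
    then have "(\<chi> g ^ n) ^ r = 1" using h c(2) by simp
    then have "k dvd r" using xi_primitive by blast
    then have "int k dvd j mod int k" unfolding r by (simp only: int_dvd_int_iff)
    then show False using j by (simp only: dvd_mod_iff[OF dvd_refl])
  qed
  have bij: "bij_betw (\<lambda>x. c \<otimes> x) U0 U0" by (rule mult_base_bij[OF c(1)])
  have "(\<Sum>x\<in>U0. \<chi> x powi j) = (\<Sum>x\<in>U0. \<chi> (c \<otimes> x) powi j)"
    by (rule sum.reindex_bij_betw[OF bij, symmetric])
  also have "\<dots> = (\<Sum>x\<in>U0. \<chi> c powi j * \<chi> x powi j)"
  proof (rule sum.cong[OF refl])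
    fix x assume "x \<in> U0"
    then have "x \<in> U" using U0_subset by auto
    then show "\<chi> (c \<otimes> x) powi j = \<chi> c powi j * \<chi> x powi j"
      using chi_mult[OF cU] by (simp add: power_int_mult_distrib)
  qed
  also have "\<dots> = \<chi> c powi j * (\<Sum>x\<in>U0. \<chi> x powi j)" by (simp add: sum_distrib_left)
  finally have "(1 - \<chi> c powi j) * (\<Sum>x\<in>U0. \<chi> x powi j) = 0" by (simp add: left_diff_distrib)
  then show ?thesis using ne by simp
qed

text \<open>Integer exponents are used because (ii) speaks of positive ones, (iii) and Fourier
  inversion of negative ones.\<close>

definition GK :: "int \<Rightarrow> complex" where
  "GK j = (\<Sum>x\<in>U0. \<chi> x powi j * \<psi>1 x)"

definition GL :: "int \<Rightarrow> complex" where
  "GL j = (\<Sum>x\<in>U. \<chi> x powi j * \<psi>2 x)"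

lemma GK_cong: "[i = j] (mod int k) \<Longrightarrow> GK i = GK j"
  unfolding GK_def using powi_mod[OF chi_base_root k_gt_0] by (intro sum.cong) auto

lemma GL_cong: "[i = j] (mod int (k * n)) \<Longrightarrow> GL i = GL j"
  unfolding GL_def using powi_mod[OF chi_root, of _ i j] k_gt_0 n_gt_0 by (intro sum.cong) auto

text \<open>The map x -> x^p permutes the nonzero elements and preserves the absolute trace.\<close>

lemma GL_mult_p: "GL (j * int p) = GL j"
proof -
  have bij: "bij_betw (\<lambda>x. x [^] p) U U"
  proof (rule bij_betwI[where g = "\<lambda>x. x [^] (p ^ (f * n - 1))"])
    have nz: "x [^] (i :: nat) \<in> U" if "x \<in> U" for x i
      using that by (induction i) (auto simp: integral_iff)
    show "(\<lambda>x. x [^] p) \<in> U \<rightarrow> U" "(\<lambda>x. x [^] (p ^ (f * n - 1))) \<in> U \<rightarrow> U" using nz by auto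
    have "p * p ^ (f * n - 1) = p ^ Suc (f * n - 1)" by simp
    also have "Suc (f * n - 1) = f * n" using f0 n_gt_0 by simp
    finally have fn: "p * p ^ (f * n - 1) = q ^ n" by (simp only: p(2) power_mult)
    show "(x [^] p) [^] (p ^ (f * n - 1)) = x" if "x \<in> U" for x
      using that pow_card by (simp only: nat_pow_pow fn Diff_iff)
    show "(x [^] (p ^ (f * n - 1))) [^] p = x" if "x \<in> U" for x
      using that pow_card by (simp only: nat_pow_pow fn mult.commute[of _ p] Diff_iff)
  qed
  have "GL j = (\<Sum>x\<in>U. \<chi> (x [^] p) powi j * \<psi>2 (x [^] p))"
    unfolding GL_def by (rule sum.reindex_bij_betw[OF bij, symmetric])
  also have "\<dots> = GL (j * int p)"
    unfolding GL_def by (intro sum.cong refl) (simp add: chi_pow psi2_pow_p power_int_mult[symmetric] mult.commute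
      power_int_of_nat[symmetric] del: power_int_of_nat)
  finally show ?thesis by simp
qed

text \<open>By \<open>power_orbit\<close> the shifted exponent is j times a power of p modulo k n,
  and such a factor does not change the sum.\<close>

lemma GL_periodic:
  assumes j: "\<not> int n ^ a dvd j" shows "GL (j + int k * u) = GL j"
proof -
  obtain m where m: "[j * int p ^ m = j + int k * u] (mod int (w * n ^ Suc a))"
    using power_orbit[OF prime_n w(2,1) p(3) a idx j] by blast
  have "GL (j * int p ^ m) = GL j"
  proof (induction m)
    case (Suc m)
    have "GL (j * int p ^ Suc m) = GL (j * int p ^ m * int p)" by (simp add: mult_ac)
    then show ?case using Suc GL_mult_p by simp
  qed simp
  moreover have "GL (j * int p ^ m) = GL (j + int k * u)" using m by (intro GL_cong) (simp add: mult_ac)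
  ultimately show ?thesis by simp
qed

text \<open>The character with exponent n j is the one with exponent j after the norm, and
  \<open>\<psi>2\<close> is \<open>\<psi>1\<close> after the trace.\<close>

lemma GL_davenport_hasse:
  assumes j: "\<not> int k dvd j" shows "GL (int n * j) = GK j ^ n"
proof -
  define \<chi>0 where "\<chi>0 x = (if x = \<zero> then 0 else \<chi> x powi j)" for x
  have norm: "(\<Otimes>i\<in>{..<n}. conj x i) = x [^] norm_exp" if "x \<in> carrier R" for x
  proof -
    have "(\<Otimes>i\<in>{..<m}. conj x i) = x [^] (\<Sum>i<m. q ^ i)" for m
      by (induction m) (use that in \<open>simp_all add: lessThan_Suc nat_pow_mult add.commute\<close>)
    then show ?thesis by (simp add: norm_exp_def)
  qed
  have n0: "norm_exp > 0"
  proof -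
    have "q ^ n > 1" using q1 n_gt_0 by (intro one_less_power) auto
    then show ?thesis using norm_exp_mult by (intro Nat.gr0I) auto
  qed
  have dh: "(\<Sum>x\<in>carrier R. \<chi>0 (\<Otimes>i\<in>{..<n}. conj x i) * \<psi>1 (\<Oplus>i\<in>{..<n}. conj x i))
      = (\<Sum>c\<in>base_field. \<chi>0 c * \<psi>1 c) ^ n"
  proof (rule davenport_hasse)
    show "\<chi>0 (x \<otimes> y) = \<chi>0 x * \<chi>0 y" if xy: "x \<in> base_field" "y \<in> base_field" for x y
      using base_fieldD(1)[OF xy(1)] base_fieldD(1)[OF xy(2)] chi_mult[of x y]
      by (auto simp: \<chi>0_def integral_iff power_int_mult_distrib)
    show "\<chi>0 \<one> = 1" by (simp add: \<chi>0_def chi_one)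
    show "\<chi>0 \<zero> = 0" by (simp add: \<chi>0_def)
    have "(\<Sum>c\<in>base_field. \<chi>0 c) = (\<Sum>c\<in>U0. \<chi>0 c)"
      by (rule sum.mono_neutral_right) (auto simp: finite_base_field \<chi>0_def)
    also have "\<dots> = (\<Sum>c\<in>U0. \<chi> c powi j)" by (intro sum.cong) (auto simp: \<chi>0_def)
    finally show "(\<Sum>c\<in>base_field. \<chi>0 c) = 0" using sum_chi_powi_zero[OF j] by simp
  qed (use psi1_add psi1_zero in auto)
  have "(\<Sum>c\<in>base_field. \<chi>0 c * \<psi>1 c) = (\<Sum>c\<in>U0. \<chi>0 c * \<psi>1 c)"
    by (rule sum.mono_neutral_right) (auto simp: finite_base_field \<chi>0_def)
  also have "\<dots> = GK j" unfolding GK_def by (intro sum.cong) (auto simp: \<chi>0_def)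
  finally have K: "(\<Sum>c\<in>base_field. \<chi>0 c * \<psi>1 c) = GK j" .
  have "(\<Sum>x\<in>carrier R. \<chi>0 (\<Otimes>i\<in>{..<n}. conj x i) * \<psi>1 (\<Oplus>i\<in>{..<n}. conj x i))
      = (\<Sum>x\<in>U. \<chi>0 (\<Otimes>i\<in>{..<n}. conj x i) * \<psi>1 (\<Oplus>i\<in>{..<n}. conj x i))"
    by (rule sum.mono_neutral_right) (use fin n0 in \<open>auto simp: norm \<chi>0_def nat_pow_zero\<close>)
  also have "\<dots> = GL (int n * j)" unfolding GL_def
  proof (rule sum.cong[OF refl])
    fix x assume x: "x \<in> U"
    obtain b :: nat where b: "x = g [^] b" using x by (rule UE)
    have xn: "x [^] norm_exp = g [^] (b * norm_exp)" using g(1) unfolding b by (simp add: nat_pow_pow)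
    have "\<chi> (x [^] norm_exp) = (\<chi> g ^ norm_exp) ^ b"
      unfolding xn chi_power by (simp add: power_mult[symmetric] mult.commute)
    also have "\<dots> = \<chi> x ^ n" unfolding chi_g_norm b chi_power by (simp add: power_mult[symmetric] mult.commute)
    finally have c: "\<chi> (x [^] norm_exp) = \<chi> x ^ n" .
    have "x [^] norm_exp \<noteq> \<zero>" unfolding xn by (rule g_pow_nonzero)
    then have "\<chi>0 (x [^] norm_exp) = \<chi> x powi (int n * j)"
      by (simp add: \<chi>0_def c power_int_mult)
    then show "\<chi>0 (\<Otimes>i\<in>{..<n}. conj x i) * \<psi>1 (\<Oplus>i\<in>{..<n}. conj x i) = \<chi> x powi (int n * j) * \<psi>2 x"
      using x by (simp add: norm psi2_eq Tr_def)
  qed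
  finally show ?thesis using dh K by simp
qed

text \<open>All values of \<open>\<chi>\<close> on nonzero elements and of the additive characters
  are powers of zeta_N, so the Gauss sums lie in one ring Z[zeta_N].\<close>

definition N :: nat where "N = k * n * p"
abbreviation "\<zeta> \<equiv> zeta N"
abbreviation "Zr \<equiv> int_adjoin \<zeta>"

lemma N_gt_0: "N > 0" using k_gt_0 n_gt_0 p_gt_1 by (simp add: N_def)

lemma root_in_Zr:
  assumes "z ^ m = 1" "m dvd N" shows "z \<in> Zr"
proof -
  have "z ^ N = 1" using assms by (auto simp: power_mult)
  then obtain i where "z = \<zeta> ^ i" using range_zeta[OF N_gt_0] by auto
  then show ?thesis by auto
qed

lemma chi_in_Zr: "x \<in> U \<Longrightarrow> \<chi> x \<in> Zr"
  using root_in_Zr[OF chi_root] by (simp add: N_def)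

lemma chi_powi_root: "x \<in> U \<Longrightarrow> (\<chi> x powi j) ^ (k * n) = 1"
proof -
  assume x: "x \<in> U"
  have "(\<chi> x powi j) ^ (k * n) = (\<chi> x ^ (k * n)) powi j"
    by (metis power_int_of_nat power_int_mult mult.commute)
  then show ?thesis using chi_root[OF x] by simp
qed

lemma chi_powi_in_Zr: "x \<in> U \<Longrightarrow> \<chi> x powi j \<in> Zr"
  using root_in_Zr[OF chi_powi_root] by (simp add: N_def)

lemma add_char_root: "add_char R p r x ^ p = 1"
  unfolding add_char_def by (metis mult.commute power_mult power_one zeta_power_self)

lemma add_char_in_Zr: "add_char R p r x \<in> Zr"
  using root_in_Zr[OF add_char_root] by (simp add: N_def)

lemma GK_in_Zr: "GK j \<in> Zr" unfolding GK_def
  using U0_subset chi_powi_in_Zr add_char_in_Zr by (intro adj_sum adj_mult) auto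

section \<open>Congruences modulo 1 - zeta_n\<close>

abbreviation "\<pi> \<equiv> 1 - zeta n"

lemma zeta_n_in_Zr: "zeta n \<in> Zr"
  using root_in_Zr[of "zeta n" n] by (simp add: N_def)

lemma n_cong_0: "adj_cong \<zeta> \<pi> (of_nat n) 0"
proof -
  have "zeta n ^ 1 \<noteq> 1" using zeta_power_eq_1_iff[OF n_gt_0, of 1] n_gt_1 by simp
  then have "(\<Sum>j<n. zeta n ^ (j * 1)) = 0" using n_gt_0 by (intro sum_roots_of_unity_power) auto
  then have "adj_cong \<zeta> \<pi> 0 (\<Sum>j<n. 1)"
    using adj_cong_sum[of "{..<n}" \<zeta> \<pi> "\<lambda>j. zeta n ^ j" "\<lambda>j. 1"] adj_cong_one_minus_power[OF zeta_n_in_Zr] by simp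
  then show ?thesis by (simp add: adj_cong_sym)
qed

lemma n_one_base: "[n] \<cdot> \<one> \<in> U0"
proof -
  have "coprime p n" using p(3) by simp
  then have "\<not> p dvd n" using p_gt_1 coprime_absorb_left[of p n] by auto
  then have "([n] \<cdot> \<one>) \<noteq> \<zero>" using nat_mult_one_eq_zero by simp
  moreover have "[m] \<cdot> \<one> \<in> base_field" for m :: nat
    by (induction m) (use zero_base one_base subringE(7)[OF subfieldE(1)[OF subfield_base]] in auto)
  ultimately show ?thesis by simp
qed

text \<open>Outside the base field the elements fall into Frobenius orbits of size n on which the
  summand is constant modulo \<open>\<pi>\<close>, so they contribute 0. On the base field the trace
  multiplies by n, and the substitution of n x for x splits off the factor \<open>\<chi>\<close>
  (n).\<close>

lemma GL_cong_GK:
  "adj_cong \<zeta> \<pi> (GL j) (\<chi> ([n] \<cdot> \<one>) powi (- j) * GK j)"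
proof -
  let ?h = "\<lambda>x. \<chi> x powi j * \<psi>2 x"
  let ?c = "[n] \<cdot> \<one>"
  have hin: "?h x \<in> Zr" if "x \<in> U" for x using that chi_powi_in_Zr add_char_in_Zr by auto
  have it: "((\<lambda>x. x [^] q) ^^ i) x = conj x i" if "x \<in> carrier R" for x i
    by (induction i) (use that in \<open>simp_all add: nat_pow_pow mult.commute\<close>)
  have nz: "x [^] (i :: nat) \<in> U" if "x \<in> U" for x i
    using that by (induction i) (auto simp: integral_iff)
  have "adj_cong \<zeta> \<pi> (\<Sum>x\<in>U - U0. ?h x) 0"
  proof (rule sum_cong_zero_of_orbits[where n = n and \<phi> = "\<lambda>x. x [^] q"])
    show "finite (U - U0)" using fin by simp
    fix x assume x: "x \<in> U - U0"
    then have xU: "x \<in> U" and xc: "x \<in> carrier R" "x \<notin> base_field" by auto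
    show "x [^] q \<in> U - U0"
    proof -
      have "x [^] q \<notin> base_field"
      proof
        assume b: "x [^] q \<in> base_field"
        have "conj (x [^] q) (n - 1) = conj x n" using xc n_gt_0 by (cases n) (auto simp: nat_pow_pow)
        then show False using conj_base[OF b] pow_card[OF xc(1)] b xc(2) by simp
      qed
      then show ?thesis using nz[OF xU] by auto
    qed
    show "((\<lambda>x. x [^] q) ^^ n) x = x" using it[OF xc(1)] pow_card[OF xc(1)] by simp
    show "inj_on (\<lambda>i. ((\<lambda>x. x [^] q) ^^ i) x) {..<n}" using conj_inj[OF xc] it[OF xc(1)] by simp
    show "?h x \<in> Zr" by (rule hin[OF xU])
    \<comment> \<open>Frobenius changes the summand by this factor, an n-th root of unity since k
      divides q - 1, and therefore 1 modulo \<open>\<pi>\<close>.\<close>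
    define z where "z = \<chi> x powi (j * int (q - 1))"
    have e: "?h (x [^] q) = z * ?h x"
    proof -
      have "int q * j = j * int (q - 1) + j" using q1 by (simp add: of_nat_diff algebra_simps)
      then have "\<chi> (x [^] q) powi j = z * \<chi> x powi j"
        using chi_nonzero[OF xU] unfolding chi_pow[OF xU] z_def
        by (metis power_int_add power_int_mult power_int_of_nat)
      then show ?thesis using psi2_conj[OF xc(1)] by simp
    qed
    have "z ^ n = 1"
    proof -
      obtain m where m: "q - 1 = k * m" using k_dvd by (elim dvdE)
      have "z ^ n = \<chi> x powi (j * int (q - 1) * int n)"
        unfolding z_def by (simp add: power_int_mult)
      also have "\<dots> = \<chi> x powi 0"
      proof (rule powi_mod[OF chi_root[OF xU]])
        show "k * n > 0" using k_gt_0 n_gt_0 by simp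
        have "j * int (q - 1) * int n = int (k * n) * (j * int m)" unfolding m by simp
        then show "[j * int (q - 1) * int n = 0] (mod int (k * n))" by (simp only: cong_0_iff dvd_triv_left)
      qed
      finally show ?thesis by simp
    qed
    then obtain i where i: "z = zeta n ^ i" using range_zeta[OF n_gt_0] by auto
    have "adj_cong \<zeta> \<pi> (?h x * z) (?h x * 1)" unfolding i
      by (intro adj_cong_mult_left hin[OF xU] adj_cong_one_minus_power zeta_n_in_Zr)
    then show "adj_cong \<zeta> \<pi> (?h (x [^] q)) (?h x)" unfolding e by (simp add: mult.commute)
  qed (use n_cong_0 n_gt_0 in auto)
  then have "adj_cong \<zeta> \<pi> ((\<Sum>x\<in>U - U0. ?h x) + (\<Sum>x\<in>U0. ?h x)) (0 + (\<Sum>x\<in>U0. ?h x))"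
    by (intro adj_cong_add) auto
  moreover have "(\<Sum>x\<in>U - U0. ?h x) + (\<Sum>x\<in>U0. ?h x) = GL j"
    unfolding GL_def by (rule sum.subset_diff[OF U0_subset, symmetric]) (use fin in simp)
  moreover have "(\<Sum>x\<in>U0. ?h x) = \<chi> ?c powi (- j) * GK j"
  proof -
    have cU: "?c \<in> U" using n_one_base U0_subset by auto
    have "(\<Sum>x\<in>U0. ?h x) = (\<Sum>x\<in>U0. \<chi> ?c powi (- j) * (\<chi> (?c \<otimes> x) powi j * \<psi>1 (?c \<otimes> x)))"
    proof (rule sum.cong[OF refl])
      fix x assume x: "x \<in> U0"
      have xU: "x \<in> U" using x U0_subset by auto
      have "\<chi> ?c powi (- j) * \<chi> ?c powi j = 1"
        using chi_nonzero[OF cU] by (simp add: power_int_minus)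
      moreover have "\<chi> (?c \<otimes> x) powi j = \<chi> ?c powi j * \<chi> x powi j"
        using chi_mult[OF cU xU] by (simp add: power_int_mult_distrib)
      moreover have "\<psi>2 x = \<psi>1 (?c \<otimes> x)" using psi2_eq[of x] Tr_of_base[of x] x xU by simp
      ultimately show "?h x = \<chi> ?c powi (- j) * (\<chi> (?c \<otimes> x) powi j * \<psi>1 (?c \<otimes> x))"
        by (metis (no_types, lifting) mult.assoc mult_1)
    qed
    also have "\<dots> = \<chi> ?c powi (- j) * (\<Sum>x\<in>U0. \<chi> (?c \<otimes> x) powi j * \<psi>1 (?c \<otimes> x))"
      by (rule sum_distrib_left[symmetric])
    also have "(\<Sum>x\<in>U0. \<chi> (?c \<otimes> x) powi j * \<psi>1 (?c \<otimes> x)) = GK j"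
      unfolding GK_def by (rule sum.reindex_bij_betw[OF mult_base_bij[OF n_one_base]])
    finally show ?thesis .
  qed
  ultimately show ?thesis by simp
qed

end

context cyclo_ext
begin

text \<open>The usual evaluation of a product of two Gauss sums. The assumption that GK j is nonzero
  supplies the nontriviality of \<open>\<psi>1\<close>: for trivial \<open>\<psi>1\<close> the sum
  would be a character sum, which vanishes.\<close>

lemma GK_mult_GK_uminus:
  assumes j: "\<not> int k dvd j" and nz: "GK j \<noteq> 0"
  shows "GK j * GK (- j) = of_nat q * \<chi> (\<ominus> \<one>) powi j"
proof -
  have K: "subring base_field R" by (rule subfieldE(1)[OF subfield_base])
  have m1: "\<ominus> \<one> \<in> U0" using subringE(5)[OF K one_base] by simp
  obtain y0 where y0: "y0 \<in> base_field" "\<psi>1 y0 \<noteq> 1"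
  proof -
    have "\<exists>y0\<in>base_field. \<psi>1 y0 \<noteq> 1"
    proof (rule ccontr)
      assume "\<not> ?thesis"
      then have "GK j = (\<Sum>x\<in>U0. \<chi> x powi j)" unfolding GK_def by (intro sum.cong) auto
      then show False using sum_chi_powi_zero[OF j] nz by simp
    qed
    then show ?thesis using that by blast
  qed
  have s0: "(\<Sum>y\<in>base_field. \<psi>1 y) = 0"
  proof -
    have "bij_betw (\<lambda>y. y0 \<oplus> y) base_field base_field"
    proof (rule bij_betwI[where g = "\<lambda>y. \<ominus> y0 \<oplus> y"])
      have y0c: "y0 \<in> carrier R" using y0 base_fieldD by auto
      show "(\<lambda>y. y0 \<oplus> y) \<in> base_field \<rightarrow> base_field" using subringE(7)[OF K] y0 by auto
      show "(\<lambda>y. \<ominus> y0 \<oplus> y) \<in> base_field \<rightarrow> base_field" using subringE(7)[OF K] subringE(5)[OF K] y0 by auto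
      show "\<ominus> y0 \<oplus> (y0 \<oplus> y) = y" if "y \<in> base_field" for y
        using y0c base_fieldD(1)[OF that] by (simp add: a_assoc[symmetric] l_neg)
      show "y0 \<oplus> (\<ominus> y0 \<oplus> y) = y" if "y \<in> base_field" for y
        using y0c base_fieldD(1)[OF that] by (simp add: a_assoc[symmetric] r_neg)
    qed
    then have "(\<Sum>y\<in>base_field. \<psi>1 y) = (\<Sum>y\<in>base_field. \<psi>1 (y0 \<oplus> y))"
      by (rule sum.reindex_bij_betw[symmetric])
    also have "\<dots> = \<psi>1 y0 * (\<Sum>y\<in>base_field. \<psi>1 y)"
      by (simp add: psi1_add[OF y0(1)] sum_distrib_left)
    finally have "(1 - \<psi>1 y0) * (\<Sum>y\<in>base_field. \<psi>1 y) = 0" by (simp add: left_diff_distrib)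
    then show ?thesis using y0(2) by simp
  qed
  have s1: "(\<Sum>y\<in>U0. \<psi>1 y) = - 1"
    using sum.remove[OF finite_base_field zero_base, of \<psi>1] s0 psi1_zero
    by (simp add: eq_neg_iff_add_eq_0 add.commute)
  have inner: "(\<Sum>y\<in>U0. \<psi>1 (c \<otimes> y)) = (if c = \<zero> then of_nat q else 0) - 1" if c: "c \<in> base_field" for c
  proof (cases "c = \<zero>")
    case True
    have "(\<Sum>y\<in>U0. \<psi>1 (c \<otimes> y)) = (\<Sum>y\<in>U0. 1)"
      using True base_fieldD(1) by (intro sum.cong) (auto simp: psi1_zero)
    also have "\<dots> = of_nat q - 1"
      using card_Diff_singleton[OF zero_base] card_base_field q1 by (simp add: of_nat_diff)
    finally show ?thesis using True by simp
  next
    case False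
    then have "(\<Sum>y\<in>U0. \<psi>1 (c \<otimes> y)) = (\<Sum>y\<in>U0. \<psi>1 y)"
      using c by (intro sum.reindex_bij_betw mult_base_bij) simp
    then show ?thesis using False s1 by simp
  qed
  have "GK j * GK (- j) = (\<Sum>y\<in>U0. \<Sum>x\<in>U0. (\<chi> x powi j * \<psi>1 x) * (\<chi> y powi (- j) * \<psi>1 y))"
    unfolding GK_def by (subst sum_product) (rule sum.swap)
  \<comment> \<open>The substitution x = y z isolates y in \<open>\<psi>1\<close> ((z + 1) y);
    summing over y gives q - 1 for z = -1 and -1 otherwise.\<close>
  also have "\<dots> = (\<Sum>y\<in>U0. \<Sum>z\<in>U0. \<chi> z powi j * \<psi>1 ((z \<oplus> \<one>) \<otimes> y))"
  proof (rule sum.cong[OF refl])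
    fix y assume y: "y \<in> U0"
    have yU: "y \<in> U" using y U0_subset by auto
    have "(\<Sum>x\<in>U0. (\<chi> x powi j * \<psi>1 x) * (\<chi> y powi (- j) * \<psi>1 y))
        = (\<Sum>z\<in>U0. (\<chi> (y \<otimes> z) powi j * \<psi>1 (y \<otimes> z)) * (\<chi> y powi (- j) * \<psi>1 y))"
      by (rule sum.reindex_bij_betw[OF mult_base_bij[OF y], symmetric])
    also have "\<dots> = (\<Sum>z\<in>U0. \<chi> z powi j * \<psi>1 ((z \<oplus> \<one>) \<otimes> y))"
    proof (rule sum.cong[OF refl])
      fix z assume z: "z \<in> U0"
      have zU: "z \<in> U" using z U0_subset by auto
      have "y \<otimes> z \<in> base_field" using subringE(6)[OF K] y z by auto
      then have "\<psi>1 (y \<otimes> z \<oplus> y) = \<psi>1 (y \<otimes> z) * \<psi>1 y" using psi1_add y by auto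
      moreover have "y \<otimes> z \<oplus> y = (z \<oplus> \<one>) \<otimes> y" using yU zU by (simp add: l_distr m_comm[of y z])
      moreover have "\<chi> (y \<otimes> z) powi j * \<chi> y powi (- j) = \<chi> z powi j"
        using chi_mult[OF yU zU] chi_nonzero[OF yU] by (simp add: power_int_mult_distrib power_int_minus field_simps)
      ultimately show "(\<chi> (y \<otimes> z) powi j * \<psi>1 (y \<otimes> z)) * (\<chi> y powi (- j) * \<psi>1 y) = \<chi> z powi j * \<psi>1 ((z \<oplus> \<one>) \<otimes> y)"
        by (metis (no_types, lifting) mult.assoc mult.left_commute)
    qed
    finally show "(\<Sum>x\<in>U0. (\<chi> x powi j * \<psi>1 x) * (\<chi> y powi (- j) * \<psi>1 y)) = \<dots>" .
  qed
  also have "\<dots> = (\<Sum>z\<in>U0. \<chi> z powi j * (\<Sum>y\<in>U0. \<psi>1 ((z \<oplus> \<one>) \<otimes> y)))"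
    by (subst sum.swap) (simp add: sum_distrib_left)
  also have "\<dots> = (\<Sum>z\<in>U0. (if z = \<ominus> \<one> then \<chi> z powi j * of_nat q else 0) - \<chi> z powi j)"
  proof (rule sum.cong[OF refl])
    fix z assume z: "z \<in> U0"
    then have zb: "z \<oplus> \<one> \<in> base_field" using subringE(7)[OF K] one_base by auto
    have "z \<oplus> \<one> = \<zero> \<longleftrightarrow> z = \<ominus> \<one>"
      using z U0_subset by (metis DiffD1 minus_equality l_neg one_closed subsetD)
    then show "\<chi> z powi j * (\<Sum>y\<in>U0. \<psi>1 ((z \<oplus> \<one>) \<otimes> y))
        = (if z = \<ominus> \<one> then \<chi> z powi j * of_nat q else 0) - \<chi> z powi j"
      using inner[OF zb] by (simp add: right_diff_distrib)
  qed
  also have "\<dots> = of_nat q * \<chi> (\<ominus> \<one>) powi j"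
    unfolding sum_subtractf sum_chi_powi_zero[OF j]
    using m1 finite_base_field by (simp add: sum.delta mult.commute)
  finally show ?thesis .
qed

text \<open>The factor p^((f' - f) / 2) of a relative Gauss sum, an integer because n is
  odd.\<close>

definition c0 :: nat where "c0 = q ^ ((n - 1) div 2)"

lemma q_cong_1: "adj_cong \<zeta> \<pi> (of_nat q) 1"
proof -
  obtain m where "q - 1 = n * m" using dvd_trans[OF n_dvd_k k_dvd] by (elim dvdE)
  then have q: "of_nat q = (of_nat m * of_nat n + 1 :: complex)"
    using q1 by (metis Suc_diff_1 Suc_eq_plus1 less_trans mult.commute of_nat_1 of_nat_add of_nat_mult zero_less_one)
  have "adj_cong \<zeta> \<pi> (of_nat m * of_nat n + 1) (of_nat m * 0 + 1)"
    by (intro adj_cong_add adj_cong_mult_left n_cong_0) auto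
  then show ?thesis unfolding q by simp
qed

lemma c0_cong_1: "adj_cong \<zeta> \<pi> (of_nat c0) 1"
  using adj_cong_power[OF q_cong_1, of "(n - 1) div 2"] by (simp add: c0_def)

lemma n_not_dvd_q: "\<not> n dvd q"
proof
  assume h: "n dvd q"
  have "n dvd q - 1" using dvd_trans[OF n_dvd_k k_dvd] .
  then have "n dvd q - (q - 1)" using h by (rule dvd_diff_nat[rotated])
  then show False using q1 n_gt_1 by simp
qed

text \<open>The hypothesis and \<open>GL_cong_GK\<close> express GL j in two ways. Cancelling GK j
  leaves \<open>\<epsilon>\<close> congruent to \<open>\<chi>\<close> (n) to the power -j, and the
  n^a-th power makes this an equation.\<close>

lemma chi_of_n_root:
  assumes \<epsilon>: "\<epsilon> \<in> {1, - 1}" and j: "\<not> int k dvd j" and nz: "GK j \<noteq> 0"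
    and GL: "GL j = \<epsilon> * of_nat c0 * GK j"
  shows "(\<chi> ([n] \<cdot> \<one>) powi (- j)) ^ (n ^ a) = \<epsilon>"
proof -
  define t where "t = \<chi> ([n] \<cdot> \<one>) powi (- j)"
  have K: "subring base_field R" by (rule subfieldE(1)[OF subfield_base])
  have nU: "[n] \<cdot> \<one> \<in> U" using n_one_base U0_subset by auto
  have tZ: "t \<in> Zr" unfolding t_def by (rule chi_powi_in_Zr[OF nU])
  have \<epsilon>Z: "\<epsilon> \<in> Zr" using \<epsilon> by auto
  have m1: "\<ominus> \<one> \<in> U" by auto
  define u where "u = \<chi> (\<ominus> \<one>) powi (- j)"
  have uZ: "u \<in> Zr" unfolding u_def by (rule chi_powi_in_Zr[OF m1])
  \<comment> \<open>GK j is cancelled inside the ring: multiplied by GK (-j) u it becomes q, which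
    is 1 modulo \<open>\<pi>\<close>.\<close>
  have "adj_cong \<zeta> \<pi> (GK (- j) * u * (\<epsilon> * of_nat c0 * GK j)) (GK (- j) * u * (t * GK j))"
    using GL_cong_GK[of j] unfolding GL t_def[symmetric] by (intro adj_cong_mult_left adj_mult GK_in_Zr uZ)
  moreover have "GK j * GK (- j) * u = of_nat q"
    unfolding GK_mult_GK_uminus[OF j nz] u_def using chi_nonzero[OF m1] by (simp add: power_int_minus)
  then have e: "GK (- j) * u * (z * GK j) = z * of_nat q" for z by (metis mult.assoc mult.commute)
  ultimately have c1: "adj_cong \<zeta> \<pi> (\<epsilon> * of_nat c0 * of_nat q) (t * of_nat q)" by simp
  have c2: "adj_cong \<zeta> \<pi> (\<epsilon> * of_nat c0 * of_nat q) (\<epsilon> * 1 * 1)"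
    by (intro adj_cong_mult c0_cong_1 q_cong_1) (use \<epsilon>Z in auto)
  have "adj_cong \<zeta> \<pi> (t * of_nat q) (t * 1)"
    by (intro adj_cong_mult_left q_cong_1 tZ)
  from adj_cong_trans[OF adj_cong_trans[OF adj_cong_sym[OF c2] c1] this]
  have "adj_cong \<zeta> \<pi> \<epsilon> t" by (simp only: mult_1_right)
  then have c: "adj_cong \<zeta> \<pi> (\<epsilon> ^ (n ^ a)) (t ^ (n ^ a))" using \<epsilon>Z tZ by (rule adj_cong_power)
  have \<epsilon>n: "\<epsilon> ^ (n ^ a) = \<epsilon>" using \<epsilon> odd_n by auto
  have tw: "(t ^ (n ^ a)) ^ w = 1"
  proof -
    have "(t ^ (n ^ a)) ^ w = (\<chi> ([n] \<cdot> \<one>) powi (- j)) powi int k"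
      unfolding t_def by (simp only: power_mult[symmetric] power_int_of_nat mult.commute)
    also have "\<dots> = (\<chi> ([n] \<cdot> \<one>) powi int k) powi (- j)" by (metis power_int_mult mult.commute)
    also have "\<chi> ([n] \<cdot> \<one>) powi int k = 1" using chi_base_root[OF n_one_base] by (simp only: power_int_of_nat)
    finally show ?thesis by simp
  qed
  \<comment> \<open>The n^a-th power leaves a w-th root of unity. Both sides are roots of X^(2w+1) -
    X, where n does not divide 2 w.\<close>
  have "\<epsilon> = t ^ (n ^ a)"
  proof (rule adj_cong_imp_eq[OF N_gt_0 _ prime_n zeta_n_in_Zr, of \<epsilon> "t ^ (n ^ a)" "2 * w" 1 1])
    show "adj_cong \<zeta> \<pi> \<epsilon> (t ^ (n ^ a))" using c \<epsilon>n by simp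
    have "\<not> n dvd 2"
    proof
      assume "n dvd 2"
      then have "n = 2" using prime_n by (intro primes_dvd_imp_eq) auto
      then show False using odd_n by simp
    qed
    then show "\<not> n dvd 2 * w" using w prime_n by (simp add: prime_dvd_mult_iff)
    show "\<not> int n dvd 1" using n_gt_1 by simp
    show "\<epsilon> ^ Suc (2 * w) = 1 * \<epsilon>" using \<epsilon> by auto
    show "(t ^ n ^ a) ^ Suc (2 * w) = 1 * t ^ n ^ a"
      using tw by (simp only: power_Suc power_mult mult.commute[of 2 w]) simp
  qed (use \<epsilon>Z tZ in auto)
  then show ?thesis by (simp add: t_def)
qed

text \<open>With D = \<open>\<epsilon>\<close> c0, the hypotheses and Davenport--Hasse make GK j and
  GK (n j) roots of X^n = D X, while \<open>GL_cong_GK\<close> at n j makes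
  \<open>\<epsilon>\<close> GK j and t GK (n j) congruent; both are roots of one separable
  equation.\<close>

lemma GK_relation:
  assumes \<epsilon>: "\<epsilon> \<in> {1, - 1}" and j: "\<not> int k dvd j" "\<not> int k dvd int n * j" "int n ^ a dvd j"
    and GL1: "GL (int n * j) = \<epsilon> * of_nat c0 * GK j"
    and GL2: "GL (int n * (int n * j)) = \<epsilon> * of_nat c0 * GK (int n * j)"
  shows "\<epsilon> * GK j = \<chi> ([n] \<cdot> \<one>) powi (- (int n * j)) * GK (int n * j)"
proof -
  define t where "t = \<chi> ([n] \<cdot> \<one>) powi (- (int n * j))"
  define D where "D = \<epsilon> * of_nat c0"
  have nU: "[n] \<cdot> \<one> \<in> U" using n_one_base U0_subset by auto
  have tZ: "t \<in> Zr" unfolding t_def by (rule chi_powi_in_Zr[OF nU])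
  have \<epsilon>Z: "\<epsilon> \<in> Zr" using \<epsilon> by auto
  have tw: "t ^ w = 1"
  proof -
    obtain i where i: "j = int n ^ a * i" using j(3) by (elim dvdE)
    have "t ^ w = \<chi> ([n] \<cdot> \<one>) powi (- (int n * j) * int w)" unfolding t_def by (simp only: power_int_mult power_int_of_nat)
    also have "\<dots> = \<chi> ([n] \<cdot> \<one>) powi 0"
    proof (rule powi_mod[OF chi_base_root[OF n_one_base] k_gt_0])
      have "- (int n * j) * int w = int k * (- int n * i)" unfolding i by simp
      then show "[- (int n * j) * int w = 0] (mod int k)" by (simp only: cong_0_iff dvd_triv_left)
    qed
    finally show ?thesis by simp
  qed
  \<comment> \<open>The exponent n is stretched to (n - 1) w + 1 so that the w-th root of unity t
    drops out and both numbers satisfy the same equation.\<close>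
  have pw: "x ^ Suc ((n - 1) * i) = D ^ i * x" if x: "x ^ n = D * x" for x i
  proof (induction i)
    case (Suc i)
    have "Suc ((n - 1) * Suc i) = (n - 1) + Suc ((n - 1) * i)" by simp
    then have "x ^ Suc ((n - 1) * Suc i) = x ^ (n - 1) * (D ^ i * x)" using Suc by (simp only: power_add)
    also have "\<dots> = D ^ i * x ^ Suc (n - 1)" by simp
    also have "Suc (n - 1) = n" using n_gt_0 by simp
    finally show ?case using x by (simp add: mult_ac)
  qed simp
  have G1: "GK j ^ n = D * GK j" using GL_davenport_hasse[OF j(1)] GL1 by (simp add: D_def)
  have G2: "GK (int n * j) ^ n = D * GK (int n * j)" using GL_davenport_hasse[OF j(2)] GL2 by (simp add: D_def)
  obtain e' :: int where e': "\<epsilon> = of_int e'" "e' \<in> {1, - 1}" using \<epsilon> by (metis empty_iff insert_iff of_int_1 of_int_minus)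
  have "\<epsilon> * GK j = t * GK (int n * j)"
  proof (rule adj_cong_imp_eq[OF N_gt_0 _ prime_n zeta_n_in_Zr, of _ _ "(n - 1) * w" "(e' * int c0) ^ w" "D ^ w"])
    have c1: "adj_cong \<zeta> \<pi> (\<epsilon> * of_nat c0 * GK j) (t * GK (int n * j))"
      using GL_cong_GK[of "int n * j"] unfolding GL1 t_def[symmetric] .
    have "adj_cong \<zeta> \<pi> (\<epsilon> * of_nat c0 * GK j) (\<epsilon> * 1 * GK j)"
      by (intro adj_cong_mult c0_cong_1) (use \<epsilon>Z GK_in_Zr in auto)
    from adj_cong_trans[OF adj_cong_sym[OF this] c1]
    show "adj_cong \<zeta> \<pi> (\<epsilon> * GK j) (t * GK (int n * j))" by (simp only: mult_1_right)
    have "\<not> n dvd n - 1" using n_gt_1 by (auto dest: dvd_imp_le)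
    then show "\<not> n dvd (n - 1) * w" using w prime_n by (simp add: prime_dvd_mult_iff)
    have pn: "prime (int n)" using prime_n by simp
    have "\<not> n dvd c0" unfolding c0_def using n_not_dvd_q prime_n prime_dvd_power by blast
    then have "\<not> int n dvd e' * int c0" using e'(2) by auto
    then show "\<not> int n dvd (e' * int c0) ^ w" using pn prime_dvd_power by blast
    show "D ^ w = of_int ((e' * int c0) ^ w)" by (simp add: D_def e'(1))
    have "(\<epsilon> * GK j) ^ n = D * (\<epsilon> * GK j)" using \<epsilon> odd_n G1 by (auto simp: power_mult_distrib)
    then show "(\<epsilon> * GK j) ^ Suc ((n - 1) * w) = D ^ w * (\<epsilon> * GK j)" by (rule pw)
    have "t ^ Suc ((n - 1) * w) = (t ^ w) ^ (n - 1) * t"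
      by (simp add: power_mult[symmetric] mult.commute)
    then have tS: "t ^ Suc ((n - 1) * w) = t" unfolding tw by (simp only: power_one mult_1)
    show "(t * GK (int n * j)) ^ Suc ((n - 1) * w) = D ^ w * (t * GK (int n * j))"
      unfolding power_mult_distrib pw[OF G2] tS by (simp only: mult.left_commute)
  qed (use \<epsilon>Z tZ GK_in_Zr in auto)
  then show ?thesis by (simp add: t_def)
qed

text \<open>The condition that c is 1 modulo p fixes the values of the additive characters; those of
  \<open>\<chi>\<close> are raised to the power c.\<close>

lemma galois_action:
  assumes c: "coprime c N" "c > 0" "[c = 1] (mod p)"
  obtains \<sigma> :: "complex \<Rightarrow> complex" where "\<sigma> 0 = 0"
    "\<And>i z. z \<in> Zr \<Longrightarrow> \<sigma> (of_int i * z) = of_int i * \<sigma> z"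
    "\<And>j :: nat. \<sigma> (GK (int j)) = GK (int (c * j))" "\<And>j :: nat. \<sigma> (GL (int j)) = GL (int (c * j))"
proof -
  obtain \<sigma> where \<sigma>: "\<And>a b. a \<in> Zr \<Longrightarrow> b \<in> Zr \<Longrightarrow> \<sigma> (a + b) = \<sigma> a + \<sigma> b"
    "\<And>a b. a \<in> Zr \<Longrightarrow> b \<in> Zr \<Longrightarrow> \<sigma> (a * b) = \<sigma> a * \<sigma> b" "\<And>i. \<sigma> (of_int i) = of_int i" "\<sigma> \<zeta> = \<zeta> ^ c"
    using galois_automorphism[OF N_gt_0 zeta_power_self c(1,2)] by blast
  have s0: "\<sigma> 0 = 0" and s1: "\<sigma> 1 = 1" using \<sigma>(3)[of 0] \<sigma>(3)[of 1] by simp_all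
  have spow: "\<sigma> (z ^ i) = \<sigma> z ^ i" if "z \<in> Zr" for z i
    by (induction i) (use that in \<open>simp_all add: s1 \<sigma>(2) adj_power\<close>)
  have ssum: "\<sigma> (sum h A) = (\<Sum>x\<in>A. \<sigma> (h x))" if "\<And>x. x \<in> A \<Longrightarrow> h x \<in> Zr" for h and A :: "'a set"
    using that by (induction A rule: infinite_finite_induct) (auto simp: s0 \<sigma>(1) adj_sum)
  have sroot: "\<sigma> z = z ^ c" if zN: "z ^ N = 1" for z
  proof -
    obtain i where "z = \<zeta> ^ i" using range_zeta[OF N_gt_0] zN by auto
    then show ?thesis using spow[of \<zeta> i] \<sigma>(4) by (simp add: power_mult[symmetric] mult.commute)
  qed
  have schi: "\<sigma> (\<chi> x powi int j) = \<chi> x powi int (c * j)" if "x \<in> U" for x j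
  proof -
    have "\<chi> x ^ N = 1" using chi_root[OF that] unfolding N_def by (simp only: power_mult power_one)
    then show ?thesis using sroot[of "\<chi> x"] spow[OF chi_in_Zr[OF that], of j]
      by (simp only: power_int_of_nat power_mult)
  qed
  have spsi: "\<sigma> (add_char R p r x) = add_char R p r x" for r x
  proof -
    let ?z = "add_char R p r x"
    have "?z ^ N = 1" using add_char_root[of r x] unfolding N_def by (simp add: power_mult mult.commute[of _ p])
    then have "\<sigma> ?z = ?z ^ c" by (rule sroot)
    also have "\<dots> = ?z powi int c" by simp
    also have "\<dots> = ?z powi 1"
      by (rule powi_mod[OF add_char_root]) (use p_gt_1 c(3) in \<open>auto simp: cong_int_iff[of _ 1, simplified]\<close>)
    finally show ?thesis by simp
  qed
  have "\<sigma> (GK (int j)) = GK (int (c * j))" for j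
  proof -
    have "\<sigma> (GK (int j)) = (\<Sum>x\<in>U0. \<sigma> (\<chi> x powi int j * \<psi>1 x))" unfolding GK_def
      by (intro ssum adj_mult chi_powi_in_Zr add_char_in_Zr) (use U0_subset in blast)
    also have "\<dots> = GK (int (c * j))" unfolding GK_def
    proof (intro sum.cong refl)
      fix x assume "x \<in> U0"
      then have "x \<in> U" using U0_subset by blast
      then show "\<sigma> (\<chi> x powi int j * \<psi>1 x) = \<chi> x powi int (c * j) * \<psi>1 x"
        by (simp only: \<sigma>(2)[OF chi_powi_in_Zr add_char_in_Zr] schi spsi)
    qed
    finally show ?thesis .
  qed
  moreover have "\<sigma> (GL (int j)) = GL (int (c * j))" for j
  proof -
    have "\<sigma> (GL (int j)) = (\<Sum>x\<in>U. \<sigma> (\<chi> x powi int j * \<psi>2 x))" unfolding GL_def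
      by (intro ssum adj_mult chi_powi_in_Zr add_char_in_Zr)
    also have "\<dots> = GL (int (c * j))" unfolding GL_def
      by (intro sum.cong refl) (simp only: \<sigma>(2)[OF chi_powi_in_Zr add_char_in_Zr] schi spsi)
    finally show ?thesis .
  qed
  moreover have "\<sigma> (of_int i * z) = of_int i * \<sigma> z" if "z \<in> Zr" for i z
    using \<sigma>(2)[OF adj_of_int that] \<sigma>(3) by simp
  ultimately show ?thesis using that s0 by blast
qed

text \<open>The relation has integer coefficients and is carried along. Nonvanishing follows by
  going back with the inverse d of c modulo N, which is again 1 modulo p.\<close>

lemma gauss_galois:
  assumes c: "coprime c N" "c > 0" "[c = 1] (mod p)" and \<epsilon>: "\<epsilon> \<in> {1, - 1}"
    and GL: "GL (int j) = \<epsilon> * of_nat c0 * GK (int j)" and nz: "GK (int j) \<noteq> 0"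
  shows "GL (int (c * j)) = \<epsilon> * of_nat c0 * GK (int (c * j))" "GK (int (c * j)) \<noteq> 0"
proof -
  obtain \<sigma> where \<sigma>: "\<sigma> 0 = 0" "\<And>i z. z \<in> Zr \<Longrightarrow> \<sigma> (of_int i * z) = of_int i * \<sigma> z"
    "\<And>j. \<sigma> (GK (int j)) = GK (int (c * j))" "\<And>j. \<sigma> (GL (int j)) = GL (int (c * j))"
    using galois_action[OF c] by metis
  obtain e' :: int where e': "\<epsilon> = of_int e'" using \<epsilon> by (metis empty_iff insert_iff of_int_1 of_int_minus)
  have "GL (int j) = of_int (e' * int c0) * GK (int j)" using GL e' by simp
  then have "\<sigma> (GL (int j)) = of_int (e' * int c0) * \<sigma> (GK (int j))" using \<sigma>(2)[OF GK_in_Zr] by metis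
  then show "GL (int (c * j)) = \<epsilon> * of_nat c0 * GK (int (c * j))" unfolding \<sigma> e' by simp
  show "GK (int (c * j)) \<noteq> 0"
  proof
    assume z: "GK (int (c * j)) = 0"
    obtain d where d: "[c * d = Suc 0] (mod N)" using cong_solve_coprime_nat[OF c(1)] by blast
    have "p \<le> N" using N_gt_0 by (intro dvd_imp_le) (simp_all add: N_def)
    then have "N > 1" using p_gt_1 by simp
    then have d0: "d > 0" using d by (auto simp: cong_def intro: Nat.gr0I)
    have cop: "coprime d N" using d by (metis cong_solve_coprime_nat coprime_iff_invertible_nat mult.commute)
    have "[c * d = 1] (mod p)" using d by (rule_tac cong_dvd_modulus_nat[of _ _ N]) (auto simp: N_def)
    moreover have "[c * d = 1 * d] (mod p)" using c(3) by (rule cong_scalar_right)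
    ultimately have d1: "[d = 1] (mod p)" by (metis cong_sym cong_trans mult_1)
    obtain \<tau> where \<tau>: "\<tau> 0 = 0" "\<And>j. \<tau> (GK (int j)) = GK (int (d * j))"
      using galois_action[OF cop d0 d1] by metis
    have "GK (int (d * (c * j))) = 0" using \<tau>(2)[of "c * j"] z \<tau>(1) by simp
    moreover have "GK (int (d * (c * j))) = GK (int j)"
    proof (rule GK_cong)
      have "[c * d = 1] (mod k)" using d by (rule_tac cong_dvd_modulus_nat[of _ _ N]) (auto simp: N_def)
      then have "[c * d * j = 1 * j] (mod k)" by (rule cong_scalar_right)
      then have "[d * (c * j) = j] (mod k)" by (simp add: mult_ac)
      then show "[int (d * (c * j)) = int j] (mod int k)" by (simp only: cong_int_iff)
    qed
    ultimately show False using nz by simp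
  qed
qed

end

lemma root_of_coprime_orders:
  fixes z :: complex
  assumes "z ^ A = 1" "z ^ B = 1" "coprime A B" "A > 0"
  shows "z = 1"
proof -
  obtain x y where "A * x = B * y + gcd A B" using bezout_nat[of A B] assms(4) by auto
  then have "A * x = B * y + 1" using assms(3) by simp
  then have "z ^ (A * x) = z ^ (B * y) * z" by simp
  then show ?thesis using assms by (simp add: power_mult)
qed

section \<open>Comparison of the two Fourier expansions\<close>

context cyclo_ext
begin

abbreviation \<xi> :: complex where "\<xi> \<equiv> \<chi> g ^ n"

text \<open>The Fourier expansions of \<open>k \<psi>(\<gamma>\<^sup>b D)\<close> and \<open>k n \<psi>'(\<omega>\<^sup>b D')\<close>.\<close>

definition V :: "nat set \<Rightarrow> nat \<Rightarrow> complex" where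
  "V I b = (\<Sum>j<k. GK (- int j) * \<xi> ^ (j * b) * (\<Sum>i\<in>I. \<xi> ^ (j * i)))"

definition V' :: "nat set \<Rightarrow> nat \<Rightarrow> complex" where
  "V' I b = (\<Sum>j<k * n. GL (- int j) * \<chi> g ^ (j * b) * (\<Sum>(i, m)\<in>I \<times> {..<n}. \<chi> g ^ (j * (i * n + m * w))))"

lemma xi_cong: "[i = j] (mod k) \<Longrightarrow> \<xi> ^ i = \<xi> ^ j"
  using powi_mod[of \<xi> k "int i" "int j"] xi_primitive[of k] k_gt_0
  by (simp only: cong_int_iff power_int_of_nat dvd_refl)

text \<open>Off the multiples of n^a the n frequencies j + k v share their Gauss sum and merge into
  the frequency j of V. A frequency n^a y with n not dividing y cancels in the sum over m. The
  frequencies n^(a+1) v correspond to n^a v through \<open>GK_relation\<close>, and frequency 0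
  gives the constant.\<close>

lemma V'_eq_V:
  assumes I: "finite I" and \<epsilon>: "\<epsilon> \<in> {1, - 1}"
    and hS: "\<And>j. j < k \<Longrightarrow> \<not> n ^ a dvd j \<Longrightarrow> (\<Sum>i\<in>I. \<xi> ^ (j * i)) = 0 \<or>
      GL (- int j) = \<epsilon> * of_nat c0 * GK (- int j) \<and> GK (- int j) \<noteq> 0"
    and h3: "\<And>v. v \<in> {1..<w} \<Longrightarrow> GL (- int (n ^ Suc a * v)) = \<epsilon> * of_nat c0 * GK (- int (n ^ a * v))"
  obtains s' where "\<And>A b m. m < n \<Longrightarrow> A + m * w = n * b \<Longrightarrow>
    V' I A = of_nat n * (of_nat c0 * V I (b + s') + (GL 0 - of_nat c0 * GK 0) * of_nat (card I))"
proof -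
  define S where "S j = (\<Sum>i\<in>I. \<xi> ^ (j * i))" for j
  have \<epsilon>\<epsilon>: "\<epsilon> * \<epsilon> = 1" and \<epsilon>n: "\<epsilon> ^ (n ^ a) = \<epsilon>" using \<epsilon> odd_n by auto
  obtain s where s: "\<chi> ([n] \<cdot> \<one>) = \<xi> ^ s" using baseE[OF n_one_base] chi_base_elem by metis
  have cop: "coprime n w" using prime_n w(2) prime_imp_coprime by blast
  obtain x where x: "[n ^ a * x = Suc 0] (mod w)" using cong_solve_coprime_nat[of "n ^ a" w] cop by auto
  define u where "u = x * s"
  \<comment> \<open>s' is s modulo w and 0 modulo n^a. On multiples of n^a it acts like s, which is
    F1; on the other frequencies that occur it has to produce the sign, which is F2.\<close>
  define s' where "s' = n ^ a * u"
  have ss': "[s = s'] (mod w)"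
  proof -
    have "[n ^ a * x * s = Suc 0 * s] (mod w)" using x by (rule cong_scalar_right)
    then show ?thesis by (simp add: s'_def u_def mult.assoc cong_sym)
  qed
  have F1: "\<xi> ^ (n ^ a * j * s) = \<xi> ^ (n ^ a * j * s')" for j
  proof (rule xi_cong)
    have "[j * s = j * s'] (mod w)" using ss' by (rule cong_scalar_left)
    then have "[n ^ a * (j * s) = n ^ a * (j * s')] (mod n ^ a * w)" by (rule cong_cmult_leftI)
    then show "[n ^ a * j * s = n ^ a * j * s'] (mod k)" by (simp add: mult_ac)
  qed
  \<comment> \<open>The n^a-th power of this number is \<open>\<epsilon>\<close> by
    \<open>chi_of_n_root\<close>, and its w-th power is 1 because n^a divides s'. Multiplied by
    \<open>\<epsilon>\<close>, it is killed by the coprime exponents n^a and 2 w.\<close>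
  have F2: "\<xi> ^ (j * s') = \<epsilon>" if j: "j < k" "\<not> n ^ a dvd j" "S j \<noteq> 0" for j
  proof -
    have h: "GL (- int j) = \<epsilon> * of_nat c0 * GK (- int j)" "GK (- int j) \<noteq> 0"
      using hS[OF j(1,2)] j(3) by (auto simp: S_def)
    have "j \<noteq> 0" using j(2) by (intro notI) simp
    then have nk: "\<not> int k dvd - int j" using j(1) by (simp only: dvd_minus_iff int_dvd_int_iff) (auto dest: dvd_imp_le)
    have "(\<chi> ([n] \<cdot> \<one>) powi (- (- int j))) ^ (n ^ a) = \<epsilon>" by (rule chi_of_n_root[OF \<epsilon> nk h(2,1)])
    then have "\<xi> ^ (n ^ a * j * s) = \<epsilon>" unfolding s by (simp add: power_mult[symmetric] mult_ac)
    then have y: "(\<xi> ^ (j * s')) ^ (n ^ a) = \<epsilon>" unfolding F1 by (simp add: power_mult[symmetric] mult_ac)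
    have "(\<xi> ^ (j * s')) ^ w = (\<xi> ^ k) ^ (j * u)" unfolding s'_def by (simp only: power_mult[symmetric] mult_ac)
    then have yw: "(\<xi> ^ (j * s')) ^ w = 1" using xi_primitive[of k] by simp
    have "\<xi> ^ (j * s') * \<epsilon> = 1"
    proof (rule root_of_coprime_orders)
      show "(\<xi> ^ (j * s') * \<epsilon>) ^ (n ^ a) = 1" using y \<epsilon>n \<epsilon>\<epsilon> by (simp only: power_mult_distrib)
      have "(\<xi> ^ (j * s')) ^ (2 * w) = 1" using yw by (simp only: mult.commute[of 2 w] power_mult power_one)
      moreover have "\<epsilon> ^ (2 * w) = 1" using \<epsilon> by auto
      ultimately show "(\<xi> ^ (j * s') * \<epsilon>) ^ (2 * w) = 1" by (simp only: power_mult_distrib mult_1)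
      show "coprime (n ^ a) (2 * w)" using cop odd_n by simp
    qed (use n_gt_0 in simp)
    then have "\<xi> ^ (j * s') * \<epsilon> * \<epsilon> = \<epsilon>" by simp
    then show ?thesis using \<epsilon>\<epsilon> by (simp only: mult.assoc mult_1_right)
  qed
  show ?thesis
  proof (rule that[of s'])
    fix A b m0 assume m0: "m0 < n" "A + m0 * w = n * b"
    \<comment> \<open>T j is the j-th term of V' at A, and H j that of V at the shifted place b +
      s'.\<close>
    define T where "T j = GL (- int j) * \<chi> g ^ (j * A) * (\<Sum>(i, m)\<in>I \<times> {..<n}. \<chi> g ^ (j * (i * n + m * w)))" for j
    define H where "H j = GK (- int j) * \<xi> ^ (j * (b + s')) * S j" for j
    have T': "T j = GL (- int j) * (\<Sum>m<n. \<chi> g ^ (j * (A + m * w))) * S j" for j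
    proof -
      have "(\<Sum>(i, m)\<in>I \<times> {..<n}. \<chi> g ^ (j * (i * n + m * w))) = (\<Sum>i\<in>I. \<Sum>m<n. \<xi> ^ (j * i) * \<chi> g ^ (j * (m * w)))"
        by (simp add: sum.cartesian_product[symmetric] power_mult[symmetric] power_add[symmetric] algebra_simps)
      also have "\<dots> = S j * (\<Sum>m<n. \<chi> g ^ (j * (m * w)))"
        unfolding S_def by (rule sum_product[symmetric])
      also have "\<chi> g ^ (j * A) * \<dots> = (\<Sum>m<n. \<chi> g ^ (j * (A + m * w))) * S j"
        by (simp add: sum_distrib_left sum_distrib_right power_add distrib_left mult_ac)
      finally show ?thesis unfolding T_def by (simp add: mult.assoc)
    qed
    have Hper: "H i = H j" if "[i = j] (mod k)" for i j
    proof -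
      have 1: "GK (- int i) = GK (- int j)"
        using that by (intro GK_cong) (simp only: cong_minus_minus_iff cong_int_iff)
      have 2: "\<xi> ^ (i * t) = \<xi> ^ (j * t)" for t using xi_cong[OF cong_scalar_right[OF that]] .
      show ?thesis unfolding H_def S_def 1 2 ..
    qed
    have Apart: "(\<Sum>v<n. T (j + k * v)) = of_nat n * of_nat c0 * H j" if j: "j < k" "\<not> n ^ a dvd j" for j
    proof -
      have GLj: "GL (- int (j + k * v)) = GL (- int j)" for v
      proof -
        have "\<not> int n ^ a dvd - int j" using j(2) by (simp only: dvd_minus_iff of_nat_power[symmetric] int_dvd_int_iff not_False_eq_True)
        from GL_periodic[OF this, of "- int v"] show ?thesis by (simp add: algebra_simps)
      qed
      have Sj: "S (j + k * v) = S j" for v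
        unfolding S_def by (intro sum.cong refl xi_cong cong_scalar_right) (simp only: cong_def mod_mult_self2)
      have "(\<Sum>v<n. T (j + k * v)) = GL (- int j) * (\<Sum>v<n. \<Sum>m<n. \<chi> g ^ ((j + k * v) * (A + m * w))) * S j"
        unfolding T' GLj Sj by (simp only: sum_distrib_left sum_distrib_right)
      \<comment> \<open>The sum over v vanishes unless n divides A + m w, which singles out m = m0
        because w is prime to n.\<close>
      also have "(\<Sum>v<n. \<Sum>m<n. \<chi> g ^ ((j + k * v) * (A + m * w)))
          = (\<Sum>m<n. \<chi> g ^ (j * (A + m * w)) * (\<Sum>v<n. (\<chi> g ^ k) ^ (v * (A + m * w))))"
        by (subst sum.swap) (simp add: sum_distrib_left power_mult[symmetric] power_add[symmetric] algebra_simps)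
      also have "\<dots> = (\<Sum>m<n. if m = m0 then \<chi> g ^ (j * (A + m * w)) * of_nat n else 0)"
      proof (rule sum.cong[OF refl])
        fix m assume m: "m \<in> {..<n}"
        have kn: "(\<chi> g ^ k) ^ i = 1 \<longleftrightarrow> n dvd i" for i
          using chi_g[of "k * i"] k_gt_0 n_gt_0 by (simp add: power_mult[symmetric] mult.assoc mult.left_commute)
        show "\<chi> g ^ (j * (A + m * w)) * (\<Sum>v<n. (\<chi> g ^ k) ^ (v * (A + m * w)))
            = (if m = m0 then \<chi> g ^ (j * (A + m * w)) * of_nat n else 0)"
        proof (cases "m = m0")
          case True
          then have "(\<chi> g ^ k) ^ (v * (A + m * w)) = 1" for v using m0(2) kn by simp
          then show ?thesis using True by simp
        next
          case False
          have "\<not> n dvd A + m * w"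
          proof
            assume d: "n dvd A + m * w"
            have "[A + m * w = A + m0 * w] (mod n)" using d m0(2) by (simp add: cong_0_iff[symmetric] cong_def)
            then have "[m * w = m0 * w] (mod n)" by (simp only: cong_add_lcancel_nat)
            then have "[m = m0] (mod n)" using cop cong_mult_rcancel_nat[of w n m m0] by (simp add: coprime_commute)
            then show False using m m0(1) False by (simp add: cong_def)
          qed
          then have ne: "(\<chi> g ^ k) ^ (A + m * w) \<noteq> 1" using kn by blast
          have kn1: "(\<chi> g ^ k) ^ n = 1" using kn by simp
          show ?thesis unfolding sum_roots_of_unity_power[OF kn1 n_gt_0 ne] using False by simp
        qed
      qed
      also have "\<dots> = \<chi> g ^ (j * (n * b)) * of_nat n" using m0 by (simp add: sum.delta)
      also have "\<chi> g ^ (j * (n * b)) = \<xi> ^ (j * b)" by (simp add: power_mult[symmetric] mult_ac)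
      finally have e: "(\<Sum>v<n. T (j + k * v)) = of_nat n * (GL (- int j) * \<xi> ^ (j * b) * S j)" by (simp add: mult_ac)
      show ?thesis
      proof (cases "S j = 0")
        case True then show ?thesis unfolding e H_def by simp
      next
        case False
        then have "GL (- int j) = \<epsilon> * of_nat c0 * GK (- int j)" using hS[OF j] by (auto simp: S_def)
        moreover have "\<xi> ^ (j * (b + s')) = \<xi> ^ (j * b) * \<epsilon>"
          using F2[OF j False] by (simp add: distrib_left power_add)
        ultimately show ?thesis unfolding e H_def by (simp add: mult_ac)
      qed
    qed
    \<comment> \<open>Here the values for the different m are the powers of a nontrivial n-th root
      of unity; this is the effect of the inner union in D'.\<close>
    have B0: "T (n ^ a * y) = 0" if y: "\<not> n dvd y" for y
    proof -
      define z where "z = \<chi> g ^ (n ^ a * y * w)"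
      have "z \<noteq> 1"
      proof
        assume "z = 1"
        then have "n ^ a * w * n dvd n ^ a * w * y" using chi_g[of "n ^ a * y * w"] by (simp add: z_def mult_ac)
        then show False using y w(1) n_gt_0 by simp
      qed
      moreover have "z ^ n = 1" using chi_g_k' unfolding z_def by (simp add: power_mult[symmetric] mult_ac)
        (metis mult.assoc mult.commute power_mult power_one)
      ultimately have "(\<Sum>m<n. z ^ (m * 1)) = 0" using n_gt_0 by (intro sum_roots_of_unity_power) auto
      moreover have "\<chi> g ^ (n ^ a * y * (A + m * w)) = \<chi> g ^ (n ^ a * y * A) * z ^ (m * 1)" for m
        unfolding z_def by (simp add: power_mult[symmetric] power_add[symmetric] algebra_simps)
      ultimately show ?thesis unfolding T' by (simp add: sum_distrib_left[symmetric])
    qed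
    have B1: "T (n ^ Suc a * v) = of_nat n * (GL (- int (n ^ Suc a * v)) * \<xi> ^ (n ^ Suc a * v * b) * S (n ^ Suc a * v))" for v
    proof -
      have t: "\<chi> g ^ (n ^ Suc a * v * (A + m * w)) = \<chi> g ^ (n ^ Suc a * v * A)" for m
      proof -
        have "\<chi> g ^ (n ^ Suc a * v * (m * w)) = (\<chi> g ^ (k * n)) ^ (v * m)"
          by (simp add: power_mult[symmetric] mult_ac)
        then show ?thesis using chi_g_k' by (simp add: distrib_left power_add)
      qed
      have "\<chi> g ^ (n ^ Suc a * v * A) = \<chi> g ^ (n ^ Suc a * v * (n * b))" unfolding m0(2)[symmetric] t ..
      also have "\<dots> = \<xi> ^ (n ^ Suc a * v * b)" by (simp only: power_mult[symmetric] mult_ac)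
      finally show ?thesis unfolding T' t by (simp add: mult_ac)
    qed
    have modw: "(n * v) mod w \<in> {1..<w}" "(n * v) mod w \<noteq> 0" if v: "v \<in> {1..<w}" for v
    proof -
      have "\<not> w dvd v" using v by (auto dest: dvd_imp_le)
      then have "\<not> w dvd n * v" using cop by (simp add: coprime_commute coprime_dvd_mult_right_iff)
      then show "(n * v) mod w \<noteq> 0" by (simp add: mod_eq_0_iff_dvd)
      then show "(n * v) mod w \<in> {1..<w}" using w(1) by simp
    qed
    have B2: "T (n ^ Suc a * v) = of_nat n * of_nat c0 * H (n ^ Suc a * v)" if v: "v \<in> {1..<w}" for v
    proof -
      have wv: "\<not> w dvd v" using v by (auto dest: dvd_imp_le)
      have wnv: "\<not> w dvd n * v" using modw(2)[OF v] by (simp add: mod_eq_0_iff_dvd)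
      define j where "j = - int (n ^ a * v)"
      have nj: "int n * j = - int (n ^ Suc a * v)" by (simp add: j_def)
      have "\<epsilon> * GK j = \<chi> ([n] \<cdot> \<one>) powi (- (int n * j)) * GK (int n * j)"
      proof (rule GK_relation[OF \<epsilon>])
        have "k dvd n ^ a * i \<longleftrightarrow> w dvd i" for i using n_gt_0 by (simp add: mult.commute[of w])
        from this[of v] this[of "n * v"] show "\<not> int k dvd j" "\<not> int k dvd int n * j"
          unfolding nj unfolding j_def dvd_minus_iff int_dvd_int_iff using wv wnv by (simp_all add: mult_ac)
        show "int n ^ a dvd j" by (simp add: j_def)
        show "GL (int n * j) = \<epsilon> * of_nat c0 * GK j" unfolding nj unfolding j_def by (rule h3[OF v])
        \<comment> \<open>(iii) is given for 1 <= v < w only, so n v is reduced modulo w; the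
          periods k n of GL and k of GK permit this.\<close>
        let ?v = "(n * v) mod w"
        have cw: "[n ^ i * ?v = n ^ i * (n * v)] (mod n ^ i * w)" for i by (rule cong_cmult_leftI) simp
        have "GL (int n * (int n * j)) = GL (- int (n ^ Suc a * ?v))"
        proof (rule GL_cong)
          have "[- int (n ^ Suc a * ?v) = - int (n ^ Suc a * (n * v))] (mod int (n ^ Suc a * w))"
            using cw[of "Suc a"] by (simp only: cong_minus_minus_iff cong_int_iff)
          moreover have "n ^ Suc a * w = k * n" by simp
          moreover have "- int (n ^ Suc a * (n * v)) = int n * (int n * j)" by (simp add: j_def mult_ac)
          ultimately show "[int n * (int n * j) = - int (n ^ Suc a * ?v)] (mod int (k * n))" by (metis cong_sym)
        qed
        also have "\<dots> = \<epsilon> * of_nat c0 * GK (- int (n ^ a * ?v))" by (rule h3[OF modw(1)[OF v]])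
        also have "GK (- int (n ^ a * ?v)) = GK (int n * j)"
        proof (rule GK_cong)
          have "[- int (n ^ a * ?v) = - int (n ^ a * (n * v))] (mod int (n ^ a * w))"
            using cw[of a] by (simp only: cong_minus_minus_iff cong_int_iff)
          then show "[- int (n ^ a * ?v) = int n * j] (mod int k)" by (simp add: j_def mult_ac)
        qed
        finally show "GL (int n * (int n * j)) = \<epsilon> * of_nat c0 * GK (int n * j)" .
      qed
      also have "\<chi> ([n] \<cdot> \<one>) powi (- (int n * j)) = \<xi> ^ (n ^ Suc a * v * s)"
        unfolding nj s by (simp only: group_add_class.minus_minus power_int_of_nat power_mult[symmetric] mult_ac)
      also have "\<dots> = \<xi> ^ (n ^ Suc a * v * s')" using F1[of "n * v"] by (simp only: power_Suc mult_ac)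
      finally have r: "\<epsilon> * GK (- int (n ^ a * v)) = \<xi> ^ (n ^ Suc a * v * s') * GK (- int (n ^ Suc a * v))"
        unfolding nj unfolding j_def .
      have e: "GL (- int (n ^ Suc a * v)) = of_nat c0 * (\<xi> ^ (n ^ Suc a * v * s') * GK (- int (n ^ Suc a * v)))"
        unfolding r[symmetric] h3[OF v] by (simp only: mult_ac)
      show ?thesis unfolding B1 e H_def distrib_left power_add by (simp only: mult_ac)
    qed
    define HB where "HB = (\<Sum>v\<in>{1..<w}. H (n ^ a * v))"
    \<comment> \<open>Multiplication by n permutes the nonzero residues modulo w, which absorbs the
      change from j to n j.\<close>
    have HB': "(\<Sum>v\<in>{1..<w}. H (n ^ Suc a * v)) = HB"
    proof -
      have "bij_betw (\<lambda>v. (n * v) mod w) {1..<w} {1..<w}"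
      proof -
        have inj: "inj_on (\<lambda>v. (n * v) mod w) {1..<w}"
        proof (rule inj_onI)
          fix v v' assume v: "v \<in> {1..<w}" "v' \<in> {1..<w}" "(n * v) mod w = (n * v') mod w"
          then have "[v = v'] (mod w)" using cong_mult_lcancel_nat[OF cop, of v v'] by (simp add: cong_def)
          then show "v = v'" using v by (simp add: cong_def)
        qed
        have "(\<lambda>v. (n * v) mod w) ` {1..<w} = {1..<w}"
          by (rule card_subset_eq) (use modw inj in \<open>auto simp: card_image\<close>)
        then show ?thesis using inj by (simp add: bij_betw_def)
      qed
      then have "HB = (\<Sum>v\<in>{1..<w}. H (n ^ a * ((n * v) mod w)))"
        unfolding HB_def by (rule sum.reindex_bij_betw[symmetric])
      also have "\<dots> = (\<Sum>v\<in>{1..<w}. H (n ^ Suc a * v))"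
      proof (intro sum.cong refl Hper)
        fix v
        have "[n ^ a * ((n * v) mod w) = n ^ a * (n * v)] (mod n ^ a * w)" by (rule cong_cmult_leftI) simp
        then show "[n ^ a * ((n * v) mod w) = n ^ Suc a * v] (mod k)" by (simp add: mult_ac)
      qed
      finally show ?thesis by simp
    qed
    define HA where "HA = (\<Sum>j\<in>{j\<in>{..<k}. \<not> n ^ a dvd j}. H j)"
    have na0: "n ^ a > 0" using n_gt_0 by simp
    have split: "{j\<in>{..<w' * n ^ a}. n ^ a dvd j} = (\<lambda>v. n ^ a * v) ` {..<w'}" for w'
      using na0 by (auto simp: image_iff mult.commute elim!: dvdE)
    have injm: "inj_on (\<lambda>v. n ^ a * v) B" for B using na0 by (auto simp: inj_on_def)
    have remove0: "(\<Sum>v<w. h v) = h 0 + (\<Sum>v\<in>{1..<w}. h v)" for h :: "nat \<Rightarrow> complex"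
    proof -
      have "{..<w} = insert 0 {1..<w}" using w(1) by auto
      then show ?thesis by simp
    qed
    have "V I (b + s') = (\<Sum>j<k. H j)" unfolding V_def H_def S_def ..
    also have "\<dots> = HA + (\<Sum>j\<in>{j\<in>{..<k}. n ^ a dvd j}. H j)"
      unfolding HA_def by (subst sum.union_disjoint[symmetric]) (auto intro: sum.cong)
    also have "(\<Sum>j\<in>{j\<in>{..<k}. n ^ a dvd j}. H j) = (\<Sum>v<w. H (n ^ a * v))"
      unfolding split by (simp add: sum.reindex[OF injm])
    also have "\<dots> = H 0 + HB" unfolding remove0 HB_def by simp
    also have "H 0 = GK 0 * of_nat (card I)" by (simp add: H_def S_def)
    finally have V: "V I (b + s') = HA + (GK 0 * of_nat (card I) + HB)" .
    have "V' I A = (\<Sum>j<k * n. T j)" unfolding V'_def T_def ..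
    also have "\<dots> = (\<Sum>j\<in>{j\<in>{..<k * n}. \<not> n ^ a dvd j}. T j) + (\<Sum>j\<in>{j\<in>{..<k * n}. n ^ a dvd j}. T j)"
      by (subst sum.union_disjoint[symmetric]) (auto intro: sum.cong)
    also have "(\<Sum>j\<in>{j\<in>{..<k * n}. \<not> n ^ a dvd j}. T j) = of_nat n * of_nat c0 * HA"
    proof -
      let ?J = "{j\<in>{..<k}. \<not> n ^ a dvd j}"
      have nk: "n ^ a dvd j + k * v \<longleftrightarrow> n ^ a dvd j" for j v by (simp add: dvd_add_left_iff)
      have "bij_betw (\<lambda>(j, v). j + k * v) (?J \<times> {..<n}) {j\<in>{..<k * n}. \<not> n ^ a dvd j}"
      proof (rule bij_betwI[where g = "\<lambda>i. (i mod k, i div k)"])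
        show "(\<lambda>(j, v). j + k * v) \<in> ?J \<times> {..<n} \<rightarrow> {j\<in>{..<k * n}. \<not> n ^ a dvd j}"
        proof (rule funcsetI)
          fix x assume "x \<in> ?J \<times> {..<n}"
          then obtain j v where x: "x = (j, v)" and jv: "j \<in> ?J" "v \<in> {..<n}" by blast
          have "j + k * v < k + k * v" using jv by simp
          also have "\<dots> = k * Suc v" by simp
          also have "\<dots> \<le> k * n" using jv by (intro mult_le_mono2) simp
          finally show "(\<lambda>(j, v). j + k * v) x \<in> {j\<in>{..<k * n}. \<not> n ^ a dvd j}" using jv nk x by simp
        qed
        show "(\<lambda>i. (i mod k, i div k)) \<in> {j\<in>{..<k * n}. \<not> n ^ a dvd j} \<rightarrow> ?J \<times> {..<n}"
          using k_gt_0 by (auto simp: less_mult_imp_div_less mult.commute dvd_mod_iff)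
        show "(\<lambda>i. (i mod k, i div k)) ((\<lambda>(j, v). j + k * v) x) = x" if xm: "x \<in> ?J \<times> {..<n}" for x
        proof -
          obtain j v where x: "x = (j, v)" "j < k" using xm by blast
          have "k \<noteq> 0" using k_gt_0 by simp
          then have "(j + k * v) div k = v + j div k" by (rule div_mult_self2)
          then have "(j + k * v) div k = v" using x(2) by (simp only: div_less add_0_right)
          moreover have "(j + k * v) mod k = j" using x(2) by (simp only: mod_mult_self2 mod_less)
          ultimately show ?thesis using x(1) by simp
        qed
        show "(\<lambda>(j, v). j + k * v) ((\<lambda>i. (i mod k, i div k)) i) = i" for i by simp
      qed
      then have "(\<Sum>j\<in>{j\<in>{..<k * n}. \<not> n ^ a dvd j}. T j) = (\<Sum>(j, v)\<in>?J \<times> {..<n}. T (j + k * v))"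
        by (subst sum.reindex_bij_betw[symmetric]) (auto simp: case_prod_unfold)
      also have "\<dots> = (\<Sum>j\<in>?J. \<Sum>v<n. T (j + k * v))" by (rule sum.cartesian_product[symmetric])
      also have "\<dots> = (\<Sum>j\<in>?J. of_nat n * of_nat c0 * H j)" by (rule sum.cong[OF refl], rule Apart) auto
      finally show ?thesis by (simp add: HA_def sum_distrib_left)
    qed
    also have "(\<Sum>j\<in>{j\<in>{..<k * n}. n ^ a dvd j}. T j) = of_nat n * (GL 0 * of_nat (card I)) + of_nat n * of_nat c0 * HB"
    proof -
      have kn: "k * n = w * n * n ^ a" by simp
      have "(\<Sum>j\<in>{j\<in>{..<k * n}. n ^ a dvd j}. T j) = (\<Sum>y<w * n. T (n ^ a * y))"
        unfolding kn split by (simp add: sum.reindex[OF injm])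
      also have "\<dots> = (\<Sum>y\<in>{y\<in>{..<w * n}. n dvd y}. T (n ^ a * y))"
        by (rule sum.mono_neutral_right) (auto intro: B0)
      also have "{y\<in>{..<w * n}. n dvd y} = (\<lambda>v. n * v) ` {..<w}"
        using n_gt_0 by (auto simp: image_iff mult.commute elim!: dvdE)
      also have "(\<Sum>y\<in>(\<lambda>v. n * v) ` {..<w}. T (n ^ a * y)) = (\<Sum>v<w. T (n ^ Suc a * v))"
        by (subst sum.reindex) (use n_gt_0 in \<open>auto simp: inj_on_def mult_ac\<close>)
      also have "\<dots> = T (n ^ Suc a * 0) + (\<Sum>v\<in>{1..<w}. T (n ^ Suc a * v))" by (rule remove0)
      also have "T (n ^ Suc a * 0) = of_nat n * (GL 0 * of_nat (card I))" unfolding B1 by (simp add: S_def)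
      also have "(\<Sum>v\<in>{1..<w}. T (n ^ Suc a * v)) = of_nat n * of_nat c0 * HB"
        unfolding HB'[symmetric] sum_distrib_left by (intro sum.cong refl B2)
      finally show ?thesis .
    qed
    finally show "V' I A = of_nat n * (of_nat c0 * V I (b + s') + (GL 0 - of_nat c0 * GK 0) * of_nat (card I))"
      unfolding V by (simp add: algebra_simps)
  qed
qed

end

text \<open>With d = gcd y k, the quotient y / d is a unit modulo k / d. It is lifted to a number
  coprime to k n and then combined with 1 modulo p by the Chinese remainder theorem.\<close>

lemma exists_galois_exponent:
  fixes k n p y :: nat
  assumes k: "k > 0" "n > 0" and p: "coprime (k * n) p" "p > 1"
  obtains c where "coprime c (k * n * p)" "c > 0" "[c = 1] (mod p)" "[c * gcd y k = y] (mod k)"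
proof -
  define d where "d = gcd y k"
  have d0: "d > 0" using k by (simp add: d_def)
  obtain y' where y': "y = d * y'" unfolding d_def by (meson dvdE gcd_dvd1)
  obtain k' where k': "k = d * k'" unfolding d_def by (meson dvdE gcd_dvd2)
  have "coprime y' k'"
  proof -
    have "gcd (d * y') (d * k') = d" using y' k' d_def by metis
    then have "d * gcd y' k' = d * 1" by (simp only: gcd_mult_left) simp
    then have "gcd y' k' = 1" using d0 by simp
    then show ?thesis by (simp only: coprime_iff_gcd_eq_1)
  qed
  moreover have "k' dvd k * n" using k' by simp
  ultimately obtain c1 where c1: "[c1 = y'] (mod k')" "coprime c1 (k * n)"
    using exists_coprime_lift[of k' "k * n" y'] k by auto
  obtain c where c: "[c = c1] (mod k * n)" "[c = 1] (mod p)"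
    using binary_chinese_remainder_nat[OF p(1)] by blast
  have ckn: "coprime c (k * n)" using c(1) c1(2) by (meson cong_imp_coprime cong_sym)
  have cp: "coprime c p" using c(2) by (meson cong_imp_coprime cong_sym coprime_1_left)
  have "c > 0"
  proof (rule Nat.gr0I)
    assume "c = 0"
    then show False using cp p(2) by simp
  qed
  moreover have "[c * d = y] (mod k)"
  proof -
    have "[c = c1] (mod k')" using c(1) \<open>k' dvd k * n\<close> by (rule cong_dvd_modulus_nat)
    then have "[c = y'] (mod k')" using c1(1) by (rule cong_trans)
    then have "[d * c = d * y'] (mod d * k')" by (rule cong_cmult_leftI)
    then show ?thesis using y' k' by (simp add: mult.commute)
  qed
  ultimately show ?thesis using ckn cp c(2) by (intro that[of c]) (simp_all add: d_def)
qed

lemma int_adjoin_power_subset: "int_adjoin (x ^ m) \<subseteq> int_adjoin x"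
  by (auto simp: int_adjoin_def ipoly_pcompose_monom[symmetric])

lemma int_adjoin_zeta_subset: "m > 0 \<Longrightarrow> int_adjoin (zeta k) \<subseteq> int_adjoin (zeta (k * m))"
  using int_adjoin_power_subset[of "zeta (k * m)" m] by (simp add: zeta_power_mult)

lemma prime_ideal_over_contraction:
  assumes P: "prime_ideal_over (k * m) p P'" and m: "m > 0"
  shows "prime_ideal_over k p (P' \<inter> int_adjoin (zeta k))"
proof -
  note sub = int_adjoin_zeta_subset[OF m, of k]
  interpret B: primeideal P' "cyclotomic_ring (k * m)" using P by (simp add: prime_ideal_over_def)
  interpret A: cring "cyclotomic_ring k" by (rule cring_cyclotomic_ring)
  have int: "of_int a \<in> P' \<longleftrightarrow> int p dvd a" for a using P by (auto simp: prime_ideal_over_def)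
  have Psub: "P' \<subseteq> int_adjoin (zeta (k * m))" using B.a_subset by simp
  have add: "a + b \<in> P'" if "a \<in> P'" "b \<in> P'" for a b
    using additive_subgroup.a_closed[OF B.additive_subgroup_axioms, of a b] that by simp
  have mult: "b * a \<in> P'" if "a \<in> P'" "b \<in> int_adjoin (zeta (k * m))" for a b
    using B.I_l_closed[of a b] that by simp
  have "primeideal (P' \<inter> int_adjoin (zeta k)) (cyclotomic_ring k)"
  proof (rule primeidealI)
    show "ideal (P' \<inter> int_adjoin (zeta k)) (cyclotomic_ring k)"
    proof (rule idealI)
      show "ring (cyclotomic_ring k)" by (rule A.ring_axioms)
      show "subgroup (P' \<inter> int_adjoin (zeta k)) (add_monoid (cyclotomic_ring k))"
      proof (rule A.add.subgroupI)
        show "P' \<inter> int_adjoin (zeta k) \<noteq> {}" using int[of 0] by auto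
        show "\<ominus>\<^bsub>cyclotomic_ring k\<^esub> x \<in> P' \<inter> int_adjoin (zeta k)"
          if x: "x \<in> P' \<inter> int_adjoin (zeta k)" for x
        proof -
          have "\<ominus>\<^bsub>cyclotomic_ring k\<^esub> x = - x" using cyclotomic_ring_a_inv[of x k] x by simp
          moreover have "- x \<in> P'" using mult[of x "- 1"] x by auto
          ultimately show ?thesis using x by auto
        qed
      qed (auto simp: add)
      show "x \<otimes>\<^bsub>cyclotomic_ring k\<^esub> b \<in> P' \<inter> int_adjoin (zeta k)"
        if "b \<in> P' \<inter> int_adjoin (zeta k)" "x \<in> carrier (cyclotomic_ring k)" for b x
        using that mult[of b x] sub by auto
      show "b \<otimes>\<^bsub>cyclotomic_ring k\<^esub> x \<in> P' \<inter> int_adjoin (zeta k)"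
        if "b \<in> P' \<inter> int_adjoin (zeta k)" "x \<in> carrier (cyclotomic_ring k)" for b x
        using that mult[of b x] sub by (auto simp: mult.commute[of b])
    qed
    show "cring (cyclotomic_ring k)" by (rule cring_cyclotomic_ring)
    show "carrier (cyclotomic_ring k) \<noteq> P' \<inter> int_adjoin (zeta k)"
    proof
      assume h: "carrier (cyclotomic_ring k) = P' \<inter> int_adjoin (zeta k)"
      have "1 \<in> P' \<inter> int_adjoin (zeta k)" unfolding h[symmetric] by simp
      then have "\<one>\<^bsub>cyclotomic_ring (k * m)\<^esub> \<in> P'" by simp
      then show False using B.one_imp_carrier B.I_notcarr by simp
    qed
    show "x \<in> P' \<inter> int_adjoin (zeta k) \<or> y \<in> P' \<inter> int_adjoin (zeta k)"
      if "x \<in> carrier (cyclotomic_ring k)" "y \<in> carrier (cyclotomic_ring k)"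
        "x \<otimes>\<^bsub>cyclotomic_ring k\<^esub> y \<in> P' \<inter> int_adjoin (zeta k)" for x y
      using that B.I_prime[of x y] sub by auto
  qed
  moreover have "{a. of_int a \<in> P' \<inter> int_adjoin (zeta k)} = {a. int p dvd a}" using int by simp
  ultimately show ?thesis by (simp add: prime_ideal_over_def)
qed

section \<open>The inclusion of the residue field of P in that of P'\<close>

locale residue_ext = A: residue_gen k p P \<gamma> + B: residue_gen "k * n" p P' \<omega>
  for k p P \<gamma> P' \<omega> and n :: nat +
  assumes n: "odd n" "n dvd k" "prime n" and P_eq: "P = P' \<inter> int_adjoin (zeta k)"
    and ord_eq: "Pocklington.ord (k * n) p = Pocklington.ord k p * n"
begin

lemma sub: "A.Z \<subseteq> B.Z"
  by (rule int_adjoin_zeta_subset) (use n(3) prime_gt_0_nat in blast)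

lemma cl_eq: "a \<in> A.Z \<Longrightarrow> b \<in> A.Z \<Longrightarrow> B.cl a = B.cl b \<longleftrightarrow> A.cl a = A.cl b"
  using A.cl_eq_iff[of a b] B.cl_eq_iff[of a b] sub by (auto simp: P_eq)

text \<open>The choice of representative does not matter, as P is the contraction of P'.\<close>

definition \<iota> :: "complex set \<Rightarrow> complex set" where
  "\<iota> Y = B.cl (SOME a. a \<in> A.Z \<and> Y = A.cl a)"

lemma iota_cl: "a \<in> A.Z \<Longrightarrow> \<iota> (A.cl a) = B.cl a"
proof -
  assume a: "a \<in> A.Z"
  define b where "b = (SOME b. b \<in> A.Z \<and> A.cl a = A.cl b)"
  have "b \<in> A.Z \<and> A.cl a = A.cl b" unfolding b_def by (rule someI[of _ a]) (use a in simp)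
  then show ?thesis unfolding \<iota>_def b_def[symmetric] using cl_eq[OF a] by metis
qed

lemma iota_hom: "\<iota> \<in> ring_hom A.F B.F"
proof (rule ring_hom_memI)
  show "\<iota> x \<in> carrier B.F" if "x \<in> carrier A.F" for x
    using that sub by (auto elim!: A.carrierE simp: iota_cl)
  show "\<iota> (x \<otimes>\<^bsub>A.F\<^esub> y) = \<iota> x \<otimes>\<^bsub>B.F\<^esub> \<iota> y" if xy: "x \<in> carrier A.F" "y \<in> carrier A.F" for x y
  proof -
    obtain a b where ab: "a \<in> A.Z" "b \<in> A.Z" "x = A.cl a" "y = A.cl b" using xy by (metis A.carrierE)
    then show ?thesis using sub by (simp add: A.cl_mult[symmetric] iota_cl adj_mult) (simp add: B.cl_mult subset_iff)
  qed
  show "\<iota> (x \<oplus>\<^bsub>A.F\<^esub> y) = \<iota> x \<oplus>\<^bsub>B.F\<^esub> \<iota> y" if xy: "x \<in> carrier A.F" "y \<in> carrier A.F" for x y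
  proof -
    obtain a b where ab: "a \<in> A.Z" "b \<in> A.Z" "x = A.cl a" "y = A.cl b" using xy by (metis A.carrierE)
    then show ?thesis using sub by (simp add: A.cl_add[symmetric] iota_cl adj_add) (simp add: B.cl_add subset_iff)
  qed
  show "\<iota> \<one>\<^bsub>A.F\<^esub> = \<one>\<^bsub>B.F\<^esub>" by (simp add: A.cl_one[symmetric] iota_cl B.cl_one)
qed

sublocale h: ring_hom_cring A.F B.F \<iota>
  by unfold_locales (rule iota_hom)

lemma iota_inj: "inj_on \<iota> (carrier A.F)"
proof (rule inj_onI)
  fix x y assume xy: "x \<in> carrier A.F" "y \<in> carrier A.F" "\<iota> x = \<iota> y"
  obtain a b where ab: "a \<in> A.Z" "b \<in> A.Z" "x = A.cl a" "y = A.cl b" using xy by (metis A.carrierE)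
  then show "x = y" using xy(3) by (simp add: iota_cl cl_eq)
qed

lemma iota_pow: "x \<in> carrier A.F \<Longrightarrow> \<iota> (x [^]\<^bsub>A.F\<^esub> (i :: nat)) = \<iota> x [^]\<^bsub>B.F\<^esub> i"
  by (induction i) simp_all

lemma iota_nonzero: "x \<in> carrier A.F \<Longrightarrow> \<iota> x = \<zero>\<^bsub>B.F\<^esub> \<longleftrightarrow> x = \<zero>\<^bsub>A.F\<^esub>"
  using inj_onD[OF iota_inj, of x "\<zero>\<^bsub>A.F\<^esub>"] h.hom_zero by auto

abbreviation q :: nat where "q \<equiv> A.q"

lemma q_power: "B.q = q ^ n"
  by (simp add: ord_eq power_mult)

text \<open>The q images are fixed by x -> x^q, which has at most q fixed points.\<close>

lemma iota_image: "\<iota> ` carrier A.F = {x \<in> carrier B.F. x [^]\<^bsub>B.F\<^esub> q = x}"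
proof (rule card_seteq)
  show "finite {x \<in> carrier B.F. x [^]\<^bsub>B.F\<^esub> q = x}" using B.finite_F by simp
  show "\<iota> ` carrier A.F \<subseteq> {x \<in> carrier B.F. x [^]\<^bsub>B.F\<^esub> q = x}"
    using A.pow_q by (auto simp: iota_pow[symmetric])
  have "{x \<in> carrier B.F. x [^]\<^bsub>B.F\<^esub> q = x} \<subseteq> insert \<zero>\<^bsub>B.F\<^esub> {x \<in> carrier B.F. x [^]\<^bsub>B.F\<^esub> (q - 1) = \<one>\<^bsub>B.F\<^esub>}"
  proof
    fix x assume x: "x \<in> {x \<in> carrier B.F. x [^]\<^bsub>B.F\<^esub> q = x}"
    then have xc: "x \<in> carrier B.F" "x [^]\<^bsub>B.F\<^esub> q = x" by auto
    have "x \<otimes>\<^bsub>B.F\<^esub> x [^]\<^bsub>B.F\<^esub> (q - 1) = x [^]\<^bsub>B.F\<^esub> Suc (q - 1)" using B.F.nat_pow_Suc2[OF xc(1)] by simp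
    also have "Suc (q - 1) = q" using A.q_gt_1 by simp
    finally have "x \<otimes>\<^bsub>B.F\<^esub> x [^]\<^bsub>B.F\<^esub> (q - 1) = x \<otimes>\<^bsub>B.F\<^esub> \<one>\<^bsub>B.F\<^esub>" using xc by simp
    then have "x = \<zero>\<^bsub>B.F\<^esub> \<or> x [^]\<^bsub>B.F\<^esub> (q - 1) = \<one>\<^bsub>B.F\<^esub>"
      using xc B.F.m_lcancel[of x "x [^]\<^bsub>B.F\<^esub> (q - 1)" "\<one>\<^bsub>B.F\<^esub>"] by auto
    then show "x \<in> insert \<zero>\<^bsub>B.F\<^esub> {x \<in> carrier B.F. x [^]\<^bsub>B.F\<^esub> (q - 1) = \<one>\<^bsub>B.F\<^esub>}" using xc by auto
  qed
  then have "card {x \<in> carrier B.F. x [^]\<^bsub>B.F\<^esub> q = x}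
      \<le> card (insert \<zero>\<^bsub>B.F\<^esub> {x \<in> carrier B.F. x [^]\<^bsub>B.F\<^esub> (q - 1) = \<one>\<^bsub>B.F\<^esub>})"
    using B.finite_F by (intro card_mono) auto
  also have "\<dots> \<le> Suc (card {x \<in> carrier B.F. x [^]\<^bsub>B.F\<^esub> (q - 1) = \<one>\<^bsub>B.F\<^esub>})"
    using B.finite_F by (simp add: card_insert_if)
  also have "\<dots> \<le> Suc (q - 1)"
    using B.F.num_roots_le_deg[OF B.finite_F, of "q - 1"] A.q_gt_1 by simp
  also have "\<dots> = card (\<iota> ` carrier A.F)" using A.q_gt_1 A.card_F card_image[OF iota_inj] by simp
  finally show "card {x \<in> carrier B.F. x [^]\<^bsub>B.F\<^esub> q = x} \<le> card (\<iota> ` carrier A.F)" .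
qed

text \<open>The exponent (q' - 1) / (k n) is (q - 1) / k times r, where n r = 1 + q + ... + q^(n-1).
  As r is 1 modulo k, the extra power leaves a k-th root of unity unchanged.\<close>

lemma teichmueller_iota:
  assumes x: "x \<in> carrier A.F" "x \<noteq> \<zero>\<^bsub>A.F\<^esub>"
  shows "B.\<chi> (\<iota> x) = A.\<chi> x"
proof (rule B.teichmueller_unique)
  show "\<iota> x \<in> carrier B.F" "\<iota> x \<noteq> \<zero>\<^bsub>B.F\<^esub>" using x iota_nonzero by auto
  define z where "z = A.\<chi> x"
  have z: "z ^ k = 1" "A.cl z = x [^]\<^bsub>A.F\<^esub> ((q - 1) div k)"
    using A.teichmueller_props[OF x] by (simp_all add: z_def)
  show "A.\<chi> x ^ (k * n) = 1" unfolding z_def[symmetric] using z by (simp add: power_mult)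
  have zZ: "z \<in> A.Z" by (rule A.root_in_Z[OF z(1)])
  then have zB: "z \<in> B.Z" using sub by auto
  have n0: "n > 0" using n(3) prime_gt_0_nat by blast
  define s where "s = (\<Sum>i<n. q ^ i)"
  have s: "[s = n] (mod k * n)" unfolding s_def
    by (rule geometric_sum_cong[OF A.q_cong n(1,2)]) (use A.q_gt_1 in linarith)
  have "n dvd s" using s by (meson cong_dvd_iff cong_dvd_modulus_nat dvd_refl dvd_triv_right)
  then obtain r where r: "s = n * r" by (elim dvdE)
  have "[n * r = n * 1] (mod n * k)" using s unfolding r by (simp add: mult.commute)
  then have "n * (r mod k) = n * (1 mod k)" unfolding cong_def mod_mult_mult1 .
  then have rk: "[r = 1] (mod k)" using n0 unfolding cong_def by (simp only: mult_cancel1) simp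
  have qs: "q ^ n - 1 = (q - 1) * s"
  proof -
    have "int (q ^ n - 1) = int ((q - 1) * s)"
      using power_diff_1_eq[of "int q" n] A.q_gt_1 by (simp add: s_def of_nat_diff)
    then show ?thesis by (simp only: of_nat_eq_iff)
  qed
  obtain m where m: "q - 1 = k * m" using A.n_dvd by (elim dvdE)
  have e1: "(B.q - 1) div (k * n) = m * r"
  proof -
    have "B.q - 1 = k * n * (m * r)" unfolding q_power qs m r by simp
    then show ?thesis using A.n0 n0 by simp
  qed
  have e2: "(q - 1) div k = m" unfolding m using A.n0 by simp
  have zr: "z ^ r = z"
  proof -
    have pm: "z ^ i = z ^ (i mod k)" for i
    proof -
      have "z ^ i = (z ^ k) ^ (i div k) * z ^ (i mod k)"
        by (simp only: power_mult[symmetric] power_add[symmetric] mult_div_mod_eq)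
      then show ?thesis using z(1) by simp
    qed
    have "z ^ r = z ^ 1" using pm[of r] pm[of 1] rk by (simp only: cong_def)
    then show ?thesis by simp
  qed
  have "B.cl z = \<iota> x [^]\<^bsub>B.F\<^esub> m"
    using iota_cl[OF zZ] unfolding z(2) iota_pow[OF x(1)] e2 by simp
  moreover have "B.cl z = B.cl z [^]\<^bsub>B.F\<^esub> r" using B.cl_power[OF zB, of r] zr by simp
  ultimately have "B.cl z = \<iota> x [^]\<^bsub>B.F\<^esub> (m * r)" using x by (simp add: B.F.nat_pow_pow)
  then show "B.cl (A.\<chi> x) = \<iota> x [^]\<^bsub>B.F\<^esub> ((B.q - 1) div (k * n))" unfolding e1 z_def .
qed

lemma add_char_iota:
  assumes x: "x \<in> carrier A.F"
  shows "add_char B.F p r (\<iota> x) = add_char A.F p r x"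
proof -
  have tr: "abs_trace B.F p r (\<iota> x) = \<iota> (abs_trace A.F p r x)"
    unfolding abs_trace_def
    using h.hom_finsum[of "\<lambda>i. x [^]\<^bsub>A.F\<^esub> (p ^ i)" "{..<r}"] x by (simp add: comp_def iota_pow)
  have one: "[m] \<cdot>\<^bsub>B.F\<^esub> \<one>\<^bsub>B.F\<^esub> = \<iota> ([m] \<cdot>\<^bsub>A.F\<^esub> \<one>\<^bsub>A.F\<^esub>)" for m :: nat
    by (simp only: A.cl_of_nat[symmetric] B.cl_of_nat[symmetric] iota_cl[OF adj_of_nat])
  have trc: "abs_trace A.F p r x \<in> carrier A.F" unfolding abs_trace_def using x by simp
  have "\<iota> ([m] \<cdot>\<^bsub>A.F\<^esub> \<one>\<^bsub>A.F\<^esub>) = \<iota> (abs_trace A.F p r x) \<longleftrightarrow> [m] \<cdot>\<^bsub>A.F\<^esub> \<one>\<^bsub>A.F\<^esub> = abs_trace A.F p r x" for m :: nat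
    by (rule inj_on_eq_iff[OF iota_inj]) (use trc in simp_all)
  then show ?thesis unfolding add_char_def tr one by simp
qed

end

text \<open>The period k divides p^r - 1, so the p^r - 1 translates in the definition meet every
  value of W.\<close>

lemma char_values_eq_range:
  fixes W :: "nat \<Rightarrow> complex"
  assumes W: "\<And>b. (\<Sum>x\<in>(g [^]\<^bsub>F\<^esub> b) <#\<^bsub>mult_of F\<^esub> D. add_char F p r x) = W b"
    and per: "\<And>i j. [i = j] (mod k) \<Longrightarrow> W i = W j" and k: "k dvd p ^ r - 1" "p ^ r > 1"
  shows "char_values F p r g D = range W"
proof -
  have "char_values F p r g D = W ` {0..p ^ r - 2}" unfolding char_values_def W ..
  also have "\<dots> = range W"
  proof (intro equalityI subsetI)
    fix y assume "y \<in> range W"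
    then obtain b where b: "y = W b" by auto
    have "W b = W (b mod (p ^ r - 1))"
      using k by (intro per) (metis cong_dvd_modulus_nat cong_mod_right cong_refl)
    moreover have "b mod (p ^ r - 1) < p ^ r - 1" using k(2) by (intro mod_less_divisor) simp
    ultimately show "y \<in> W ` {0..p ^ r - 2}" using b by (intro image_eqI[of _ _ "b mod (p ^ r - 1)"]) auto
  qed auto
  finally show ?thesis .
qed

lemma card_range_affine:
  fixes W W' :: "nat \<Rightarrow> complex"
  assumes "c \<noteq> 0" and "\<And>a. \<exists>b. W' a = c * W b + d" and "\<And>b. \<exists>a. W' a = c * W b + d"
  shows "card (range W') = card (range W)"
proof -
  have "range W' = (\<lambda>z. c * z + d) ` range W"
  proof (intro equalityI subsetI)
    fix y assume "y \<in> range W'"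
    then obtain a where "y = W' a" by auto
    then show "y \<in> (\<lambda>z. c * z + d) ` range W" using assms(2)[of a] by auto
  next
    fix y assume "y \<in> (\<lambda>z. c * z + d) ` range W"
    then obtain b where "y = c * W b + d" by auto
    then show "y \<in> range W'" using assms(3)[of b] by (metis rangeI)
  qed
  moreover have "inj_on (\<lambda>z. c * z + d) (range W)" using assms(1) by (auto simp: inj_on_def)
  ultimately show ?thesis by (simp only: card_image)
qed

section \<open>From the hypotheses of the theorem to the two Fourier expansions\<close>

theorem theorem3p2:
  fixes t l h p e k k' f f' q q' :: nat
    and pr ex :: "nat \<Rightarrow> nat"
    and P P' \<gamma> \<omega> :: "complex set"
    and F F' :: "complex set ring"
    and \<chi> \<chi>' :: "complex set \<Rightarrow> complex"
    and J J1 J2 I :: "nat set"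
    and \<epsilon> :: complex
    and D D' :: "complex set set"
  assumes l: "l \<ge> 1"
    and pr: "\<forall>i\<in>{1..l}. prime (pr i) \<and> odd (pr i)" "inj_on pr {1..l}"
    and h: "h = 2 ^ t * (\<Prod>i\<in>{1..l}. pr i)"
    and p: "prime p" "\<not> p dvd h"
    and index: "\<forall>s\<le>t. \<forall>M\<subseteq>{1..l}. \<forall>x :: nat \<Rightarrow> nat. (\<forall>i\<in>M. x i \<ge> 1) \<longrightarrow>
        unit_index (2 ^ s * (\<Prod>i\<in>M. pr i ^ x i)) p = unit_index (2 ^ s * (\<Prod>i\<in>M. pr i)) p"
    and e: "e = unit_index h p"
    and ex: "\<forall>i\<in>{1..l}. ex i \<ge> 1"
    and k: "k = 2 ^ t * (\<Prod>i\<in>{1..l}. pr i ^ ex i)" "k' = k * pr 1"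
    and f: "f = totient k div e" "f' = totient k' div e"
    and q: "q = p ^ f" "q' = p ^ f'"
    and P: "prime_ideal_over k' p P'" "P = P' \<inter> carrier (cyclotomic_ring k)"
    and F: "F = residue_field k P" "F' = residue_field k' P'"
    and \<chi>: "\<chi> = teichmueller k P q" "\<chi>' = teichmueller k' P' q'"
    and \<gamma>\<omega>: "primitive_element F \<gamma>" "primitive_element F' \<omega>"
        "coherent_primitive_elements \<chi> \<gamma> \<chi>' \<omega> (pr 1)"
    and J: "J = {j. j > 0 \<and> j dvd k \<and> \<not> pr 1 ^ ex 1 dvd j}" "J1 \<union> J2 = J" "J1 \<inter> J2 = {}"
    and I: "I \<subseteq> {0..k - 1}"
    and i: "\<forall>j\<in>J1. (\<Sum>i\<in>I. zeta k ^ (i * j)) = 0"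
    and \<epsilon>: "\<epsilon> \<in> {1, -1}"
    and ii: "\<forall>j\<in>J2.
        relative_gauss_sum p F' f' (char_power \<chi>' (int j)) F f (char_power \<chi> (int j)) = \<epsilon>"
    and iii: "l \<ge> 2 \<or> t \<ge> 1 \<longrightarrow> (\<forall>v\<in>{1..k div pr 1 ^ ex 1 - 1}.
        gauss_sum F' p f' (char_power \<chi>' (- int (pr 1 ^ (ex 1 + 1) * v))) =
          \<epsilon> * complex_of_real (real p powr ((real (totient k') - real (totient k)) / (2 * real e)))
            * gauss_sum F p f (char_power \<chi> (- int (pr 1 ^ ex 1 * v))))"
    and D: "D = (\<Union>i\<in>I. cyclotomic_class F \<gamma> k i)"
        "D' = (\<Union>i\<in>I. \<Union>j\<in>{0..pr 1 - 1}.
                cyclotomic_class F' \<omega> (k * pr 1) (i * pr 1 + j * (k div pr 1 ^ ex 1)))"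
    and two_values: "card (char_values F p f \<gamma> D) = 2"
  shows "card (char_values F' p f' \<omega> D') = 2"
proof -
  define n a where "n = pr 1" and "a = ex 1"
  \<comment> \<open>The part of k prime to n, which is also the step k / n^a between the classes in
    D'.\<close>
  define w where "w = 2 ^ t * (\<Prod>i\<in>{2..l}. pr i ^ ex i)"
  have np: "prime n" "odd n" using pr(1) l by (auto simp: n_def)
  have n0: "n > 0" and n1: "n > 1" using np(1) prime_gt_0_nat prime_gt_1_nat by auto
  have a: "a \<ge> 1" using ex l by (auto simp: a_def)
  have split: "{1..l} = insert 1 {2..l}" using l by auto
  have prp: "prime (pr i)" if "i \<in> {1..l}" for i using pr(1) that by blast
  \<comment> \<open>The exponent of n is left free, since the orders of p are compared along all
    moduli w n^x.\<close>
  have prod_split: "2 ^ t * (\<Prod>i\<in>{1..l}. pr i ^ (if i = 1 then x else ex i)) = w * n ^ x" for x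
  proof -
    have "(\<Prod>i\<in>{1..l}. pr i ^ (if i = 1 then x else ex i)) = n ^ x * (\<Prod>i\<in>{2..l}. pr i ^ (if i = 1 then x else ex i))"
      unfolding split by (simp add: n_def)
    also have "(\<Prod>i\<in>{2..l}. pr i ^ (if i = 1 then x else ex i)) = (\<Prod>i\<in>{2..l}. pr i ^ ex i)"
      by (rule prod.cong) auto
    finally show ?thesis by (simp add: w_def mult_ac)
  qed
  have kw: "k = w * n ^ a"
  proof -
    have "(\<Prod>i\<in>{1..l}. pr i ^ ex i) = (\<Prod>i\<in>{1..l}. pr i ^ (if i = 1 then a else ex i))"
      by (rule prod.cong) (auto simp: a_def)
    then show ?thesis unfolding k(1) using prod_split[of a] by simp
  qed
  have k'n: "k' = k * n" using k(2) by (simp add: n_def)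
  have w0: "w > 0" unfolding w_def using prp by (auto intro!: prod_pos prime_gt_0_nat)
  have k0: "k > 0" unfolding kw using w0 n0 by simp
  have nw: "\<not> n dvd w"
  proof
    assume "n dvd w"
    then consider "n dvd 2 ^ t" | "n dvd (\<Prod>i\<in>{2..l}. pr i ^ ex i)"
      unfolding w_def using np(1) prime_dvd_mult_iff by blast
    then show False
    proof cases
      case 1
      then have "n dvd 2" using np(1) prime_dvd_power by blast
      then have "n = 2" using primes_dvd_imp_eq[OF np(1) two_is_prime_nat] by simp
      then show False using np(2) by simp
    next
      case 2
      then obtain i where i: "i \<in> {2..l}" "n dvd pr i ^ ex i"
        using prime_dvd_prod_iff[of "{2..l}" n "\<lambda>i. pr i ^ ex i"] np(1) by auto
      have il: "i \<in> {1..l}" using i(1) by auto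
      have "n dvd pr i" using i(2) np(1) prime_dvd_power by blast
      then have "pr 1 = pr i" using primes_dvd_imp_eq[OF np(1) prp[OF il]] by (simp add: n_def)
      moreover have "1 \<in> {1..l}" using l by simp
      ultimately have "1 = i" using inj_onD[OF pr(2)] il by blast
      then show False using i(1) by simp
    qed
  qed
  have pk: "\<not> p dvd k"
  proof
    assume "p dvd k"
    then consider "p dvd 2 ^ t" | "p dvd (\<Prod>i\<in>{1..l}. pr i ^ ex i)"
      unfolding k(1) using p(1) prime_dvd_mult_iff by blast
    then show False
    proof cases
      case 1 then show False using p(2) unfolding h by simp
    next
      case 2
      then obtain i where i: "i \<in> {1..l}" "p dvd pr i ^ ex i"
        using prime_dvd_prod_iff[of "{1..l}" p "\<lambda>i. pr i ^ ex i"] p(1) by auto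
      have "p dvd pr i" using i(2) p(1) prime_dvd_power by blast
      also have "pr i dvd (\<Prod>i\<in>{1..l}. pr i)" by (rule dvd_prodI) (use i in auto)
      finally show False using p(2) unfolding h by simp
    qed
  qed
  have cop_wn: "coprime w n" using prime_imp_coprime[OF np(1) nw] by (simp add: coprime_commute)
  have nk: "n dvd k" unfolding kw using a by (simp add: dvd_power)
  have cop_pk: "coprime p k" using p(1) pk prime_imp_coprime by blast
  have cop_pn: "coprime p n" using cop_pk nk by (metis coprime_commute coprime_divisors dvd_refl)
  have cop: "coprime p (w * n)" using cop_pk cop_pn unfolding kw by simp
  have pk': "\<not> p dvd k * n"
  proof
    assume "p dvd k * n"
    then have "p dvd n" using pk p(1) prime_dvd_mult_iff by blast
    then show False using cop_pn p(1) by (metis coprime_absorb_left not_prime_unit)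
  qed
  have idx: "unit_index (w * n ^ x) p = e" if x: "x \<ge> 1" for x
  proof -
    have "\<forall>i\<in>{1..l}. (if i = 1 then x else ex i) \<ge> 1" using x ex by auto
    then have "unit_index (2 ^ t * (\<Prod>i\<in>{1..l}. pr i ^ (if i = 1 then x else ex i))) p
        = unit_index (2 ^ t * (\<Prod>i\<in>{1..l}. pr i)) p"
      using index[rule_format, OF order_refl subset_refl, of "\<lambda>i. if i = 1 then x else ex i"] by simp
    then show ?thesis unfolding prod_split e h .
  qed
  note tower = ord_tower[OF np(1) nw w0 cop _ idx]
  have e0: "e > 0" using tower(3)[of 1] by simp
  have tk: "totient k = e * Pocklington.ord k p" unfolding kw by (rule tower(2)[OF a])
  have tk': "totient k' = e * Pocklington.ord (k * n) p"
    using tower(2)[of "Suc a"] unfolding k'n kw by (simp add: mult_ac)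
  have fo: "f = Pocklington.ord k p" using f(1) tk e0 by simp
  have fo': "f' = Pocklington.ord (k * n) p" using f(2) tk' e0 by simp
  have ordn: "Pocklington.ord (k * n) p = Pocklington.ord k p * n"
  proof -
    have "Pocklington.ord (w * n ^ Suc a) p = n * (n ^ (a - 1) * Pocklington.ord (w * n) p)"
      using tower(1)[of "Suc a"] a by (cases a) auto
    also have "n ^ (a - 1) * Pocklington.ord (w * n) p = Pocklington.ord (w * n ^ a) p"
      using tower(1)[OF a] by simp
    finally show ?thesis unfolding kw by (simp add: mult_ac)
  qed
  have f'n: "f' = f * n" unfolding fo fo' by (rule ordn)
  have P': "prime_ideal_over (k * n) p P'" using P(1) unfolding k'n .
  have Peq: "P = P' \<inter> int_adjoin (zeta k)" using P(2) by simp
  interpret residue_ext k p P \<gamma> P' \<omega> n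
  proof unfold_locales
    show "prime_ideal_over k p P" unfolding Peq by (rule prime_ideal_over_contraction[OF P' n0])
    show "primitive_element (residue_field k P) \<gamma>" using \<gamma>\<omega>(1) unfolding F(1) .
    show "primitive_element (residue_field (k * n) P') \<omega>" using \<gamma>\<omega>(2) unfolding F(2) k'n .
  qed (use k0 n0 p(1) pk pk' P' np nk Peq ordn in auto)
  have qA: "q = p ^ Pocklington.ord k p" using q(1) fo by simp
  have q'B: "q' = p ^ Pocklington.ord (k * n) p" using q(2) fo' by simp
  have q'n: "q' = q ^ n" unfolding q'B qA ordn by (simp add: power_mult)
  have FA: "F = A.F" by (rule F(1))
  have FB: "F' = B.F" using F(2) unfolding k'n .
  have chiA: "\<chi> = A.\<chi>" unfolding \<chi>(1) qA by (rule refl)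
  have chiB: "\<chi>' = B.\<chi>" unfolding \<chi>(2) q'B k'n by (rule refl)
  have frob_q: "(x \<oplus>\<^bsub>B.F\<^esub> y) [^]\<^bsub>B.F\<^esub> (p ^ i) = x [^]\<^bsub>B.F\<^esub> (p ^ i) \<oplus>\<^bsub>B.F\<^esub> y [^]\<^bsub>B.F\<^esub> (p ^ i)"
    if xy: "x \<in> carrier B.F" "y \<in> carrier B.F" for x y and i :: nat
  proof (induction i)
    case (Suc i)
    have s: "z [^]\<^bsub>B.F\<^esub> (p ^ Suc i) = (z [^]\<^bsub>B.F\<^esub> (p ^ i)) [^]\<^bsub>B.F\<^esub> p" if "z \<in> carrier B.F" for z
      using that by (simp add: B.F.nat_pow_pow mult.commute)
    show ?case using xy Suc B.frob_add by (simp add: s del: power_Suc)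
  qed (use xy in simp)
  interpret C: cyclo_ext B.F q n p f w a e \<chi>' \<omega>
  proof unfold_locales
    show "finite (carrier B.F)" by (rule B.finite_F)
    show "card (carrier B.F) = q ^ n" using B.card_F q'B q'n by simp
    show "q > 1" using A.q_gt_1 qA by simp
    show "(x \<oplus>\<^bsub>B.F\<^esub> y) [^]\<^bsub>B.F\<^esub> q = x [^]\<^bsub>B.F\<^esub> q \<oplus>\<^bsub>B.F\<^esub> y [^]\<^bsub>B.F\<^esub> q"
      if "x \<in> carrier B.F" "y \<in> carrier B.F" for x y
      unfolding qA using that by (rule frob_q)
    show "card {x \<in> carrier B.F. x [^]\<^bsub>B.F\<^esub> q = x} = q"
      unfolding qA iota_image[symmetric] using card_image[OF iota_inj] A.card_F by simp
    show "q = p ^ f" by (rule q(1))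
    show "f > 0" using A.f_gt_0 fo by simp
    show "[q = 1] (mod w * n ^ a)" using A.q_cong unfolding qA kw .
    show "[p] \<cdot>\<^bsub>B.F\<^esub> \<one>\<^bsub>B.F\<^esub> = \<zero>\<^bsub>B.F\<^esub>" by (rule B.char_p)
    show "\<omega> [^]\<^bsub>B.F\<^esub> (i :: nat) = \<one>\<^bsub>B.F\<^esub> \<longleftrightarrow> q ^ n - 1 dvd i" for i
      using B.g_order[of i] q'B q'n by simp
    show "carrier B.F - {\<zero>\<^bsub>B.F\<^esub>} = (\<lambda>i. \<omega> [^]\<^bsub>B.F\<^esub> i) ` {..<q ^ n - 1}"
      using B.g_powers q'B q'n by simp
    show "\<chi>' (\<omega> [^]\<^bsub>B.F\<^esub> (i :: nat)) = \<chi>' \<omega> ^ i" for i unfolding chiB by (rule B.teichmueller_power)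
    show "\<chi>' \<omega> ^ i = 1 \<longleftrightarrow> w * n ^ Suc a dvd i" for i
      using B.teichmueller_g_primitive[of i] unfolding chiB kw by (simp add: mult_ac)
  qed (use np p cop w0 nw a idx B.frob_add B.g_carrier in auto)
  have kC: "k = C.k" unfolding kw by (rule refl)
  \<comment> \<open>This is the only use of coherence: the root of unity that indexes the classes in
    D is the n-th power of the one for D'.\<close>
  have coh: "\<chi> \<gamma> = C.\<xi>" using \<gamma>\<omega>(3) by (simp add: coherent_primitive_elements_def n_def)
  have GL: "gauss_sum F' p f' (char_power \<chi>' j) = C.GL j" for j
    unfolding gauss_sum_def C.GL_def char_power_def FB f'n by (rule refl)
  have U0: "C.U0 = \<iota> ` (carrier A.F - {\<zero>\<^bsub>A.F\<^esub>})"
  proof -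
    have "C.base_field = \<iota> ` carrier A.F" unfolding C.base_field_def iota_image by (simp add: qA)
    moreover have "\<iota> ` carrier A.F - {\<zero>\<^bsub>B.F\<^esub>} = \<iota> ` (carrier A.F - {\<zero>\<^bsub>A.F\<^esub>})"
      using iota_nonzero by auto
    ultimately show ?thesis by simp
  qed
  have GK: "gauss_sum F p f (char_power \<chi> j) = C.GK j" for j
  proof -
    have "inj_on \<iota> (carrier A.F - {\<zero>\<^bsub>A.F\<^esub>})" using iota_inj by (rule inj_on_subset) auto
    then have "C.GK j = (\<Sum>x\<in>carrier A.F - {\<zero>\<^bsub>A.F\<^esub>}. \<chi>' (\<iota> x) powi j * add_char B.F p f (\<iota> x))"
      unfolding C.GK_def U0 by (simp add: sum.reindex)
    also have "\<dots> = gauss_sum F p f (char_power \<chi> j)"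
      unfolding gauss_sum_def char_power_def FA chiA chiB
      by (intro sum.cong refl) (simp add: teichmueller_iota add_char_iota)
    finally show ?thesis by simp
  qed
  have IK: "finite I" "\<And>i. i \<in> I \<Longrightarrow> i < k" using I k0 by (auto intro: finite_subset)
  have wdiv: "k div pr 1 ^ ex 1 = w" unfolding kw n_def[symmetric] a_def[symmetric] using n0 by simp
  have dvdk': "k * n dvd q ^ n - 1" using B.n_dvd q'B q'n by simp
  define W where "W b = C.V I b / of_nat k" for b
  define W' where "W' b = C.V' I b / of_nat (k * n)" for b
  have qn1: "q ^ n > 1" using B.q_gt_1 q'B q'n by simp
  have valA: "char_values F p f \<gamma> D = range W"
  proof (rule char_values_eq_range[where k = k])
    fix b
    have "of_nat k * (\<Sum>x\<in>(\<gamma> [^]\<^bsub>A.F\<^esub> b) <#\<^bsub>mult_of A.F\<^esub> (\<Union>i\<in>I. cyclotomic_class A.F \<gamma> k i). add_char A.F p f x)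
      = (\<Sum>j<k. (\<Sum>x\<in>carrier A.F - {\<zero>\<^bsub>A.F\<^esub>}. \<chi> x powi (- int j) * add_char A.F p f x) * C.\<xi> ^ (j * b) * (\<Sum>i\<in>I. C.\<xi> ^ (j * i)))"
    proof (rule A.F.period_sum[where Q = "q - 1"])
      show "finite (carrier A.F)" by (rule A.finite_F)
      show "\<gamma> \<in> carrier A.F" "\<gamma> \<noteq> \<zero>\<^bsub>A.F\<^esub>" using A.g_carrier by auto
      show "\<gamma> [^]\<^bsub>A.F\<^esub> (i :: nat) = \<one>\<^bsub>A.F\<^esub> \<longleftrightarrow> q - 1 dvd i" for i using A.g_order qA by simp
      show "q - 1 > 0" using C.q1 by simp
      show "k dvd q - 1" using A.n_dvd qA by simp
      show "carrier A.F - {\<zero>\<^bsub>A.F\<^esub>} = (\<lambda>i. \<gamma> [^]\<^bsub>A.F\<^esub> i) ` {..<q - 1}" using A.g_powers qA by simp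
      show "\<chi> (\<gamma> [^]\<^bsub>A.F\<^esub> (i :: nat)) = C.\<xi> ^ i" for i
        using A.teichmueller_power[of i] unfolding coh[symmetric] chiA .
      show "C.\<xi> ^ i = 1 \<longleftrightarrow> k dvd i" for i using C.xi_primitive kC by simp
      show "finite I" by (rule IK(1))
      show "s = s'" if "s \<in> I" "s' \<in> I" "[s = s'] (mod k)" for s s'
        using that IK(2) by (auto simp: cong_def)
    qed
    also have "\<dots> = C.V I b"
      unfolding C.V_def kC[symmetric] using GK by (simp add: gauss_sum_def char_power_def FA)
    finally show "(\<Sum>x\<in>(\<gamma> [^]\<^bsub>F\<^esub> b) <#\<^bsub>mult_of F\<^esub> D. add_char F p f x) = W b"
      unfolding W_def D(1) FA using k0 by (simp add: field_simps)
  next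
    fix i j :: nat assume "[i = j] (mod k)"
    then have "C.\<xi> ^ (m * i) = C.\<xi> ^ (m * j)" for m
      unfolding kC by (intro C.xi_cong cong_scalar_left)
    then show "W i = W j" unfolding W_def C.V_def by simp
  next
    show "k dvd p ^ f - 1" using A.n_dvd fo by simp
    show "p ^ f > 1" using A.q_gt_1 fo by simp
  qed
  have valB: "char_values F' p f' \<omega> D' = range W'"
  proof (rule char_values_eq_range[where k = "k * n"])
    fix b
    have "of_nat (k * n) * (\<Sum>x\<in>(\<omega> [^]\<^bsub>B.F\<^esub> b) <#\<^bsub>mult_of B.F\<^esub> (\<Union>s\<in>I \<times> {..<n}. cyclotomic_class B.F \<omega> (k * n) (fst s * n + snd s * w)). add_char B.F p (f * n) x)
      = (\<Sum>j<k * n. (\<Sum>x\<in>carrier B.F - {\<zero>\<^bsub>B.F\<^esub>}. \<chi>' x powi (- int j) * add_char B.F p (f * n) x) * \<chi>' \<omega> ^ (j * b) * (\<Sum>s\<in>I \<times> {..<n}. \<chi>' \<omega> ^ (j * (fst s * n + snd s * w))))"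
    proof (rule B.F.period_sum[where Q = "q ^ n - 1"])
      show "finite (carrier B.F)" by (rule B.finite_F)
      show "\<omega> \<in> carrier B.F" "\<omega> \<noteq> \<zero>\<^bsub>B.F\<^esub>" using B.g_carrier by auto
      show "\<omega> [^]\<^bsub>B.F\<^esub> (i :: nat) = \<one>\<^bsub>B.F\<^esub> \<longleftrightarrow> q ^ n - 1 dvd i" for i by (rule C.g(3))
      show "q ^ n - 1 > 0" using qn1 by simp
      show "k * n dvd q ^ n - 1" by (rule dvdk')
      show "carrier B.F - {\<zero>\<^bsub>B.F\<^esub>} = (\<lambda>i. \<omega> [^]\<^bsub>B.F\<^esub> i) ` {..<q ^ n - 1}" by (rule C.g(4))
      show "\<chi>' (\<omega> [^]\<^bsub>B.F\<^esub> (i :: nat)) = \<chi>' \<omega> ^ i" for i by (rule C.chi_power)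
      show "\<chi>' \<omega> ^ i = 1 \<longleftrightarrow> k * n dvd i" for i using C.chi_g[of i] unfolding kw by (simp add: mult_ac)
      show "finite (I \<times> {..<n})" using IK by simp
      show "s = s'" if s: "s \<in> I \<times> {..<n}" "s' \<in> I \<times> {..<n}"
        and c: "[fst s * n + snd s * w = fst s' * n + snd s' * w] (mod k * n)" for s s'
      proof -
        \<comment> \<open>Modulo n only the multiples of w survive, and w is prime to n; so the
          second components agree and the first ones remain to be compared modulo k.\<close>
        have "[fst s * n + snd s * w = fst s' * n + snd s' * w] (mod n)" using c by (rule cong_dvd_modulus_nat) simp
        then have "[snd s * w = snd s' * w] (mod n)" by (simp add: cong_def)
        then have "[snd s = snd s'] (mod n)" using cong_mult_rcancel_nat[OF cop_wn] by simp
        then have snd: "snd s = snd s'" using s by (auto simp: cong_def)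
        then have "[fst s * n = fst s' * n] (mod k * n)" using c by (simp add: cong_add_rcancel_nat)
        then have "(fst s mod k) * n = (fst s' mod k) * n" unfolding cong_def mod_mult_mult2 .
        then have "fst s = fst s'" using s IK(2) n0 by (auto simp: mem_Times_iff)
        then show ?thesis using snd by (simp add: prod_eq_iff)
      qed
    qed
    also have "\<dots> = C.V' I b"
      unfolding C.V'_def kC[symmetric] C.GL_def by (simp add: case_prod_unfold)
    finally have eq: "of_nat (k * n) * (\<Sum>x\<in>(\<omega> [^]\<^bsub>B.F\<^esub> b) <#\<^bsub>mult_of B.F\<^esub> (\<Union>s\<in>I \<times> {..<n}. cyclotomic_class B.F \<omega> (k * n) (fst s * n + snd s * w)). add_char B.F p (f * n) x) = C.V' I b" .
    have "{0..pr 1 - 1} = {..<n}" using n0 by (auto simp: n_def)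
    then have D'eq: "D' = (\<Union>s\<in>I \<times> {..<n}. cyclotomic_class B.F \<omega> (k * n) (fst s * n + snd s * w))"
      unfolding D(2) wdiv FB by (auto simp: n_def)
    show "(\<Sum>x\<in>(\<omega> [^]\<^bsub>F'\<^esub> b) <#\<^bsub>mult_of F'\<^esub> D'. add_char F' p f' x) = W' b"
      unfolding W'_def D'eq FB f'n eq[symmetric] using k0 n0 by simp
  next
    fix i j :: nat assume ij: "[i = j] (mod k * n)"
    have "\<chi>' \<omega> ^ (m * i) = \<chi>' \<omega> ^ (m * j)" for m
    proof -
      have "\<chi>' \<omega> powi int (m * i) = \<chi>' \<omega> powi int (m * j)"
        by (rule C.powi_mod[where m = "k * n"])
          (use C.chi_g_k' k0 n0 cong_scalar_left[OF ij, of m] in \<open>auto simp only: kC cong_int_iff nat_0_less_mult_iff\<close>)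
      then show ?thesis by (simp only: power_int_of_nat)
    qed
    then show "W' i = W' j" unfolding W'_def C.V'_def by simp
  next
    show "k * n dvd p ^ f' - 1" using B.n_dvd fo' by simp
    show "p ^ f' > 1" using B.q_gt_1 fo' by simp
  qed
  have c0: "real p powr (real (f * (n - 1)) / 2) = real C.c0"
  proof -
    define m where "m = n div 2"
    have m: "n = 2 * m + 1" using odd_two_times_div_two_succ[OF np(2)] by (simp add: m_def)
    have half: "real (f * (n - 1)) / 2 = real (f * ((n - 1) div 2))" unfolding m by simp
    have "real p > 0" using prime_gt_0_nat[OF p(1)] by simp
    then have "real p powr (real (f * (n - 1)) / 2) = real p ^ (f * ((n - 1) div 2))"
      unfolding half by (rule powr_realpow)
    then show ?thesis unfolding C.c0_def by (simp add: q(1) power_mult)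
  qed
  have half1: "(real f' - real f) / 2 = real (f * (n - 1)) / 2"
    unfolding f'n using n0 by (simp add: of_nat_diff algebra_simps)
  have half2: "(real (totient k') - real (totient k)) / (2 * real e) = real (f * (n - 1)) / 2"
  proof -
    have "real (totient k') - real (totient k) = real e * real (f * (n - 1))"
      unfolding tk tk' ordn fo using n0 by (simp add: of_nat_diff algebra_simps)
    then show ?thesis using e0 by (simp add: field_simps)
  qed
  have J2: "C.GL (int d) = \<epsilon> * of_nat C.c0 * C.GK (int d)" "C.GK (int d) \<noteq> 0" if d: "d \<in> J2" for d
  proof -
    have r: "C.GL (int d) / (of_nat C.c0 * C.GK (int d)) = \<epsilon>"
      using ii d unfolding relative_gauss_sum_def GL GK half1 c0 by simp
    have "\<epsilon> \<noteq> 0" using \<epsilon> by auto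
    then have "of_nat C.c0 * C.GK (int d) \<noteq> 0" using r by (metis div_by_0)
    then show "C.GL (int d) = \<epsilon> * of_nat C.c0 * C.GK (int d)" "C.GK (int d) \<noteq> 0"
      using r by (auto simp: field_simps)
  qed
  have h3: "C.GL (- int (n ^ Suc a * v)) = \<epsilon> * of_nat C.c0 * C.GK (- int (n ^ a * v))" if v: "v \<in> {1..<w}" for v
  proof -
    \<comment> \<open>If n is the only prime factor of k, then w = 1 and there is no v to
      consider.\<close>
    have "l \<ge> 2 \<or> t \<ge> 1"
    proof (rule ccontr)
      assume "\<not> ?thesis"
      then have "t = 0" "{2..l} = {}" using l by auto
      then have "w = 1" unfolding w_def by simp
      then show False using v by simp
    qed
    then have "\<forall>v\<in>{1..w - 1}. C.GL (- int (n ^ (a + 1) * v)) = \<epsilon> * of_nat C.c0 * C.GK (- int (n ^ a * v))"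
      using iii wdiv unfolding GL GK half2 c0 n_def[symmetric] a_def[symmetric] by simp
    moreover have "v \<in> {1..w - 1}" using v by auto
    ultimately show ?thesis by (metis Suc_eq_plus1)
  qed
  have hS: "(\<Sum>i\<in>I. C.\<xi> ^ (j * i)) = 0 \<or> C.GL (- int j) = \<epsilon> * of_nat C.c0 * C.GK (- int j) \<and> C.GK (- int j) \<noteq> 0"
    if jC: "j < C.k" "\<not> n ^ a dvd j" for j
  proof -
    have j: "j < k" "\<not> n ^ a dvd j" using jC by (simp_all only: kw[symmetric] not_False_eq_True)
    \<comment> \<open>d lies in J because n^a does not divide j. Hypotheses (i) and (ii) are known
      at d and are carried to j by a Galois conjugation.\<close>
    define d where "d = gcd j k"
    have "d > 0" "d dvd k" unfolding d_def using k0 by auto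
    moreover have "\<not> n ^ a dvd d" using j(2) unfolding d_def by auto
    ultimately have "d \<in> J1 \<union> J2" using J by (auto simp: n_def a_def)
    then consider "d \<in> J1" | "d \<in> J2" by blast
    then show ?thesis
    proof cases
      case 1
      \<comment> \<open>\<open>\<xi>\<close> need not be zeta_k itself, only a primitive k-th root
        of unity; u is the corresponding exponent, coprime to k.\<close>
      obtain u where u: "C.\<xi> = zeta k ^ u"
        using range_zeta[OF k0] C.xi_primitive[of k] kC by auto
      have "gcd (u * j) k = d"
      proof -
        have "coprime u k"
        proof (rule ccontr)
          assume nc: "\<not> coprime u k"
          define r where "r = gcd u k"
          have r: "r \<noteq> 1" using nc unfolding r_def coprime_iff_gcd_eq_1 .
          have "r dvd u" "r dvd k" by (simp_all add: r_def)
          then obtain u1 k1 where uk: "u = r * u1" "k = r * k1" by (elim dvdE)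
          have "C.\<xi> ^ k1 = (zeta k ^ k) ^ u1" unfolding u uk(1) by (subst (3) uk(2)) (simp add: power_mult[symmetric] mult_ac)
          then have "k dvd k1" using C.xi_primitive[of k1] kC by simp
          then have "r * k1 \<le> k1" using k0 uk(2) by (metis dvd_imp_le nat_0_less_mult_iff)
          then show False using r k0 uk(2) by (metis One_nat_def Suc_leI le_antisym mult_le_cancel2 nat_0_less_mult_iff nat_mult_1)
        qed
        then show ?thesis unfolding d_def by (simp add: gcd_mult_left_left_cancel coprime_commute)
      qed
      moreover have "coprime (k * n) 1" by simp
      ultimately obtain c where c: "coprime c k" "c > 0" "[c * d = u * j] (mod k)"
      proof -
        have cp: "coprime (k * n) p" using cop_pk cop_pn by (simp add: coprime_commute)
        from exists_galois_exponent[OF k0 n0 cp, of "u * j"] C.p_gt_1 \<open>gcd (u * j) k = d\<close>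
        obtain c where "coprime c (k * n * p)" "c > 0" "[c * d = u * j] (mod k)" by metis
        from this(1) have "coprime c k" by simp
        then show ?thesis using \<open>c > 0\<close> \<open>[c * d = u * j] (mod k)\<close> by (rule that)
      qed
      \<comment> \<open>The sum in (i) as an integer polynomial evaluated at zeta_k, so that its
        vanishing passes to the conjugate zeta_k^c.\<close>
      define G where "G = (\<Sum>i\<in>I. Polynomial.monom (1 :: int) (i * d))"
      have Gx: "ipoly G x = (\<Sum>i\<in>I. x ^ (i * d))" for x
        unfolding G_def using IK(1) by (induction I rule: finite_induct) (simp_all add: ipoly_add ipoly_monom)
      have "ipoly G (zeta k) = 0" using i 1 unfolding Gx by simp
      then have "ipoly G (zeta k ^ c) = 0" by (rule ipoly_root_power_coprime[OF k0 zeta_power_self c(1,2)])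
      moreover have "(zeta k ^ c) ^ (i * d) = C.\<xi> ^ (j * i)" for i
      proof -
        have "zeta k powi int (c * d * i) = zeta k powi int (u * j * i)"
          by (rule C.powi_mod[OF zeta_power_self k0]) (use cong_scalar_right[OF c(3), of i] in \<open>simp only: cong_int_iff\<close>)
        then have "zeta k ^ (c * d * i) = zeta k ^ (u * j * i)" by (simp only: power_int_of_nat)
        then show ?thesis unfolding u by (simp add: power_mult[symmetric] mult_ac)
      qed
      ultimately have "(\<Sum>i\<in>I. C.\<xi> ^ (j * i)) = 0" unfolding Gx by simp
      then show ?thesis ..
    next
      case 2
      have "j \<noteq> 0" using j(2) by (intro notI) simp
      \<comment> \<open>Fourier inversion asks for the exponent -j, represented among natural
        numbers by k - j, which has the same greatest common divisor with k.\<close>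
      have "gcd (k - j) k = d" unfolding d_def using j(1)
        by (metis gcd.commute gcd_diff2_nat less_imp_le)
      moreover have cp: "coprime (k * n) p" using cop_pk cop_pn by (simp add: coprime_commute)
      ultimately obtain c where c: "coprime c (k * n * p)" "c > 0" "[c = 1] (mod p)" "[c * d = k - j] (mod k)"
        using exists_galois_exponent[OF k0 n0 cp C.p_gt_1, of "k - j"] by metis
      have cN: "coprime c C.N" using c(1) unfolding C.N_def kC[symmetric] .
      note G = C.gauss_galois[OF cN c(2,3) \<epsilon> J2[OF 2]]
      have "[int (c * d) = int (k - j)] (mod int k)" using c(4) by (simp only: cong_int_iff)
      moreover have "int (k - j) = - int j + int k" using j(1) by (simp add: of_nat_diff)
      ultimately have cd: "[int (c * d) = - int j] (mod int k)" by (simp add: cong_def)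
      have K: "C.GK (int (c * d)) = C.GK (- int j)" 
        by (rule C.GK_cong) (use cd in \<open>simp only: kw[symmetric]\<close>)
      \<comment> \<open>The exponents agree only modulo k. That is enough for GK; for GL it is
        \<open>GL_periodic\<close>, available as n^a does not divide j.\<close>
      obtain z where z: "int (c * d) = - int j + int k * z" using cd by (metis cong_iff_lin cong_sym)
      have "\<not> int n ^ a dvd - int j" using j(2)
        by (simp only: dvd_minus_iff of_nat_power[symmetric] int_dvd_int_iff not_False_eq_True)
      then have "C.GL (- int j + int C.k * z) = C.GL (- int j)" by (rule C.GL_periodic)
      moreover have "int (c * d) = - int j + int C.k * z" using z by (simp only: kw[symmetric])
      ultimately have L: "C.GL (int (c * d)) = C.GL (- int j)" by (simp only:)
      show ?thesis using G unfolding K L by blast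
    qed
  qed
  obtain s' where s': "\<And>A b m. m < n \<Longrightarrow> A + m * w = n * b \<Longrightarrow>
      C.V' I A = of_nat n * (of_nat C.c0 * C.V I (b + s') + (C.GL 0 - of_nat C.c0 * C.GK 0) * of_nat (card I))"
    using C.V'_eq_V[OF IK(1) \<epsilon> hS h3] by metis
  define K where "K = (C.GL 0 - of_nat C.c0 * C.GK 0) * of_nat (card I) / of_nat k"
  have WW: "W' A = of_nat C.c0 * W (b + s') + K" if "m < n" "A + m * w = n * b" for A b m
    unfolding W'_def W_def K_def s'[OF that] using k0 n0 by (simp add: field_simps)
  have "card (range W') = card (range W)"
  proof (rule card_range_affine[where c = "of_nat C.c0" and d = K])
    show "of_nat C.c0 \<noteq> (0 :: complex)" using C.q1 by (simp add: C.c0_def)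
    show "\<exists>b. W' A = of_nat C.c0 * W b + K" for A
    proof -
      obtain y where y: "[w * y = Suc 0] (mod n)" using cong_solve_coprime_nat[OF cop_wn] by blast
      \<comment> \<open>m w is -A modulo n: y inverts w, and n - A mod n stands for -A.\<close>
      define m where "m = (y * (n - A mod n)) mod n"
      have "m < n" unfolding m_def using n0 by simp
      moreover have "n dvd A + m * w"
      proof -
        have "[m * w = y * (n - A mod n) * w] (mod n)" unfolding m_def by (intro cong_scalar_right) simp
        also have "y * (n - A mod n) * w = (w * y) * (n - A mod n)" by (simp add: mult_ac)
        also have "[(w * y) * (n - A mod n) = 1 * (n - A mod n)] (mod n)" using y by (intro cong_scalar_right) simp
        finally have "[A + m * w = A + (n - A mod n)] (mod n)" by (simp add: cong_add_lcancel_nat)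
        also have "[A + (n - A mod n) = A mod n + (n - A mod n)] (mod n)" by (intro cong_add) auto
        also have "A mod n + (n - A mod n) = n" using n0 by (simp add: less_imp_le)
        finally have "(A + m * w) mod n = 0" by (simp add: cong_def)
          then show ?thesis by (rule mod_0_imp_dvd)
      qed
      ultimately obtain b where "A + m * w = n * b" by (elim dvdE)
      then show ?thesis using WW[OF \<open>m < n\<close>] by blast
    qed
    show "\<exists>A. W' A = of_nat C.c0 * W b + K" for b
    proof -
      have per: "W i = W j" if "[i = j] (mod k)" for i j
      proof -
        have "C.\<xi> ^ (m * i) = C.\<xi> ^ (m * j)" for m
          unfolding kC by (intro C.xi_cong cong_scalar_left) (use that kC in simp)
        then show ?thesis unfolding W_def C.V_def by simp
      qed
      \<comment> \<open>b1 represents b - s' modulo k, so the translate A = n b1, with m = 0,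
        attains the value belonging to b.\<close>
      define b1 where "b1 = b + (k - s' mod k)"
      have "[b1 + s' = b] (mod k)"
      proof -
        have "[b1 + s' = b + (k - s' mod k) + s' mod k] (mod k)" unfolding b1_def by (intro cong_add) auto
        also have "b + (k - s' mod k) + s' mod k = b + k" using mod_less_divisor[OF k0, of s'] by linarith
        also have "[b + k = b] (mod k)" by (simp add: cong_def)
        finally show ?thesis .
      qed
      then have "W (b1 + s') = W b" by (rule per)
      moreover have "W' (n * b1) = of_nat C.c0 * W (b1 + s') + K" by (rule WW[of 0]) (use n0 in auto)
      ultimately show ?thesis by metis
    qed
  qed
  then show ?thesis using two_values unfolding valA valB by simp
qed

end
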